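(* Consider two stochastic systems $(\Phi,B,C)$ on $X$ and $(\widetilde\Phi,\widetilde B,\widetilde C)$ on $\widetilde X$ with the same input space $\mathbb R^n$ and output space $\mathbb R^m$, such that the flows $\Phi$ and $\widetilde\Phi$ are independent, exponentially stable in mean square sense, and define $C_b$-Markov semigroups. Then for every control $u\in\mathcal H_2^{(0,\infty)}(\mathbb R^n)$, with zero initial conditions, $$\sup_{t\in(0,\infty)}\mathbb E\|CY_t(u)-\widetilde C\widetilde Y_t(u)\|_{\mathbb R^m}\le2\|H-\widetilde H\|_{\mathrm{TC}}\,\|u\|_{\mathcal H_2^{(0,\infty)}(\mathbb R^n)}.$$
   Context: Fix a filtered probability space $(\Omega,\mathcal F,(\mathcal F_t),\mathbb P)$ with the usual conditions. A stochastic system consists of a real separable Hilbert space $X$, $C\in\mathcal L(X,\mathbb R^m)$, $Bu=\sum_{i=1}^n\psi_iu_i$ with $\psi_i\in X$, and a stochastic flow $(\Phi(t,s))_{0\le s\le t}$ of random operators in $\mathcal L(X)$, $\Phi(t):=\Phi(t,0)$. Exponential stability in mean square sense: there is $c>0$ with $\mathbb E\|\Phi(t)\varphi_0\|^2\lesssim e^{-ct}\|\varphi_0\|^2$. Defining a (time-homogeneous) $C_b$-Markov semigroup: $P(t)f(x):=\mathbb Ef(\Phi(s+t,s)x)$ is independent of $s\ge0$ and $P(t+s)=P(t)P(s)$, for all $f$ with $f(\Phi(t,s)x)$ integrable. $Y_t(u)=\int_0^t\Phi(t,s)Bu(s)ds$. With $\Omega_{(0,\infty)}=(0,\infty)\times\Omega$: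 $W:X\to L^2(\Omega_{(0,\infty)},\mathbb R^m)$, $(Wx)(t,\omega)=C\Phi(t,\omega)x$; $R:L^2(\Omega_{(0,\infty)},\mathbb R^n)\to X$, $Rf=\mathbb E\int_0^\infty\sum_i\Phi(s)\psi_i\langle f(s),\widehat e_i\rangle ds$; Hankel operator $H=WR$; likewise $\widetilde Y,\widetilde H$ for the second system. $\mathcal H_2^{(0,\infty)}(\mathbb R^n)$ is the Banach space of jointly measurable, $(\mathcal F_t)$-adapted $\mathbb R^n$-valued processes $u$ with norm $\|u\|=\sup_{t\in(0,\infty)}(\mathbb E\|u(t)\|^2_{\mathbb R^n})^{1/2}<\infty$. $\|\cdot\|_{\mathrm{TC}}$ is the trace norm. *)

theory Defs
  imports "HOL-Probability.Probability"
begin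

definition usual_filtration :: "'a measure \<Rightarrow> (real \<Rightarrow> 'a measure) \<Rightarrow> bool" where
  "usual_filtration M F \<longleftrightarrow>
     filtration (space M) F \<and>
     (\<forall>t. subalgebra M (F t)) \<and>
     (\<forall>A B. A \<in> null_sets M \<and> B \<subseteq> A \<longrightarrow> B \<in> sets M) \<and>
     (\<forall>t\<ge>0. \<forall>N \<in> null_sets M. N \<in> sets (F t)) \<and>
     (\<forall>t\<ge>0. sets (F t) = (\<Inter>s\<in>{t<..}. sets (F s)))"

definition stoch_flow ::
  "'a measure \<Rightarrow> (real \<Rightarrow> 'a measure) \<Rightarrow> (real \<Rightarrow> real \<Rightarrow> 'a \<Rightarrow> 'x::{real_inner,banach,second_countable_topology} \<Rightarrow> 'x) \<Rightarrow> bool" where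
  "stoch_flow M F Phi \<longleftrightarrow>
     (\<forall>t s w. 0 \<le> s \<and> s \<le> t \<and> w \<in> space M \<longrightarrow> bounded_linear (Phi t s w)) \<and>
     (\<forall>t w. 0 \<le> t \<and> w \<in> space M \<longrightarrow> Phi t t w = id) \<and>
     (\<forall>t s r w. 0 \<le> r \<and> r \<le> s \<and> s \<le> t \<and> w \<in> space M \<longrightarrow> Phi t s w \<circ> Phi s r w = Phi t r w) \<and>
     (\<forall>t s x. 0 \<le> s \<and> s \<le> t \<longrightarrow> (\<lambda>w. Phi t s w x) \<in> borel_measurable (F t)) \<and>
     (\<forall>x. (\<lambda>((t, s), w). Phi t s w x) \<in>
          borel_measurable (restrict_space (lborel \<Otimes>\<^sub>M lborel) {(t, s). 0 \<le> s \<and> s \<le> t} \<Otimes>\<^sub>M M))"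

definition ms_exp_stable ::
  "'a measure \<Rightarrow> (real \<Rightarrow> real \<Rightarrow> 'a \<Rightarrow> 'x::real_normed_vector \<Rightarrow> 'x) \<Rightarrow> bool" where
  "ms_exp_stable M Phi \<longleftrightarrow> (\<exists>c>0. \<exists>K. \<forall>t\<ge>0. \<forall>x.
     (\<integral>\<^sup>+ w. ennreal ((norm (Phi t 0 w x))\<^sup>2) \<partial>M) \<le> ennreal (K * exp (- c * t) * (norm x)\<^sup>2))"

definition trans_op ::
  "'a measure \<Rightarrow> (real \<Rightarrow> real \<Rightarrow> 'a \<Rightarrow> 'x \<Rightarrow> 'x) \<Rightarrow> real \<Rightarrow> ('x \<Rightarrow> real) \<Rightarrow> 'x \<Rightarrow> real" where
  "trans_op M Phi t f x = (\<integral>w. f (Phi t 0 w x) \<partial>M)"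

definition markov_sg ::
  "'a measure \<Rightarrow> (real \<Rightarrow> real \<Rightarrow> 'a \<Rightarrow> 'x::{real_normed_vector,second_countable_topology} \<Rightarrow> 'x) \<Rightarrow> bool" where
  "markov_sg M Phi \<longleftrightarrow> (\<forall>f :: 'x \<Rightarrow> real.
     (\<forall>t s x. 0 \<le> s \<and> s \<le> t \<longrightarrow> integrable M (\<lambda>w. f (Phi t s w x))) \<longrightarrow>
       (\<forall>t s x. 0 \<le> t \<and> 0 \<le> s \<longrightarrow>
          (\<integral>w. f (Phi (s + t) s w x) \<partial>M) = trans_op M Phi t f x) \<and>
       (\<forall>t s x. 0 \<le> t \<and> 0 \<le> s \<longrightarrow>
          trans_op M Phi (t + s) f x = trans_op M Phi t (trans_op M Phi s f) x))"

definition flow_index :: "(real \<times> real \<times> 'x) set" where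
  "flow_index = {(t, s, x). 0 \<le> s \<and> s \<le> t}"

definition flows_indep ::
  "'a measure \<Rightarrow> (real \<Rightarrow> real \<Rightarrow> 'a \<Rightarrow> 'x::topological_space \<Rightarrow> 'x)
     \<Rightarrow> (real \<Rightarrow> real \<Rightarrow> 'a \<Rightarrow> 'y::topological_space \<Rightarrow> 'y) \<Rightarrow> bool" where
  "flows_indep M Phi Psi \<longleftrightarrow>
     prob_space.indep_set M
       (sets (vimage_algebra (space M) (\<lambda>w. restrict (\<lambda>(t, s, x). Phi t s w x) flow_index)
                (Pi\<^sub>M flow_index (\<lambda>_. borel))))
       (sets (vimage_algebra (space M) (\<lambda>w. restrict (\<lambda>(t, s, y). Psi t s w y) flow_index)
                (Pi\<^sub>M flow_index (\<lambda>_. borel))))"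

definition input_op :: "('n::finite \<Rightarrow> 'x::real_vector) \<Rightarrow> real^'n \<Rightarrow> 'x" where
  "input_op psi v = (\<Sum>i\<in>UNIV. (v $ i) *\<^sub>R psi i)"

definition state_resp ::
  "(real \<Rightarrow> real \<Rightarrow> 'a \<Rightarrow> 'x::{banach,second_countable_topology} \<Rightarrow> 'x) \<Rightarrow> ('n::finite \<Rightarrow> 'x)
     \<Rightarrow> (real \<Rightarrow> 'a \<Rightarrow> real^'n) \<Rightarrow> real \<Rightarrow> 'a \<Rightarrow> 'x" where
  "state_resp Phi psi u t w = (LINT s:{0<..t}|lborel. Phi t s w (input_op psi (u s w)))"

definition Omega_pos :: "'a measure \<Rightarrow> (real \<times> 'a) measure" where
  "Omega_pos M = restrict_space lborel {0<..} \<Otimes>\<^sub>M M"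

definition obs_op ::
  "(real \<Rightarrow> real \<Rightarrow> 'a \<Rightarrow> 'x \<Rightarrow> 'x) \<Rightarrow> ('x \<Rightarrow> real^'m) \<Rightarrow> 'x \<Rightarrow> real \<times> 'a \<Rightarrow> real^'m" where
  "obs_op Phi C x = (\<lambda>(t, w). C (Phi t 0 w x))"

definition reach_op ::
  "'a measure \<Rightarrow> (real \<Rightarrow> real \<Rightarrow> 'a \<Rightarrow> 'x::{banach,second_countable_topology} \<Rightarrow> 'x)
     \<Rightarrow> ('n::finite \<Rightarrow> 'x) \<Rightarrow> (real \<times> 'a \<Rightarrow> real^'n) \<Rightarrow> 'x" where
  "reach_op M Phi psi f =
     (\<integral>w. (LINT s:{0<..}|lborel. Phi s 0 w (input_op psi (f (s, w)))) \<partial>M)"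

definition hankel ::
  "'a measure \<Rightarrow> (real \<Rightarrow> real \<Rightarrow> 'a \<Rightarrow> 'x::{banach,second_countable_topology} \<Rightarrow> 'x)
     \<Rightarrow> ('n::finite \<Rightarrow> 'x) \<Rightarrow> ('x \<Rightarrow> real^'m) \<Rightarrow> (real \<times> 'a \<Rightarrow> real^'n) \<Rightarrow> real \<times> 'a \<Rightarrow> real^'m" where
  "hankel M Phi psi C f = obs_op Phi C (reach_op M Phi psi f)"

definition L2 :: "'b measure \<Rightarrow> ('b \<Rightarrow> 'v::euclidean_space) set" where
  "L2 mu = {f. f \<in> borel_measurable mu \<and> integrable mu (\<lambda>z. (norm (f z))\<^sup>2)}"

definition L2_inner :: "'b measure \<Rightarrow> ('b \<Rightarrow> 'v::euclidean_space) \<Rightarrow> ('b \<Rightarrow> 'v) \<Rightarrow> real" where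
  "L2_inner mu f g = (\<integral>z. f z \<bullet> g z \<partial>mu)"

definition L2_orthonormal :: "'b measure \<Rightarrow> nat \<Rightarrow> (nat \<Rightarrow> 'b \<Rightarrow> 'v::euclidean_space) \<Rightarrow> bool" where
  "L2_orthonormal mu k e \<longleftrightarrow> (\<forall>i<k. e i \<in> L2 mu) \<and>
     (\<forall>i<k. \<forall>j<k. L2_inner mu (e i) (e j) = (if i = j then 1 else 0))"

text \<open>Trace norm of T : L^2(mu) -> L^2(nu):
  ||T||_TC = sup { sum_i |<T e_i, f_i>| : (e_i), (f_i) orthonormal systems }
  (value infinity if T is not trace class).\<close>

definition trace_norm ::
  "'b measure \<Rightarrow> 'c measure \<Rightarrow> (('b \<Rightarrow> 'v::euclidean_space) \<Rightarrow> ('c \<Rightarrow> 'w::euclidean_space)) \<Rightarrow> ennreal" where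
  "trace_norm mu nu T = (SUP (k, e, f) \<in> {(k, e, f). L2_orthonormal mu k e \<and> L2_orthonormal nu k f}.
      ennreal (\<Sum>i<k. \<bar>L2_inner nu (T (e i)) (f i)\<bar>))"

definition H2 :: "'a measure \<Rightarrow> (real \<Rightarrow> 'a measure) \<Rightarrow> (real \<Rightarrow> 'a \<Rightarrow> real^'n::finite) set" where
  "H2 M F = {u. (\<lambda>(t, w). u t w) \<in> borel_measurable (Omega_pos M) \<and>
      (\<forall>t>0. u t \<in> borel_measurable (F t)) \<and>
      (\<exists>K. \<forall>t>0. (\<integral>\<^sup>+ w. ennreal ((norm (u t w))\<^sup>2) \<partial>M) \<le> ennreal K)}"

definition H2_norm :: "'a measure \<Rightarrow> (real \<Rightarrow> 'a \<Rightarrow> real^'n::finite) \<Rightarrow> real" where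
  "H2_norm M u = (SUP t\<in>{0<..}. sqrt (enn2real (\<integral>\<^sup>+ w. ennreal ((norm (u t w))\<^sup>2) \<partial>M)))"

end

theory Submission
  imports Defs "HOL-Real_Asymp.Real_Asymp"
begin

text \<open>
  Let \<open>z t\<close> be the \<open>L\<^sup>2(\<Omega>)\<close> size of the Hilbert-Schmidt norm of \<open>C \<Phi>(t) B - C' \<Phi>'(t) B'\<close>.
  By the Cauchy-Schwarz inequality in \<open>\<Omega>\<close> and time homogeneity the output error at time \<open>t\<close> is at most
  \<open>\<integral>\<^sub>0\<^sup>t z(t - s) ds\<close> times the norm of \<open>u\<close>, so it suffices that \<open>\<integral>\<^sub>0\<^sup>\<infinity> z\<close> is at most twice the trace norm.

  The difference of the Hankel operators has the kernel
  \<open>\<kappa>((t,w),(s,w')) = C \<Phi>(t,w) \<Phi>(s,w') B - C' \<Phi>'(t,w) \<Phi>'(s,w') B'\<close>, and the semigroup property together with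
  the independence of the two flows shows that its mean square over \<open>(w, w')\<close> is \<open>z(t + s)\<^sup>2\<close>.
  The trace norm dominates the sum of the Hilbert-Schmidt norms of diagonal blocks \<open>J \<times> J\<close>,
  which by Cauchy-Schwarz is at least the sum of \<open>\<epsilon>\<^sup>-\<^sup>1 \<integral>\<integral> z(t + s) ds dt\<close> over \<open>J \<times> J\<close>
  for intervals \<open>J\<close> of length \<open>\<epsilon>\<close>. Averaging \<open>z\<close> over the antidiagonals avoids any
  regularity of the kernel at the diagonal. Two such families of blocks, shifted by \<open>\<epsilon>/2\<close>, give
  \<open>\<integral> z\<close> over \<open>(\<epsilon>, \<infinity>)\<close>, whence the factor 2.
\<close>

section \<open>Trace versus Frobenius norm\<close>

text \<open>The factor 2 already shows in the formal trace: a kernel z(t + s) is sampled along t =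
  s, where the sum 2t runs at double speed, so the trace sees only half of the integral of z. The
  trace norm is a supremum over pairs of orthonormal systems, so a block is bounded below by
  exhibiting such a pair. Approximation of the kernel by step functions turns the block into a
  finite matrix; rotating one of the two systems then brings the trace of this matrix up to its
  Frobenius norm, with an arbitrarily small loss. The Markov property identifies only the law of a
  flow started from one vector, not joint laws for several starting vectors. That suffices because
  the mean square of the Hilbert-Schmidt norm is a sum of separate expectations, one per input
  vector. Within one summand both flows occur together, and independence reduces their joint law to
  the two one-point laws. The output error is controlled in the first moment, since the control and
  the flow may be dependent and Cauchy-Schwarz over the sample space is what separates them.\<close>

definition row_orthonormal :: "'i set \<Rightarrow> ('i \<Rightarrow> 'i \<Rightarrow> real) \<Rightarrow> bool" where
  "row_orthonormal K U \<longleftrightarrow> (\<forall>i\<in>K. \<forall>j\<in>K. (\<Sum>l\<in>K. U i l * U j l) = (if i = j then 1 else 0))"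

text \<open>Rows \<open>i\<close> and \<open>j\<close> are acted on by the 2 by 2 matrix with rows
  \<open>(c, s)\<close> and \<open>(e * s, - e * c)\<close>. It is orthogonal with determinant
  \<open>- e\<close>: a rotation for \<open>e = -1\<close> and a reflection for
  \<open>e = 1\<close>.\<close>

lemma row_orthonormal_mix:
  assumes U: "row_orthonormal K U" and ij: "i \<in> K" "j \<in> K" "i \<noteq> j"
    and cs: "c\<^sup>2 + s\<^sup>2 = 1" and e: "e\<^sup>2 = (1::real)"
  shows "row_orthonormal K (U(i := \<lambda>l. c * U i l + s * U j l, j := \<lambda>l. e * (s * U i l - c * U j l)))"
    (is "row_orthonormal K ?U'")
proof -
  define B where "B a b = (\<Sum>l\<in>K. a l * b l)" for a b :: "'a \<Rightarrow> real"
  have UB: "B (U a) (U b) = (if a = b then 1 else 0)" if "a \<in> K" "b \<in> K" for a b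
    using U that unfolding row_orthonormal_def B_def by auto
  have Badd: "B (\<lambda>l. x * a l + y * b l) d = x * B a d + y * B b d" for x y a b d
    unfolding B_def by (simp add: sum.distrib sum_distrib_left algebra_simps)
  have Bsym: "B a d = B d a" for a d unfolding B_def by (simp add: mult.commute)
  have Bm: "B (\<lambda>l. e * (x * a l - y * b l)) d = e * (x * B a d - y * B b d)" for x y a b d
    unfolding B_def by (simp add: sum_subtractf sum_distrib_left algebra_simps)
  have ee: "e * e = 1" and cc: "c * c + s * s = 1" using cs e by (auto simp: power2_eq_square)
  have jj: "e * (s * (e * s)) + e * (c * (e * c)) = 1"
    using ee cc by (metis mult.assoc mult.left_commute mult.right_neutral distrib_left add.commute)
  have "B (?U' a) (?U' b) = (if a = b then 1 else 0)" if ab: "a \<in> K" "b \<in> K" for a b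
  proof -
    let ?ui = "\<lambda>l. c * U i l + s * U j l" and ?uj = "\<lambda>l. e * (s * U i l - c * U j l)"
    have ii: "B ?ui ?ui = 1"
      using ij cc by (simp add: Badd Bsym[of _ ?ui] UB)
    have ij': "B ?ui ?uj = 0"
      using ij by (simp add: Badd Bsym[of _ ?uj] Bm UB)
    have jj': "B ?uj ?uj = 1"
      using ij jj by (simp add: Bm Bsym[of _ ?uj] UB distrib_left)
    have io: "B ?ui (U d) = 0" if "d \<in> K" "d \<noteq> i" "d \<noteq> j" for d using that ij by (simp add: Badd UB)
    have jo: "B ?uj (U d) = 0" if "d \<in> K" "d \<noteq> i" "d \<noteq> j" for d using that ij by (simp add: Bm UB)
    show ?thesis
      using ii ij' jj' io jo ab ij UB Bsym
      by (cases "a = i"; cases "a = j"; cases "b = i"; cases "b = j") (auto simp: Bsym)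
  qed
  then show ?thesis unfolding row_orthonormal_def B_def by blast
qed

text \<open>The extremal direction is the normalised vector \<open>(a, b)\<close>. This trades a
  family of linear inequalities, one per angle, for a single quadratic one.\<close>

lemma unit_direction:
  fixes a b y :: real
  assumes "\<And>c s. c\<^sup>2 + s\<^sup>2 = 1 \<Longrightarrow> c * a + s * b \<le> y"
  shows "a\<^sup>2 + b\<^sup>2 \<le> y\<^sup>2"
proof (cases "a = 0 \<and> b = 0")
  case False
  define r where "r = sqrt (a\<^sup>2 + b\<^sup>2)"
  have r: "r > 0" "r\<^sup>2 = a\<^sup>2 + b\<^sup>2"
    using False unfolding r_def by (simp_all add: sum_power2_gt_zero_iff)
  have "(a/r)\<^sup>2 + (b/r)\<^sup>2 = 1"
    using r(1) by (simp add: power_divide r(2)[symmetric] flip: add_divide_distrib)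
  from assms[OF this] have "(a\<^sup>2 + b\<^sup>2) / r \<le> y"
    by (simp add: power2_eq_square add_divide_distrib)
  then have "r \<le> y" using r by (metis power2_eq_square nonzero_mult_div_cancel_right less_irrefl)
  then show ?thesis using r by (metis power_mono less_imp_le)
qed auto

text \<open>At a maximiser \<open>U\<close> of \<open>tr (U A)\<close> no rotation or reflection in a coordinate plane helps;
  this forces \<open>P\<^sub>i\<^sub>j\<^sup>2 + P\<^sub>j\<^sub>i\<^sup>2 \<le> 2 P\<^sub>i\<^sub>i P\<^sub>j\<^sub>j\<close> for \<open>P = U A\<close>, and summing over
  \<open>i, j\<close> compares the trace with the Frobenius norm. Near-maximisers suffice.\<close>

lemma orthonormal_trace_ge_frobenius:
  fixes A :: "'i \<Rightarrow> 'i \<Rightarrow> real"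
  assumes K: "finite K" and eta: "\<eta> > 0"
  shows "\<exists>U. row_orthonormal K U \<and>
     (\<Sum>i\<in>K. \<Sum>l\<in>K. U i l * A l i) \<ge> sqrt (\<Sum>i\<in>K. \<Sum>l\<in>K. (A l i)\<^sup>2) - \<eta>"
proof -
  define P where "P U i j = (\<Sum>l\<in>K. U i l * A l j)" for U :: "'i \<Rightarrow> 'i \<Rightarrow> real" and i j
  define G where "G = (\<Sum>i\<in>K. \<Sum>l\<in>K. (A l i)\<^sup>2)"
  \<comment> \<open>Invariance of the Frobenius norm is built into \<open>R\<close> instead of being
    derived from orthonormality of the columns of \<open>U\<close>: \<open>id1\<close> has it and
    every plane rotation or reflection visibly preserves it.\<close>
  define R where "R = {U. row_orthonormal K U \<and> (\<Sum>i\<in>K. \<Sum>j\<in>K. (P U i j)\<^sup>2) = G}"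
  define t where "t U = (\<Sum>i\<in>K. P U i i)" for U
  have G0: "G \<ge> 0" unfolding G_def by (intro sum_nonneg) auto
  define id1 where "id1 = (\<lambda>i l::'i. if i = l then 1 else 0 :: real)"
  have Pid: "P id1 i j = A i j" if "i \<in> K" for i j
  proof -
    have "P id1 i j = (\<Sum>l\<in>K. if l = i then A l j else 0)"
      unfolding P_def id1_def by (intro sum.cong) auto
    then show ?thesis using K that by simp
  qed
  have idR: "id1 \<in> R"
  proof -
    have "(\<Sum>l\<in>K. id1 i l * id1 j l) = (if i = j then 1 else 0)" if "i \<in> K" for i j
    proof -
      have "(\<Sum>l\<in>K. id1 i l * id1 j l) = (\<Sum>l\<in>K. if l = i then if i = j then 1 else 0 else 0)"
        unfolding id1_def by (intro sum.cong) auto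
      then show ?thesis using K that by simp
    qed
    moreover have "(\<Sum>i\<in>K. \<Sum>j\<in>K. (P id1 i j)\<^sup>2) = G"
      unfolding G_def by (subst (2) sum.swap) (simp add: Pid cong: sum.cong)
    ultimately show ?thesis unfolding R_def row_orthonormal_def by auto
  qed
  have Pb: "\<bar>P U i j\<bar> \<le> sqrt G" if "U \<in> R" "i \<in> K" "j \<in> K" for U i j
  proof -
    have "(P U i j)\<^sup>2 \<le> (\<Sum>j\<in>K. (P U i j)\<^sup>2)"
      using K that by (intro member_le_sum) auto
    also have "\<dots> \<le> (\<Sum>i\<in>K. \<Sum>j\<in>K. (P U i j)\<^sup>2)"
      using K that(2) by (intro member_le_sum[of i K "\<lambda>i. \<Sum>j\<in>K. (P U i j)\<^sup>2"]) (auto intro: sum_nonneg)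
    finally show ?thesis using that by (simp add: R_def real_le_rsqrt abs_le_square_iff)
  qed
  have tb: "t U \<le> card K * sqrt G" if "U \<in> R" for U
    unfolding t_def using Pb[OF that] by (intro sum_bounded_above) (meson abs_le_D1)
  define V where "V = Sup (t ` R)"
  have bdd: "bdd_above (t ` R)" using tb by (intro bdd_aboveI2)
  have tV: "t U \<le> V" if "U \<in> R" for U
    unfolding V_def using bdd that by (intro cSup_upper) auto
  have near: "\<exists>U\<in>R. V - d < t U" if "d > 0" for d
    using less_cSup_iff[OF _ bdd, of "V - d"] idR that unfolding V_def by auto
  \<comment> \<open>Both the identity and its negative lie in \<open>R\<close>, so the supremum
    \<open>V\<close> is nonnegative. This later turns \<open>G \<le> V\<^sup>2\<close> into a bound
    on \<open>sqrt G\<close>.\<close>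
  have Pneg: "P (\<lambda>i l. - U i l) i j = - P U i j" for U i j
    unfolding P_def by (simp add: sum_negf)
  have negO: "(\<lambda>i l. - id1 i l) \<in> R"
    using idR unfolding R_def row_orthonormal_def by (simp add: Pneg)
  have "t (\<lambda>i l. - id1 i l) = - t id1" unfolding t_def by (simp add: Pneg sum_negf)
  then have V0: "V \<ge> 0" using tV[OF idR] tV[OF negO] by linarith
  have mixO: "U(i := \<lambda>l. c * U i l + s * U j l, j := \<lambda>l. e * (s * U i l - c * U j l)) \<in> R"
    "t (U(i := \<lambda>l. c * U i l + s * U j l, j := \<lambda>l. e * (s * U i l - c * U j l)))
       = t U - P U i i - P U j j + (c * P U i i + s * P U j i + e * (s * P U i j - c * P U j j))"
    if U: "U \<in> R" and ij: "i \<in> K" "j \<in> K" "i \<noteq> j" and cs: "c\<^sup>2 + s\<^sup>2 = 1" and e: "e\<^sup>2 = 1"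
    for U i j c s e
  proof -
    let ?U = "U(i := \<lambda>l. c * U i l + s * U j l, j := \<lambda>l. e * (s * U i l - c * U j l))"
    have Pi: "P ?U i a = c * P U i a + s * P U j a" for a
      unfolding P_def using ij by (simp add: sum_distrib_left sum.distrib algebra_simps)
    have Pj: "P ?U j a = e * (s * P U i a - c * P U j a)" for a
      unfolding P_def using ij by (simp add: sum_distrib_left sum_subtractf algebra_simps)
    have Po: "P ?U b a = P U b a" if "b \<noteq> i" "b \<noteq> j" for a b
      unfolding P_def using that by simp
    have split: "(\<Sum>b\<in>K. f b) = f i + f j + (\<Sum>b\<in>K - {i,j}. f b)" for f :: "'i \<Rightarrow> real"
    proof -
      have "(\<Sum>b\<in>K. f b) = (\<Sum>b\<in>{i,j}. f b) + (\<Sum>b\<in>K - {i,j}. f b)"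
        using K ij by (metis sum.subset_diff add.commute empty_subsetI insert_subset)
      then show ?thesis using ij by simp
    qed
    have sq: "(c * x + s * y)\<^sup>2 + (e * (s * x - c * y))\<^sup>2 = x\<^sup>2 + y\<^sup>2" for x y
    proof -
      have "(c * x + s * y)\<^sup>2 + (e * (s * x - c * y))\<^sup>2 = (c * x + s * y)\<^sup>2 + (s * x - c * y)\<^sup>2"
        using e by (simp add: power_mult_distrib)
      also have "\<dots> = (c\<^sup>2 + s\<^sup>2) * (x\<^sup>2 + y\<^sup>2)" by (simp add: power2_eq_square algebra_simps)
      finally show ?thesis using cs by simp
    qed
    have "(\<Sum>a\<in>K. (P ?U i a)\<^sup>2) + (\<Sum>a\<in>K. (P ?U j a)\<^sup>2) = (\<Sum>a\<in>K. (P U i a)\<^sup>2) + (\<Sum>a\<in>K. (P U j a)\<^sup>2)"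
      unfolding sum.distrib[symmetric] Pi Pj sq ..
    then have "(\<Sum>b\<in>K. \<Sum>a\<in>K. (P ?U b a)\<^sup>2) = (\<Sum>b\<in>K. \<Sum>a\<in>K. (P U b a)\<^sup>2)"
      unfolding split[of "\<lambda>b. \<Sum>a\<in>K. (P _ b a)\<^sup>2"] by (simp add: Po)
    then show "?U \<in> R"
      using row_orthonormal_mix[OF _ ij cs e, of U] U unfolding R_def by simp
    show "t ?U = t U - P U i i - P U j j + (c * P U i i + s * P U j i + e * (s * P U i j - c * P U j j))"
      unfolding t_def split[of "\<lambda>b. P _ b b"] by (simp add: Po Pi Pj)
  qed
  have key: "G \<le> (V + d)\<^sup>2 + (card K)\<^sup>2 * (2 * d * sqrt G + d\<^sup>2)" if d: "d > 0" for d
  proof -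
    obtain U where U: "U \<in> R" "V - d < t U" using near[OF d] by auto
    let ?P = "P U"
    have pair: "(?P i j)\<^sup>2 + (?P j i)\<^sup>2 \<le> 2 * (?P i i * ?P j j) + (4 * d * sqrt G + d\<^sup>2)"
      if ij: "i \<in> K" "j \<in> K" for i j
    proof (cases "i = j")
      case True
      have "0 \<le> 4 * d * sqrt G + d\<^sup>2" using d G0 by auto
      then show ?thesis using True by (simp add: power2_eq_square)
    next
      case False
      have 1: "c * ?P i i + s * ?P j i + e * (s * ?P i j - c * ?P j j) \<le> ?P i i + ?P j j + d"
        if "c\<^sup>2 + s\<^sup>2 = 1" "e\<^sup>2 = 1" for c s e
        using mixO(2)[OF U(1) ij False that] tV[OF mixO(1)[OF U(1) ij False that]] U(2) by linarith
      \<comment> \<open>With \<open>e = -1\<close> the left side of \<open>1\<close> is a linear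
        form in \<open>(c, s)\<close> with coefficients \<open>?P i i + ?P j j\<close> and
        \<open>?P j i - ?P i j\<close>; with \<open>e = 1\<close> the signs swap. Adding the two
        quadratic inequalities cancels the mixed terms and leaves twice the four squares on the
        left.\<close>
      have rot: "(?P i i + ?P j j)\<^sup>2 + (?P j i - ?P i j)\<^sup>2 \<le> (?P i i + ?P j j + d)\<^sup>2"
        using 1[of _ _ "-1"] by (intro unit_direction) (simp add: algebra_simps)
      have ref: "(?P i i - ?P j j)\<^sup>2 + (?P j i + ?P i j)\<^sup>2 \<le> (?P i i + ?P j j + d)\<^sup>2"
        using 1[of _ _ 1] by (intro unit_direction) (simp add: algebra_simps)
      have "2 * d * (?P i i + ?P j j) \<le> 2 * d * (2 * sqrt G)"
        using Pb[OF U(1) ij(1) ij(1)] Pb[OF U(1) ij(2) ij(2)] d by (intro mult_left_mono) linarith+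
      then show ?thesis using rot ref by (simp add: power2_eq_square algebra_simps)
    qed
    \<comment> \<open>On the left every entry is counted twice, giving \<open>2 * G\<close>; on the
      right the products of diagonal entries add up to the squared trace.\<close>
    have "(\<Sum>i\<in>K. \<Sum>j\<in>K. (?P i j)\<^sup>2 + (?P j i)\<^sup>2)
        \<le> (\<Sum>i\<in>K. \<Sum>j\<in>K. 2 * (?P i i * ?P j j) + (4 * d * sqrt G + d\<^sup>2))"
      using pair by (intro sum_mono) auto
    also have "\<dots> = 2 * (t U)\<^sup>2 + (card K)\<^sup>2 * (4 * d * sqrt G + d\<^sup>2)"
      unfolding t_def power2_eq_square[of "sum _ _"]
      by (simp add: sum.distrib sum_product power2_eq_square flip: sum_distrib_left)
    also have "(\<Sum>i\<in>K. \<Sum>j\<in>K. (?P i j)\<^sup>2 + (?P j i)\<^sup>2) = 2 * G"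
      using U(1) sum.swap[of "\<lambda>i j. (?P j i)\<^sup>2" K K] unfolding R_def by (simp add: sum.distrib)
    finally have "G \<le> (t U)\<^sup>2 + (card K)\<^sup>2 * (2 * d * sqrt G + d\<^sup>2 / 2)" by (simp add: algebra_simps)
    moreover have "(card K)\<^sup>2 * (2 * d * sqrt G + d\<^sup>2 / 2) \<le> (card K)\<^sup>2 * (2 * d * sqrt G + d\<^sup>2)"
      by (intro mult_left_mono) auto
    moreover have "(t U)\<^sup>2 \<le> (V + d)\<^sup>2"
      using U(2) tV[OF U(1)] V0 d by (intro iffD1[OF abs_le_square_iff]) auto
    ultimately show ?thesis by linarith
  qed
  have "((\<lambda>d. (V + d)\<^sup>2 + (card K)\<^sup>2 * (2 * d * sqrt G + d\<^sup>2)) \<longlongrightarrow> (V + 0)\<^sup>2 + (card K)\<^sup>2 * (2 * 0 * sqrt G + 0\<^sup>2)) (at_right 0)"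
    by (intro tendsto_intros)
  moreover have "\<forall>\<^sub>F d in at_right 0. G \<le> (V + d)\<^sup>2 + (card K)\<^sup>2 * (2 * d * sqrt G + d\<^sup>2)"
    using key by (auto simp: eventually_at_right_field intro!: exI[of _ 1])
  ultimately have "G \<le> (V + 0)\<^sup>2 + (card K)\<^sup>2 * (2 * 0 * sqrt G + 0\<^sup>2)"
    by (rule tendsto_lowerbound) simp
  then have "G \<le> V\<^sup>2" by simp
  then have GV: "sqrt G \<le> V" using V0 by (simp add: real_le_lsqrt)
  obtain U where "U \<in> R" "V - \<eta> < t U" using near[OF eta] by auto
  then show ?thesis using GV unfolding R_def t_def P_def G_def by (intro exI[of _ U]) auto
qed

section \<open>Approximation by rectangular step functions\<close>

text \<open>The finite measurable partitions underlying these rectangular step functions are encoded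
  by a measurable label \<open>p\<close> with finitely many values; common refinement is pairing of labels.\<close>

definition rect_step :: "'b measure \<Rightarrow> ('b \<times> 'b \<Rightarrow> 'v) \<Rightarrow> bool" where
  "rect_step N g \<longleftrightarrow> (\<exists>p n c. p \<in> measurable N (count_space UNIV) \<and> (\<forall>x. p x < (n::nat)) \<and>
      g = (\<lambda>(x, y). c (p x) (p y)))"

lemma rect_step_combine:
  assumes "rect_step N g" "rect_step N h"
  shows "rect_step N (\<lambda>z. F (g z) (h z))"
proof -
  obtain p n c where p: "p \<in> measurable N (count_space UNIV)" "\<forall>x. p x < (n::nat)" "g = (\<lambda>(x, y). c (p x) (p y))"
    using assms(1) unfolding rect_step_def by auto
  obtain q m d where q: "q \<in> measurable N (count_space UNIV)" "\<forall>x. q x < (m::nat)" "h = (\<lambda>(x, y). d (q x) (q y))"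
    using assms(2) unfolding rect_step_def by auto
  \<comment> \<open>Labels are paired in base \<open>m\<close>: as \<open>q x < m\<close>, quotient
    and remainder by \<open>m\<close> recover both.\<close>
  let ?r = "\<lambda>x. p x * m + q x"
  have "?r x < n * m" for x
  proof -
    have "p x * m + q x < (p x + 1) * m" using q(2) by simp
    also have "\<dots> \<le> n * m" using p(2)[rule_format, of x] by (intro mult_le_mono1) simp
    finally show ?thesis .
  qed
  moreover have "?r x div m = p x" "?r x mod m = q x" for x
    using q(2)[rule_format, of x] by auto
  moreover have "?r \<in> measurable N (count_space UNIV)"
    using p(1) q(1) by measurable
  ultimately show ?thesis unfolding rect_step_def p(3) q(3)
    by (intro exI[of _ ?r] exI[of _ "n * m"] exI[of _ "\<lambda>a b. F (c (a div m) (b div m)) (d (a mod m) (b mod m))"])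
       (auto simp: fun_eq_iff)
qed

lemma rect_step_const: "rect_step N (\<lambda>z. c)"
  unfolding rect_step_def by (intro exI[of _ "\<lambda>_. 0"] exI[of _ 1] exI[of _ "\<lambda>_ _. c"]) auto

lemma rect_step_rectangle:
  assumes "A \<in> sets N" "B \<in> sets N"
  shows "rect_step N (\<lambda>z. indicator (A \<times> B) z :: real)"
  unfolding rect_step_def
  using assms
  \<comment> \<open>One label has to serve both coordinates, so it is a two-bit code: 1 for
    membership in \<open>A\<close>, 2 for membership in \<open>B\<close>.\<close>
  by (intro exI[of _ "\<lambda>x. (if x \<in> A then 1 else 0) + (if x \<in> B then 2 else 0)"] exI[of _ 4]
       exI[of _ "\<lambda>a b. if (a = 1 \<or> a = 3) \<and> 2 \<le> b then 1 else 0"])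
     (auto simp: fun_eq_iff indicator_def)

lemma rect_step_measurable:
  fixes g :: "'b \<times> 'b \<Rightarrow> 'v::topological_space"
  assumes "rect_step N g"
  shows "g \<in> borel_measurable (N \<Otimes>\<^sub>M N)"
proof -
  obtain p :: "'b \<Rightarrow> nat" and c where p: "p \<in> measurable N (count_space UNIV)" "g = (\<lambda>(x, y). c (p x) (p y))"
    using assms unfolding rect_step_def by blast
  show ?thesis unfolding p(2) using p(1) by measurable
qed

text \<open>Mean-square closure of the rectangular step functions. The squared distance is an
  extended nonnegative integral, so \<open>h\<close> itself need not be square integrable.\<close>

definition rect_approx :: "'b measure \<Rightarrow> ('b \<times> 'b \<Rightarrow> 'v::euclidean_space) \<Rightarrow> bool" where
  "rect_approx N h \<longleftrightarrow> h \<in> borel_measurable (N \<Otimes>\<^sub>M N) \<and>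
     (\<forall>\<epsilon>>0. \<exists>g. rect_step N g \<and> (\<integral>\<^sup>+z. ennreal ((norm (h z - g z))\<^sup>2) \<partial>(N \<Otimes>\<^sub>M N)) < ennreal \<epsilon>)"

lemma ennreal_numeral_mult: "0 \<le> x \<Longrightarrow> numeral n * ennreal x = ennreal (numeral n * x)"
  by (metis ennreal_mult ennreal_numeral zero_le_numeral)

lemma norm_add_power2_le: "(norm (a + b :: 'v::real_normed_vector))\<^sup>2 \<le> 2 * (norm a)\<^sup>2 + 2 * (norm b)\<^sup>2"
proof -
  have "(norm (a + b))\<^sup>2 \<le> (norm a + norm b)\<^sup>2" by (intro power_mono norm_triangle_ineq) auto
  also have "\<dots> \<le> 2 * (norm a)\<^sup>2 + 2 * (norm b)\<^sup>2"
    using sum_squares_bound[of "norm a" "norm b"] by (simp add: power2_sum)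
  finally show ?thesis .
qed

text \<open>The tolerance is a quarter because squaring a sum costs a factor 2 on each part: 2 times
  \<epsilon>/4, twice, is \<epsilon>.\<close>

lemma nn_integral_norm_add_power2_less:
  fixes a b :: "'b \<Rightarrow> 'v::euclidean_space"
  assumes [measurable]: "a \<in> borel_measurable P" "b \<in> borel_measurable P"
    and a: "(\<integral>\<^sup>+z. ennreal ((norm (a z))\<^sup>2) \<partial>P) < ennreal (\<epsilon>/4)"
    and b: "(\<integral>\<^sup>+z. ennreal ((norm (b z))\<^sup>2) \<partial>P) < ennreal (\<epsilon>/4)"
  shows "(\<integral>\<^sup>+z. ennreal ((norm (a z + b z))\<^sup>2) \<partial>P) < ennreal \<epsilon>"
proof -
  have e: "\<epsilon> > 0"
  proof (rule ccontr)
    assume "\<not> \<epsilon> > 0"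
    then have "ennreal (\<epsilon>/4) = 0" by (intro ennreal_neg) simp
    then show False using a by simp
  qed
  have "(\<integral>\<^sup>+z. ennreal ((norm (a z + b z))\<^sup>2) \<partial>P)
      \<le> (\<integral>\<^sup>+z. 2 * ennreal ((norm (a z))\<^sup>2) + 2 * ennreal ((norm (b z))\<^sup>2) \<partial>P)"
  proof (rule nn_integral_mono)
    fix z
    have "ennreal ((norm (a z + b z))\<^sup>2) \<le> ennreal (2 * (norm (a z))\<^sup>2 + 2 * (norm (b z))\<^sup>2)"
      by (intro ennreal_leI norm_add_power2_le)
    also have "\<dots> = ennreal (2 * (norm (a z))\<^sup>2) + ennreal (2 * (norm (b z))\<^sup>2)"
      by (intro ennreal_plus) auto
    also have "\<dots> = 2 * ennreal ((norm (a z))\<^sup>2) + 2 * ennreal ((norm (b z))\<^sup>2)"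
      by (intro arg_cong2[where f = "(+)"] ennreal_numeral_mult[symmetric]) auto
    finally show "ennreal ((norm (a z + b z))\<^sup>2) \<le> 2 * ennreal ((norm (a z))\<^sup>2) + 2 * ennreal ((norm (b z))\<^sup>2)" .
  qed
  also have "\<dots> = 2 * (\<integral>\<^sup>+z. ennreal ((norm (a z))\<^sup>2) \<partial>P) + 2 * (\<integral>\<^sup>+z. ennreal ((norm (b z))\<^sup>2) \<partial>P)"
    by (simp add: nn_integral_add nn_integral_cmult)
  also have "\<dots> < ennreal \<epsilon>"
  proof -
    obtain r where r: "0 \<le> r" "(\<integral>\<^sup>+z. ennreal ((norm (a z))\<^sup>2) \<partial>P) = ennreal r" "r < \<epsilon>/4"
      using a by (cases "\<integral>\<^sup>+z. ennreal ((norm (a z))\<^sup>2) \<partial>P") (auto simp: ennreal_less_iff)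
    obtain t where t: "0 \<le> t" "(\<integral>\<^sup>+z. ennreal ((norm (b z))\<^sup>2) \<partial>P) = ennreal t" "t < \<epsilon>/4"
      using b by (cases "\<integral>\<^sup>+z. ennreal ((norm (b z))\<^sup>2) \<partial>P") (auto simp: ennreal_less_iff)
    have "2 * r + 2 * t < \<epsilon>" using r(3) t(3) by simp
    then show ?thesis unfolding r(2) t(2) using r(1) t(1)
      by (simp add: ennreal_numeral_mult ennreal_less_iff flip: ennreal_plus)
  qed
  finally show ?thesis .
qed

lemma rect_approx_add:
  assumes "rect_approx N f" "rect_approx N h"
  shows "rect_approx N (\<lambda>z. f z + h z)"
  unfolding rect_approx_def
proof (intro conjI allI impI)
  have [measurable]: "f \<in> borel_measurable (N \<Otimes>\<^sub>M N)" "h \<in> borel_measurable (N \<Otimes>\<^sub>M N)"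
    using assms by (auto simp: rect_approx_def)
  show "(\<lambda>z. f z + h z) \<in> borel_measurable (N \<Otimes>\<^sub>M N)" by measurable
  fix \<epsilon> :: real assume "\<epsilon> > 0"
  then have e: "\<epsilon>/4 > 0" by simp
  obtain g where g: "rect_step N g" "(\<integral>\<^sup>+z. ennreal ((norm (f z - g z))\<^sup>2) \<partial>(N \<Otimes>\<^sub>M N)) < ennreal (\<epsilon>/4)"
    using assms(1) e unfolding rect_approx_def by blast
  obtain k where k: "rect_step N k" "(\<integral>\<^sup>+z. ennreal ((norm (h z - k z))\<^sup>2) \<partial>(N \<Otimes>\<^sub>M N)) < ennreal (\<epsilon>/4)"
    using assms(2) e unfolding rect_approx_def by blast
  note [measurable] = rect_step_measurable[OF g(1)] rect_step_measurable[OF k(1)]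
  have "(\<integral>\<^sup>+z. ennreal ((norm ((f z - g z) + (h z - k z)))\<^sup>2) \<partial>(N \<Otimes>\<^sub>M N)) < ennreal \<epsilon>"
    by (intro nn_integral_norm_add_power2_less g k) measurable
  then show "\<exists>g. rect_step N g \<and> (\<integral>\<^sup>+z. ennreal ((norm (f z + h z - g z))\<^sup>2) \<partial>(N \<Otimes>\<^sub>M N)) < ennreal \<epsilon>"
    using rect_step_combine[OF g(1) k(1), of "(+)"] by (intro exI[of _ "\<lambda>z. g z + k z"]) (simp add: algebra_simps)
qed

lemma rect_approx_const: "rect_approx N (\<lambda>z. c)"
  unfolding rect_approx_def using rect_step_const[of N c] by (auto intro!: exI[of _ "\<lambda>z. c"])

lemma rect_approx_sum:
  assumes "finite I" "\<And>i. i \<in> I \<Longrightarrow> rect_approx N (f i)"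
  shows "rect_approx N (\<lambda>z. \<Sum>i\<in>I. f i z)"
  using assms by (induction I) (auto intro: rect_approx_add rect_approx_const)

text \<open>Closing up twice adds nothing. Complements, countable unions and general functions can
  therefore each be handled through one intermediate approximant.\<close>

lemma rect_approx_limit:
  assumes [measurable]: "h \<in> borel_measurable (N \<Otimes>\<^sub>M N)"
    and "\<And>\<epsilon>. \<epsilon> > 0 \<Longrightarrow> \<exists>f. rect_approx N f \<and> (\<integral>\<^sup>+z. ennreal ((norm (h z - f z))\<^sup>2) \<partial>(N \<Otimes>\<^sub>M N)) < ennreal \<epsilon>"
  shows "rect_approx N h"
  unfolding rect_approx_def
proof (intro conjI allI impI assms(1))
  fix \<epsilon> :: real assume "\<epsilon> > 0"
  then have e: "\<epsilon>/4 > 0" by simp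
  obtain f where f: "rect_approx N f" "(\<integral>\<^sup>+z. ennreal ((norm (h z - f z))\<^sup>2) \<partial>(N \<Otimes>\<^sub>M N)) < ennreal (\<epsilon>/4)"
    using assms(2)[OF e] by auto
  have [measurable]: "f \<in> borel_measurable (N \<Otimes>\<^sub>M N)" using f(1) by (auto simp: rect_approx_def)
  obtain k where k: "rect_step N k" "(\<integral>\<^sup>+z. ennreal ((norm (f z - k z))\<^sup>2) \<partial>(N \<Otimes>\<^sub>M N)) < ennreal (\<epsilon>/4)"
    using f(1) e unfolding rect_approx_def by blast
  note [measurable] = rect_step_measurable[OF k(1)]
  have "(\<integral>\<^sup>+z. ennreal ((norm ((h z - f z) + (f z - k z)))\<^sup>2) \<partial>(N \<Otimes>\<^sub>M N)) < ennreal \<epsilon>"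
    by (intro nn_integral_norm_add_power2_less f k) measurable
  then show "\<exists>g. rect_step N g \<and> (\<integral>\<^sup>+z. ennreal ((norm (h z - g z))\<^sup>2) \<partial>(N \<Otimes>\<^sub>M N)) < ennreal \<epsilon>"
    using k(1) by auto
qed

text \<open>Dynkin's argument: rectangles form an intersection-stable generator, and the
  approximable sets are closed under complements and disjoint countable unions.\<close>

lemma rect_approx_indicator:
  assumes N: "finite_measure N" and D: "D \<in> sets (N \<Otimes>\<^sub>M N)"
  shows "rect_approx N (\<lambda>z. indicator D z :: real)"
proof -
  interpret N: finite_measure N by fact
  interpret P: finite_measure "N \<Otimes>\<^sub>M N" by (intro finite_measure_pair_measure N)
  let ?G = "{a \<times> b | a b. a \<in> sets N \<and> b \<in> sets N}"
  have G: "Int_stable ?G" by (rule Int_stable_pair_measure_generator)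
  have sub: "?G \<subseteq> Pow (space N \<times> space N)" using sets.space_closed by blast
  have S: "sets (N \<Otimes>\<^sub>M N) = sigma_sets (space N \<times> space N) ?G" by (rule sets_pair_measure)
  from D show ?thesis unfolding S
  proof (induction rule: sigma_sets_induct_disjoint[OF G sub, consumes 1, case_names basic empty compl union])
    case (basic A)
    then obtain a b where A: "A = a \<times> b" "a \<in> sets N" "b \<in> sets N" by auto
    show ?case unfolding A(1) rect_approx_def using rect_step_rectangle[OF A(2,3)] A
      by (auto intro!: exI[of _ "indicator (a \<times> b)"] borel_measurable_indicator pair_measureI)
  next
    case empty
    show ?case using rect_approx_const[of N "0::real"] by simp
  next
    case (compl A)
    have m: "A \<in> sets (N \<Otimes>\<^sub>M N)" using compl unfolding S by simp
    show ?case
    proof (rule rect_approx_limit)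
      show "(\<lambda>z. indicator (space N \<times> space N - A) z :: real) \<in> borel_measurable (N \<Otimes>\<^sub>M N)"
        using m by (intro borel_measurable_indicator) (metis sets.compl_sets space_pair_measure)
      fix \<epsilon> :: real assume e: "\<epsilon> > 0"
      from compl(2) obtain g where g: "rect_step N g"
        "(\<integral>\<^sup>+z. ennreal ((norm (indicator A z - g z :: real))\<^sup>2) \<partial>(N \<Otimes>\<^sub>M N)) < ennreal \<epsilon>"
        using e unfolding rect_approx_def by blast
      have "rect_approx N (\<lambda>z. 1 - g z)"
        using rect_step_combine[OF g(1) rect_step_const[of N "0::real"], of "\<lambda>a b. 1 - a"]
          rect_step_measurable[OF g(1)] unfolding rect_approx_def
        by (auto intro!: exI[of _ "\<lambda>z. 1 - g z"])
      moreover have "(\<integral>\<^sup>+z. ennreal ((norm (indicator (space N \<times> space N - A) z - (1 - g z) :: real))\<^sup>2) \<partial>(N \<Otimes>\<^sub>M N))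
          = (\<integral>\<^sup>+z. ennreal ((norm (indicator A z - g z :: real))\<^sup>2) \<partial>(N \<Otimes>\<^sub>M N))"
        by (intro nn_integral_cong) (auto simp: indicator_def space_pair_measure power2_commute)
      ultimately show "\<exists>f. rect_approx N f \<and>
        (\<integral>\<^sup>+z. ennreal ((norm (indicator (space N \<times> space N - A) z - f z :: real))\<^sup>2) \<partial>(N \<Otimes>\<^sub>M N)) < ennreal \<epsilon>"
        using g(2) by (intro exI[of _ "\<lambda>z. 1 - g z"]) auto
    qed
  next
    case (union A)
    have m [measurable]: "A i \<in> sets (N \<Otimes>\<^sub>M N)" for i using union(2) unfolding S by auto
    show ?case
    proof (rule rect_approx_limit)
      show "(\<lambda>z. indicator (\<Union> (range A)) z :: real) \<in> borel_measurable (N \<Otimes>\<^sub>M N)" by measurable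
      fix \<epsilon> :: real assume e: "\<epsilon> > 0"
      \<comment> \<open>The part of the union missed by the first \<open>n\<close> sets decreases to
        the empty set, so by finiteness of the measure its mass tends to zero.\<close>
      let ?R = "\<lambda>n. \<Union> (range A) - (\<Union>i<n. A i)"
      have "(\<lambda>n. emeasure (N \<Otimes>\<^sub>M N) (?R n)) \<longlonglongrightarrow> emeasure (N \<Otimes>\<^sub>M N) (\<Inter>n. ?R n)"
        by (intro Lim_emeasure_decseq) (auto simp: decseq_def intro: less_le_trans)
      moreover have "(\<Inter>n. ?R n) = {}" using lessI by blast
      ultimately have "(\<lambda>n. emeasure (N \<Otimes>\<^sub>M N) (?R n)) \<longlonglongrightarrow> 0" by (metis emeasure_empty)
      then have "\<forall>\<^sub>F n in sequentially. emeasure (N \<Otimes>\<^sub>M N) (?R n) < ennreal \<epsilon>"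
        using e by (intro order_tendstoD) auto
      then obtain n where n: "emeasure (N \<Otimes>\<^sub>M N) (?R n) < ennreal \<epsilon>"
        using eventually_happens'[OF sequentially_bot] by blast
      have sum: "(\<Sum>i<n. indicator (A i) z :: real) = indicator (\<Union>i<n. A i) z" for z
        using union(1) by (subst indicator_UN_disjoint) (auto simp: disjoint_family_on_def)
      have "(\<integral>\<^sup>+z. ennreal ((norm (indicator (\<Union> (range A)) z - (\<Sum>i<n. indicator (A i) z) :: real))\<^sup>2) \<partial>(N \<Otimes>\<^sub>M N))
          = (\<integral>\<^sup>+z. indicator (?R n) z \<partial>(N \<Otimes>\<^sub>M N))"
        unfolding sum by (intro nn_integral_cong) (auto simp: indicator_def)
      also have "\<dots> = emeasure (N \<Otimes>\<^sub>M N) (?R n)" by (intro nn_integral_indicator) measurable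
      finally show "\<exists>f. rect_approx N f \<and>
        (\<integral>\<^sup>+z. ennreal ((norm (indicator (\<Union> (range A)) z - f z :: real))\<^sup>2) \<partial>(N \<Otimes>\<^sub>M N)) < ennreal \<epsilon>"
        using rect_approx_sum[of "{..<n}" N "\<lambda>i z. indicator (A i) z :: real"] union(3) n
        by (intro exI[of _ "\<lambda>z. \<Sum>i<n. indicator (A i) z"]) auto
    qed
  qed
qed

lemma rect_approx_scaleR_const:
  fixes v :: "'v::euclidean_space"
  assumes "rect_approx N f"
  shows "rect_approx N (\<lambda>z. (f z :: real) *\<^sub>R v)"
  unfolding rect_approx_def
proof (intro conjI allI impI)
  have [measurable]: "f \<in> borel_measurable (N \<Otimes>\<^sub>M N)" using assms by (auto simp: rect_approx_def)
  show "(\<lambda>z. f z *\<^sub>R v) \<in> borel_measurable (N \<Otimes>\<^sub>M N)" by measurable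
  fix \<epsilon> :: real assume e: "\<epsilon> > 0"
  \<comment> \<open>The added 1 keeps the quotient defined for \<open>v = 0\<close> and the final
    inequality strict.\<close>
  define d where "d = \<epsilon> / ((norm v)\<^sup>2 + 1)"
  have d: "d > 0" using e unfolding d_def by (auto intro!: divide_pos_pos add_nonneg_pos)
  obtain g where g: "rect_step N g" "(\<integral>\<^sup>+z. ennreal ((norm (f z - g z))\<^sup>2) \<partial>(N \<Otimes>\<^sub>M N)) < ennreal d"
    using assms d unfolding rect_approx_def by blast
  note [measurable] = rect_step_measurable[OF g(1)]
  have "(\<integral>\<^sup>+z. ennreal ((norm (f z *\<^sub>R v - g z *\<^sub>R v))\<^sup>2) \<partial>(N \<Otimes>\<^sub>M N))
      = (\<integral>\<^sup>+z. ennreal ((norm v)\<^sup>2) * ennreal ((norm (f z - g z))\<^sup>2) \<partial>(N \<Otimes>\<^sub>M N))"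
    by (intro nn_integral_cong)
       (simp add: scaleR_left_diff_distrib[symmetric] power_mult_distrib ennreal_mult[symmetric] mult.commute del: scaleR_left_diff_distrib)
  also have "\<dots> = ennreal ((norm v)\<^sup>2) * (\<integral>\<^sup>+z. ennreal ((norm (f z - g z))\<^sup>2) \<partial>(N \<Otimes>\<^sub>M N))"
    by (intro nn_integral_cmult) measurable
  also have "\<dots> \<le> ennreal ((norm v)\<^sup>2) * ennreal d"
    using g(2) by (intro mult_left_mono) auto
  also have "\<dots> < ennreal \<epsilon>"
  proof -
    have "(norm v)\<^sup>2 * d < \<epsilon>" using e unfolding d_def
      by (simp add: divide_simps add_nonneg_pos)
    then show ?thesis using d e by (simp add: ennreal_mult[symmetric] ennreal_less_iff)
  qed
  finally show "\<exists>g. rect_step N g \<and> (\<integral>\<^sup>+z. ennreal ((norm (f z *\<^sub>R v - g z))\<^sup>2) \<partial>(N \<Otimes>\<^sub>M N)) < ennreal \<epsilon>"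
    using rect_step_combine[OF g(1) g(1), of "\<lambda>a b. a *\<^sub>R v"] by blast
qed

lemma rect_approx_square_integrable:
  fixes h :: "'b \<times> 'b \<Rightarrow> 'v::euclidean_space"
  assumes N: "finite_measure N" and [measurable]: "h \<in> borel_measurable (N \<Otimes>\<^sub>M N)"
    and fin: "(\<integral>\<^sup>+z. ennreal ((norm (h z))\<^sup>2) \<partial>(N \<Otimes>\<^sub>M N)) < \<infinity>"
  shows "rect_approx N h"
proof (rule rect_approx_limit)
  show "h \<in> borel_measurable (N \<Otimes>\<^sub>M N)" by fact
  fix \<epsilon> :: real assume e: "\<epsilon> > 0"
  let ?P = "N \<Otimes>\<^sub>M N"
  obtain s where s: "\<And>i. simple_function ?P (s i)" "\<And>z. z \<in> space ?P \<Longrightarrow> (\<lambda>i. s i z) \<longlonglongrightarrow> h z"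
      "\<And>i z. z \<in> space ?P \<Longrightarrow> dist (s i z) 0 \<le> 2 * dist (h z) 0"
    using borel_measurable_implies_sequence_metric[OF assms(2), of 0] by blast
  have [measurable]: "s i \<in> borel_measurable ?P" for i using s(1) by (rule borel_measurable_simple_function)
  \<comment> \<open>The approximants satisfy |s| \<le> 2|h|, so |h - s| \<le> 3|h|; squaring gives
    the dominating function with constant 9.\<close>
  have "(\<lambda>i. \<integral>\<^sup>+z. ennreal ((norm (h z - s i z))\<^sup>2) \<partial>?P) \<longlonglongrightarrow> (\<integral>\<^sup>+z. 0 \<partial>?P)"
  proof (rule nn_integral_dominated_convergence[where w = "\<lambda>z. 9 * ennreal ((norm (h z))\<^sup>2)"])
    show "(\<integral>\<^sup>+z. 9 * ennreal ((norm (h z))\<^sup>2) \<partial>?P) < \<infinity>"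
      using fin by (simp add: nn_integral_cmult ennreal_mult_less_top)
    show "AE z in ?P. ennreal ((norm (h z - s i z))\<^sup>2) \<le> 9 * ennreal ((norm (h z))\<^sup>2)" for i
    proof (rule AE_I2)
      fix z assume z: "z \<in> space ?P"
      have "norm (h z - s i z) \<le> norm (h z) + norm (s i z)" by (rule norm_triangle_ineq4)
      also have "\<dots> \<le> 3 * norm (h z)" using s(3)[OF z, of i] by simp
      finally have "(norm (h z - s i z))\<^sup>2 \<le> (3 * norm (h z))\<^sup>2" by (rule power_mono) auto
      then have "(norm (h z - s i z))\<^sup>2 \<le> 9 * (norm (h z))\<^sup>2" by (simp add: power_mult_distrib)
      then show "ennreal ((norm (h z - s i z))\<^sup>2) \<le> 9 * ennreal ((norm (h z))\<^sup>2)"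
        by (simp add: ennreal_numeral_mult ennreal_leI)
    qed
    show "AE z in ?P. (\<lambda>i. ennreal ((norm (h z - s i z))\<^sup>2)) \<longlonglongrightarrow> 0"
    proof (rule AE_I2)
      fix z assume z: "z \<in> space ?P"
      have "(\<lambda>i. ennreal ((norm (h z - s i z))\<^sup>2)) \<longlonglongrightarrow> ennreal ((norm (h z - h z))\<^sup>2)"
        by (intro tendsto_ennrealI tendsto_intros s z)
      then show "(\<lambda>i. ennreal ((norm (h z - s i z))\<^sup>2)) \<longlonglongrightarrow> 0" by simp
    qed
  qed auto
  then have "\<forall>\<^sub>F i in sequentially. (\<integral>\<^sup>+z. ennreal ((norm (h z - s i z))\<^sup>2) \<partial>?P) < ennreal \<epsilon>"
    using e by (intro order_tendstoD) auto
  then obtain i where i: "(\<integral>\<^sup>+z. ennreal ((norm (h z - s i z))\<^sup>2) \<partial>?P) < ennreal \<epsilon>"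
    using eventually_happens'[OF sequentially_bot] by blast
  let ?f = "\<lambda>z. \<Sum>y\<in>s i ` space ?P. (indicator (s i -` {y} \<inter> space ?P) z :: real) *\<^sub>R y"
  have "rect_approx N ?f"
    using s(1)[of i] unfolding simple_function_def
    by (intro rect_approx_sum rect_approx_scaleR_const rect_approx_indicator N) auto
  moreover have rep: "?f z = s i z" if "z \<in> space ?P" for z
    using simple_function_indicator_representation_banach[OF s(1)[of i] that] by (rule sym)
  have "(\<integral>\<^sup>+z. ennreal ((norm (h z - ?f z))\<^sup>2) \<partial>?P) = (\<integral>\<^sup>+z. ennreal ((norm (h z - s i z))\<^sup>2) \<partial>?P)"
    by (intro nn_integral_cong) (simp only: rep)
  ultimately show "\<exists>f. rect_approx N f \<and> (\<integral>\<^sup>+z. ennreal ((norm (h z - f z))\<^sup>2) \<partial>?P) < ennreal \<epsilon>"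
    using i by (intro exI[of _ ?f]) (simp only:)
qed

section \<open>Trace norm and Hilbert-Schmidt norm of blocks\<close>

text \<open>A version of \<open>L2_orthonormal\<close> for arbitrary index sets: the systems below
  are indexed by pairs, of a cell and a coordinate or of a block and a number.\<close>

definition L2_orthonormal_on :: "'b measure \<Rightarrow> 'i set \<Rightarrow> ('i \<Rightarrow> 'b \<Rightarrow> 'v::euclidean_space) \<Rightarrow> bool" where
  "L2_orthonormal_on mu I e \<longleftrightarrow> (\<forall>i\<in>I. e i \<in> L2 mu) \<and>
     (\<forall>i\<in>I. \<forall>j\<in>I. L2_inner mu (e i) (e j) = (if i = j then 1 else 0))"

section \<open>Square integrable functions and orthonormal systems\<close>

lemma L2_measurable [measurable_dest]: "f \<in> L2 mu \<Longrightarrow> f \<in> borel_measurable mu"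
  unfolding L2_def by simp

lemma abs_inner_le_power2: "\<bar>x \<bullet> y\<bar> \<le> (norm x)\<^sup>2 + (norm (y :: 'v::real_inner))\<^sup>2"
proof -
  have "\<bar>x \<bullet> y\<bar> \<le> norm x * norm y" by (rule Cauchy_Schwarz_ineq2)
  also have "\<dots> \<le> (norm x)\<^sup>2 + (norm y)\<^sup>2"
    using sum_squares_bound[of "norm x" "norm y"] zero_le_power2[of "norm x"] zero_le_power2[of "norm y"] by linarith
  finally show ?thesis .
qed

lemma L2_inner_integrable:
  assumes "f \<in> L2 mu" "g \<in> L2 mu"
  shows "integrable mu (\<lambda>z. f z \<bullet> g z)"
proof (rule Bochner_Integration.integrable_bound)
  show "integrable mu (\<lambda>z. (norm (f z))\<^sup>2 + (norm (g z))\<^sup>2)"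
    using assms unfolding L2_def by auto
  show "(\<lambda>z. f z \<bullet> g z) \<in> borel_measurable mu"
    using assms by (auto dest: L2_measurable)
qed (auto simp: abs_inner_le_power2)

lemma L2_add:
  assumes "f \<in> L2 mu" "g \<in> L2 mu"
  shows "(\<lambda>z. f z + g z) \<in> L2 mu"
proof -
  have "integrable mu (\<lambda>z. (norm (f z + g z))\<^sup>2)"
  proof (rule Bochner_Integration.integrable_bound)
    show "integrable mu (\<lambda>z. 2 * (norm (f z))\<^sup>2 + 2 * (norm (g z))\<^sup>2)"
      using assms unfolding L2_def by auto
    show "(\<lambda>z. (norm (f z + g z))\<^sup>2) \<in> borel_measurable mu"
      using assms by (auto dest!: L2_measurable)
  qed (use norm_add_power2_le in \<open>auto intro!: AE_I2\<close>)
  then show ?thesis using assms by (auto simp: L2_def)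
qed

lemma L2_scale: "f \<in> L2 mu \<Longrightarrow> (\<lambda>z. c *\<^sub>R f z) \<in> L2 mu"
  unfolding L2_def by (auto simp: power_mult_distrib)

lemma L2_zero: "(\<lambda>z. 0) \<in> L2 mu"
  unfolding L2_def by auto

lemma L2_sum:
  assumes "finite I" "\<And>i. i \<in> I \<Longrightarrow> e i \<in> L2 mu"
  shows "(\<lambda>z. \<Sum>i\<in>I. c i *\<^sub>R e i z) \<in> L2 mu"
  using assms by (induction I) (auto intro!: L2_add L2_scale L2_zero)

lemma L2_inner_sum_right:
  assumes "finite I" "\<And>i. i \<in> I \<Longrightarrow> e i \<in> L2 mu" "g \<in> L2 mu"
  shows "L2_inner mu g (\<lambda>z. \<Sum>i\<in>I. c i *\<^sub>R e i z) = (\<Sum>i\<in>I. c i * L2_inner mu g (e i))"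
  unfolding L2_inner_def inner_sum_right inner_scaleR_right
  using assms by (subst Bochner_Integration.integral_sum) (auto intro!: L2_inner_integrable)

lemma L2_inner_sum_left:
  assumes "finite I" "\<And>i. i \<in> I \<Longrightarrow> e i \<in> L2 mu" "g \<in> L2 mu"
  shows "L2_inner mu (\<lambda>z. \<Sum>i\<in>I. c i *\<^sub>R e i z) g = (\<Sum>i\<in>I. c i * L2_inner mu (e i) g)"
  using L2_inner_sum_right[OF assms, where c = c] unfolding L2_inner_def by (simp add: inner_commute)

text \<open>The Gram matrix of the new system is the product of \<open>U\<close> with its transpose.
  The injection \<open>\<iota>\<close> selects the rows that are kept, so the rotated system may be
  cut down to a smaller index set.\<close>

lemma L2_orthonormal_on_rotate:
  assumes L: "finite L" "L2_orthonormal_on mu L f" and U: "row_orthonormal L U"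
    and \<iota>: "inj_on \<iota> I" "\<iota> ` I \<subseteq> L"
  shows "L2_orthonormal_on mu I (\<lambda>i z. \<Sum>l\<in>L. U (\<iota> i) l *\<^sub>R f l z)"
proof -
  have f: "l \<in> L \<Longrightarrow> f l \<in> L2 mu" for l using L by (auto simp: L2_orthonormal_on_def)
  have "L2_inner mu (\<lambda>z. \<Sum>l\<in>L. U (\<iota> i) l *\<^sub>R f l z) (\<lambda>z. \<Sum>l\<in>L. U (\<iota> j) l *\<^sub>R f l z) = (if i = j then 1 else 0)"
    if ij: "i \<in> I" "j \<in> I" for i j
  proof -
    have "L2_inner mu (\<lambda>z. \<Sum>l\<in>L. U (\<iota> i) l *\<^sub>R f l z) (\<lambda>z. \<Sum>l\<in>L. U (\<iota> j) l *\<^sub>R f l z)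
        = (\<Sum>l\<in>L. U (\<iota> i) l * (\<Sum>l'\<in>L. U (\<iota> j) l' * L2_inner mu (f l) (f l')))"
      using f L(1) by (simp add: L2_inner_sum_left L2_inner_sum_right L2_sum)
    also have "\<dots> = (\<Sum>l\<in>L. U (\<iota> i) l * (\<Sum>l'\<in>L. if l' = l then U (\<iota> j) l' else 0))"
      using L(2) unfolding L2_orthonormal_on_def
      by (intro sum.cong refl arg_cong2[where f = times]) auto
    also have "\<dots> = (\<Sum>l\<in>L. U (\<iota> i) l * U (\<iota> j) l)"
      using L(1) by (simp cong: sum.cong)
    also have "\<dots> = (if \<iota> i = \<iota> j then 1 else 0)"
      using U ij \<iota>(2) unfolding row_orthonormal_def by (meson image_subset_iff)
    finally show ?thesis using ij \<iota>(1) by (auto dest: inj_onD)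
  qed
  then show ?thesis using f L(1) unfolding L2_orthonormal_on_def by (auto intro!: L2_sum)
qed

lemma trace_norm_ge:
  assumes "finite I" "L2_orthonormal_on mu I e" "L2_orthonormal_on nu I f"
  shows "ennreal (\<Sum>i\<in>I. \<bar>L2_inner nu (T (e i)) (f i)\<bar>) \<le> trace_norm mu nu T"
proof -
  obtain h where h: "bij_betw h {..<card I} I"
    using ex_bij_betw_nat_finite[OF assms(1)] by (auto simp: atLeast0LessThan)
  have hI: "h i \<in> I" if "i < card I" for i using h that by (auto simp: bij_betw_def)
  have hin: "h i = h j \<longleftrightarrow> i = j" if "i < card I" "j < card I" for i j
    using h that by (auto simp: bij_betw_def dest: inj_onD)
  have "L2_orthonormal mu (card I) (\<lambda>i. e (h i))" "L2_orthonormal nu (card I) (\<lambda>i. f (h i))"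
    using assms(2,3) hI hin unfolding L2_orthonormal_def L2_orthonormal_on_def by auto
  then have "ennreal (\<Sum>i<card I. \<bar>L2_inner nu (T (e (h i))) (f (h i))\<bar>) \<le> trace_norm mu nu T"
    unfolding trace_norm_def
    by (intro SUP_upper2[of "(card I, \<lambda>i. e (h i), \<lambda>i. f (h i))"]) auto
  also have "(\<Sum>i<card I. \<bar>L2_inner nu (T (e (h i))) (f (h i))\<bar>) = (\<Sum>i\<in>I. \<bar>L2_inner nu (T (e i)) (f i)\<bar>)"
    using sum.reindex_bij_betw[OF h, of "\<lambda>i. \<bar>L2_inner nu (T (e i)) (f i)\<bar>"] .
  finally show ?thesis .
qed

text \<open>The numbers \<open>\<beta> i (f l)\<close> form a matrix with at most as many indices in
  \<open>I\<close> as in \<open>L\<close>. Rotating the frame \<open>f\<close> moves almost its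
  whole Frobenius norm onto the paired entries. New functions are combinations of old ones, hence
  vanish wherever all old ones do; this keeps them inside a block.\<close>

lemma orthonormal_frame_frobenius:
  fixes \<beta> :: "'i \<Rightarrow> ('b \<Rightarrow> 'v::euclidean_space) \<Rightarrow> real" and f :: "'l \<Rightarrow> 'b \<Rightarrow> 'v"
  assumes L: "finite L" "L2_orthonormal_on mu L f" and I: "finite I" "card I \<le> card L"
    and lin: "\<And>i c. i \<in> I \<Longrightarrow> \<beta> i (\<lambda>z. \<Sum>l\<in>L. c l *\<^sub>R f l z) = (\<Sum>l\<in>L. c l * \<beta> i (f l))"
    and eta: "\<eta> > 0"
  shows "\<exists>f'. L2_orthonormal_on mu I f' \<and> (\<forall>i\<in>I. \<forall>z. (\<forall>l\<in>L. f l z = 0) \<longrightarrow> f' i z = 0) \<and>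
    sqrt (\<Sum>i\<in>I. \<Sum>l\<in>L. (\<beta> i (f l))\<^sup>2) - \<eta> \<le> (\<Sum>i\<in>I. \<beta> i (f' i))"
proof -
  obtain \<iota> where \<iota>: "\<iota> ` I \<subseteq> L" "inj_on \<iota> I" using card_le_inj[OF I(1) L(1) I(2)] by blast
  \<comment> \<open>The matrix is made square by zero columns at indices outside the image of
    \<open>\<iota>\<close>; they contribute neither to the trace nor to the Frobenius norm.\<close>
  define A where "A l j = (if j \<in> \<iota> ` I then \<beta> (inv_into I \<iota> j) (f l) else 0)" for l j
  have A: "A l (\<iota> i) = \<beta> i (f l)" if "i \<in> I" for l i using that \<iota> by (simp add: A_def)
  have sumA: "(\<Sum>j\<in>L. g j) = (\<Sum>i\<in>I. g (\<iota> i))" if "\<And>j. j \<notin> \<iota> ` I \<Longrightarrow> g j = 0" for g :: "'l \<Rightarrow> real"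
    using that \<iota> L(1) by (subst sum.reindex[OF \<iota>(2), symmetric, unfolded comp_def])
      (intro sum.mono_neutral_right, auto)
  obtain U where U: "row_orthonormal L U"
    "(\<Sum>i\<in>L. \<Sum>l\<in>L. U i l * A l i) \<ge> sqrt (\<Sum>i\<in>L. \<Sum>l\<in>L. (A l i)\<^sup>2) - \<eta>"
    using orthonormal_trace_ge_frobenius[OF L(1) eta, of A] by blast
  have 1: "(\<Sum>i\<in>L. \<Sum>l\<in>L. (A l i)\<^sup>2) = (\<Sum>i\<in>I. \<Sum>l\<in>L. (\<beta> i (f l))\<^sup>2)"
    by (subst sumA) (auto simp: A_def[of _ "_"] A \<iota>(2) intro!: sum.cong)
  have 2: "(\<Sum>i\<in>L. \<Sum>l\<in>L. U i l * A l i) = (\<Sum>i\<in>I. \<Sum>l\<in>L. U (\<iota> i) l * \<beta> i (f l))"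
    by (subst sumA) (auto simp: A_def[of _ "_"] A \<iota>(2) intro!: sum.cong)
  let ?f = "\<lambda>i z. \<Sum>l\<in>L. U (\<iota> i) l *\<^sub>R f l z"
  have "L2_orthonormal_on mu I ?f" by (rule L2_orthonormal_on_rotate[OF L U(1) \<iota>(2,1)])
  then show ?thesis using U(2) unfolding 1 2 by (intro exI[of _ ?f]) (auto simp: lin)
qed

text \<open>The kernel is tied to \<open>T\<close> only through matrix elements between indicators
  of sets of finite measure, which is all that step functions can see, and only where it is
  integrable. The first argument of \<open>\<kappa>\<close> belongs to the output and the second to
  the input, while the component \<open>$ i $ j\<close> has the input coordinate first. Linearity is
  pointwise because \<open>T\<close> acts on functions, not on classes.\<close>

locale L2_kernel_operator = sigma_finite_measure mu
  for mu :: "'b measure" +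
  fixes T :: "('b \<Rightarrow> real^'n) \<Rightarrow> 'b \<Rightarrow> real^'m" and \<kappa> :: "'b \<times> 'b \<Rightarrow> real^'m^'n"
  assumes T_L2: "f \<in> L2 mu \<Longrightarrow> T f \<in> L2 mu"
    and T_add: "f \<in> L2 mu \<Longrightarrow> g \<in> L2 mu \<Longrightarrow> z \<in> space mu \<Longrightarrow> T (\<lambda>z. f z + g z) z = T f z + T g z"
    and T_scale: "f \<in> L2 mu \<Longrightarrow> z \<in> space mu \<Longrightarrow> T (\<lambda>z. c *\<^sub>R f z) z = c *\<^sub>R T f z"
    and \<kappa>_measurable [measurable]: "\<kappa> \<in> borel_measurable (mu \<Otimes>\<^sub>M mu)"
    and T_kernel: "\<And>A B i j. A \<in> sets mu \<Longrightarrow> B \<in> sets mu \<Longrightarrow> emeasure mu A < \<infinity> \<Longrightarrow> emeasure mu B < \<infinity> \<Longrightarrow>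
        integrable (mu \<Otimes>\<^sub>M mu) (\<lambda>z. indicator (A \<times> B) z * \<kappa> z $ i $ j) \<Longrightarrow>
        L2_inner mu (T (\<lambda>z. indicator B z *\<^sub>R axis i 1)) (\<lambda>z. indicator A z *\<^sub>R axis j 1)
          = (\<integral>z. indicator (A \<times> B) z * \<kappa> z $ i $ j \<partial>(mu \<Otimes>\<^sub>M mu))"
begin

lemma T_sum:
  assumes "finite I" "\<And>i. i \<in> I \<Longrightarrow> e i \<in> L2 mu" "z \<in> space mu"
  shows "T (\<lambda>z. \<Sum>i\<in>I. c i *\<^sub>R e i z) z = (\<Sum>i\<in>I. c i *\<^sub>R T (e i) z)"
  using assms
proof (induction I)
  case empty
  show ?case using T_scale[OF L2_zero empty(2), of 0] by simp
next
  case (insert i I)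
  then show ?case by (simp add: T_add T_scale L2_sum L2_scale)
qed

lemma T_inner_sum:
  assumes "finite I" "\<And>i. i \<in> I \<Longrightarrow> e i \<in> L2 mu" "g \<in> L2 mu"
  shows "L2_inner mu (T (\<lambda>z. \<Sum>i\<in>I. c i *\<^sub>R e i z)) g = (\<Sum>i\<in>I. c i * L2_inner mu (T (e i)) g)"
proof -
  have "L2_inner mu (T (\<lambda>z. \<Sum>i\<in>I. c i *\<^sub>R e i z)) g = L2_inner mu (\<lambda>z. \<Sum>i\<in>I. c i *\<^sub>R T (e i) z) g"
    unfolding L2_inner_def using assms(1,2) by (intro Bochner_Integration.integral_cong refl) (simp add: T_sum)
  then show ?thesis using assms by (simp add: L2_inner_sum_left T_L2)
qed

lemma T_inner_scale:
  assumes "e \<in> L2 mu" "f \<in> L2 mu"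
  shows "L2_inner mu (T (\<lambda>z. a *\<^sub>R e z)) (\<lambda>z. b *\<^sub>R f z) = a * (b * L2_inner mu (T e) f)"
proof -
  have "L2_inner mu (T (\<lambda>z. a *\<^sub>R e z)) (\<lambda>z. b *\<^sub>R f z) = a * L2_inner mu (T e) (\<lambda>z. b *\<^sub>R f z)"
    using T_inner_sum[of "{()}" "\<lambda>_. e" "\<lambda>z. b *\<^sub>R f z" "\<lambda>_. a"] assms L2_scale[OF assms(2)] by simp
  also have "L2_inner mu (T e) (\<lambda>z. b *\<^sub>R f z) = b * L2_inner mu (T e) f"
    using L2_inner_sum_right[of "{()}" "\<lambda>_. f" mu "T e" "\<lambda>_. b"] assms T_L2 by simp
  finally show ?thesis .
qed

text \<open>The larger of the two systems is rotated and cut to the size of the smaller, which stays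
  as it is.\<close>

lemma orthonormal_pair_frobenius:
  assumes I: "finite I" "L2_orthonormal_on mu I e" and L: "finite L" "L2_orthonormal_on mu L f"
    and D: "\<And>i z. i \<in> I \<Longrightarrow> z \<notin> D \<Longrightarrow> e i z = 0" "\<And>i z. i \<in> L \<Longrightarrow> z \<notin> D \<Longrightarrow> f i z = 0"
    and eta: "\<eta> > 0"
  shows "\<exists>(k::nat) e' f'. L2_orthonormal mu k e' \<and> L2_orthonormal mu k f' \<and>
     (\<forall>i<k. \<forall>z. z \<notin> D \<longrightarrow> e' i z = 0 \<and> f' i z = 0) \<and>
     sqrt (\<Sum>i\<in>I. \<Sum>l\<in>L. (L2_inner mu (T (e i)) (f l))\<^sup>2) - \<eta> \<le> (\<Sum>i<k. L2_inner mu (T (e' i)) (f' i))"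
proof -
  have eL: "i \<in> I \<Longrightarrow> e i \<in> L2 mu" and fL: "l \<in> L \<Longrightarrow> f l \<in> L2 mu" for i l
    using I L by (auto simp: L2_orthonormal_on_def)
  \<comment> \<open>The two cases below end with index sets of different types; both are renumbered
    by an initial segment of the naturals.\<close>
  have nat_index: ?thesis
    if J: "finite J" "L2_orthonormal_on mu J e'" "L2_orthonormal_on mu J f'"
      "\<And>i z. i \<in> J \<Longrightarrow> z \<notin> D \<Longrightarrow> e' i z = 0 \<and> f' i z = 0"
      and le: "sqrt (\<Sum>i\<in>I. \<Sum>l\<in>L. (L2_inner mu (T (e i)) (f l))\<^sup>2) - \<eta> \<le> (\<Sum>i\<in>J. L2_inner mu (T (e' i)) (f' i))"
    for J :: "'j set" and e' f'
  proof -
    obtain h where h: "bij_betw h {..<card J} J"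
      using ex_bij_betw_nat_finite[OF J(1)] by (auto simp: atLeast0LessThan)
    have hJ: "h i \<in> J" if "i < card J" for i using h that by (auto simp: bij_betw_def)
    have hin: "h i = h j \<longleftrightarrow> i = j" if "i < card J" "j < card J" for i j
      using h that by (auto simp: bij_betw_def dest: inj_onD)
    show ?thesis
      using J hJ hin le sum.reindex_bij_betw[OF h, of "\<lambda>i. L2_inner mu (T (e' i)) (f' i)"]
      unfolding L2_orthonormal_def L2_orthonormal_on_def
      by (intro exI[of _ "card J"] exI[of _ "\<lambda>i. e' (h i)"] exI[of _ "\<lambda>i. f' (h i)"]) auto
  qed
  show ?thesis
  proof (cases "card I \<le> card L")
    case True
    have "\<exists>f'. L2_orthonormal_on mu I f' \<and> (\<forall>i\<in>I. \<forall>z. (\<forall>l\<in>L. f l z = 0) \<longrightarrow> f' i z = 0) \<and>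
      sqrt (\<Sum>i\<in>I. \<Sum>l\<in>L. (L2_inner mu (T (e i)) (f l))\<^sup>2) - \<eta> \<le> (\<Sum>i\<in>I. L2_inner mu (T (e i)) (f' i))"
      using orthonormal_frame_frobenius[OF L I(1) True _ eta, of "\<lambda>i. L2_inner mu (T (e i))"]
      by (simp add: L2_inner_sum_right L(1) fL T_L2 eL)
    then obtain f' where "L2_orthonormal_on mu I f'" "\<forall>i\<in>I. \<forall>z. (\<forall>l\<in>L. f l z = 0) \<longrightarrow> f' i z = 0"
      "sqrt (\<Sum>i\<in>I. \<Sum>l\<in>L. (L2_inner mu (T (e i)) (f l))\<^sup>2) - \<eta> \<le> (\<Sum>i\<in>I. L2_inner mu (T (e i)) (f' i))"
      by blast
    then show ?thesis using D by (intro nat_index[of I e f'] I) auto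
  next
    case False
    have "\<exists>e'. L2_orthonormal_on mu L e' \<and> (\<forall>i\<in>L. \<forall>z. (\<forall>l\<in>I. e l z = 0) \<longrightarrow> e' i z = 0) \<and>
      sqrt (\<Sum>l\<in>L. \<Sum>i\<in>I. (L2_inner mu (T (e i)) (f l))\<^sup>2) - \<eta> \<le> (\<Sum>l\<in>L. L2_inner mu (T (e' l)) (f l))"
      using orthonormal_frame_frobenius[OF I L(1) _ _ eta, of "\<lambda>l e. L2_inner mu (T e) (f l)"] False
      by (simp add: T_inner_sum I(1) fL eL)
    then obtain e' where "L2_orthonormal_on mu L e'" "\<forall>i\<in>L. \<forall>z. (\<forall>l\<in>I. e l z = 0) \<longrightarrow> e' i z = 0"
      "sqrt (\<Sum>i\<in>I. \<Sum>l\<in>L. (L2_inner mu (T (e i)) (f l))\<^sup>2) - \<eta> \<le> (\<Sum>l\<in>L. L2_inner mu (T (e' l)) (f l))"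
      by (subst (asm) sum.swap) blast
    then show ?thesis using D by (intro nat_index[of L e' f] L) auto
  qed
qed


text \<open>A step function close to the kernel supplies a partition of \<open>D\<close> into cells.
  The matrix elements of \<open>T\<close> between normalised cell indicators are cell averages of
  the kernel up to scaling, and averages are the best approximation among step functions on that
  partition. Hence the Frobenius norm of this matrix misses the Hilbert-Schmidt norm by at most
  \<eta>/2; passing from Frobenius norm to a trace costs the other \<eta>/2.\<close>

lemma block_ge_hilbert_schmidt:
  assumes D: "D \<in> sets mu" "emeasure mu D < \<infinity>"
    and fin: "(\<integral>\<^sup>+z. indicator (D \<times> D) z * ennreal ((norm (\<kappa> z))\<^sup>2) \<partial>(mu \<Otimes>\<^sub>M mu)) < \<infinity>"
    and eta: "\<eta> > 0"
  shows "\<exists>(k::nat) e f. L2_orthonormal mu k e \<and> L2_orthonormal mu k f \<and>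
     (\<forall>i<k. \<forall>z. z \<notin> D \<longrightarrow> e i z = 0 \<and> f i z = 0) \<and>
     sqrt (enn2real (\<integral>\<^sup>+z. indicator (D \<times> D) z * ennreal ((norm (\<kappa> z))\<^sup>2) \<partial>(mu \<Otimes>\<^sub>M mu))) - \<eta>
       \<le> (\<Sum>i<k. L2_inner mu (T (e i)) (f i))"
proof -
  note [measurable] = D(1)
  \<comment> \<open>Restriction to \<open>D\<close> as a density: the measure becomes finite while
    the measurable sets stay those of \<open>mu\<close>.\<close>
  define N where "N = density mu (indicator D)"
  let ?Q = "mu \<Otimes>\<^sub>M mu"
  interpret N: finite_measure N
  proof
    have "emeasure N (space N) = emeasure mu (D \<inter> space mu)"
      unfolding N_def by (simp add: emeasure_restricted)
    then show "emeasure N (space N) \<noteq> \<infinity>"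
      using D by (simp add: Int_absorb2 sets.sets_into_space)
  qed
  have NN: "N \<Otimes>\<^sub>M N = density ?Q (\<lambda>(x, y). indicator D x * indicator D y)"
    unfolding N_def
  proof (rule pair_measure_density)
    show "sigma_finite_measure (density mu (indicator D))"
      using N.sigma_finite_measure_axioms unfolding N_def .
  qed (auto intro: sigma_finite_measure_axioms)
  have ind: "(\<lambda>(x, y). indicator D x * indicator D y) = (indicator (D \<times> D) :: _ \<Rightarrow> ennreal)"
    by (auto simp: indicator_def)
  have nnN: "(\<integral>\<^sup>+z. h z \<partial>(N \<Otimes>\<^sub>M N)) = (\<integral>\<^sup>+z. indicator (D \<times> D) z * h z \<partial>?Q)"
    if "h \<in> borel_measurable ?Q" for h
    unfolding NN ind using that by (intro nn_integral_density) measurable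
  have setsN: "sets (N \<Otimes>\<^sub>M N) = sets ?Q" unfolding NN by simp
  have measN: "\<kappa> \<in> borel_measurable (N \<Otimes>\<^sub>M N)"
    using \<kappa>_measurable by (simp add: measurable_cong_sets[OF setsN refl])
  have "rect_approx N \<kappa>"
    using fin by (intro rect_approx_square_integrable N.finite_measure_axioms measN) (simp add: nnN)
  moreover have "(\<eta>/2)\<^sup>2 > 0" using eta by simp
  ultimately obtain g where g: "rect_step N g"
    "(\<integral>\<^sup>+z. ennreal ((norm (\<kappa> z - g z))\<^sup>2) \<partial>(N \<Otimes>\<^sub>M N)) < ennreal ((\<eta>/2)\<^sup>2)"
    unfolding rect_approx_def by blast
  obtain p n c where p: "p \<in> measurable N (count_space UNIV)" "\<And>x. p x < (n::nat)"
    and gc: "g = (\<lambda>(x, y). c (p x) (p y))"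
    using g(1) unfolding rect_step_def by auto
  have [measurable]: "p \<in> measurable mu (count_space UNIV)" using p(1) unfolding N_def by simp
  have gm [measurable]: "g \<in> borel_measurable ?Q" unfolding gc by measurable
  define Ce where "Ce a = D \<inter> (p -` {a} \<inter> space mu)" for a
  have Cm [measurable]: "Ce a \<in> sets mu" for a unfolding Ce_def by measurable
  have CD: "Ce a \<subseteq> D" for a unfolding Ce_def by auto
  have Cfin: "emeasure mu (Ce a) < \<infinity>" for a
    using emeasure_mono[OF CD D(1), of a] D(2) by (simp add: order.strict_trans1)
  define m where "m a = measure mu (Ce a)" for a
  have em: "emeasure mu (Ce a) = ennreal (m a)" for a
    using Cfin[of a] unfolding m_def by (intro emeasure_eq_ennreal_measure) auto
  have emQ: "emeasure ?Q (Ce a \<times> Ce b) = ennreal (m a * m b)" for a b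
    using m_def by (simp add: emeasure_pair_measure_Times em ennreal_mult)
  have intC: "integrable ?Q (\<lambda>z. indicator (Ce a \<times> Ce b) z :: real)" for a b
    using emQ[of a b] by (intro integrable_real_indicator) (auto simp: less_top[symmetric])
  have IC: "(\<integral>z. indicator (Ce a \<times> Ce b) z \<partial>?Q) = m a * m b" for a b
    using emQ[of a b] m_def by (simp add: measure_def)
  have v: "integrable ?Q (\<lambda>z. indicator (D \<times> D) z * (norm (\<kappa> z))\<^sup>2)"
    using fin by (intro integrableI_nonneg) (auto simp: ennreal_mult ennreal_indicator)
  have nna: "(\<integral>\<^sup>+z. ennreal (indicator (D \<times> D) z * (norm (\<kappa> z - g z))\<^sup>2) \<partial>?Q) < ennreal ((\<eta>/2)\<^sup>2)"
    using g(2) by (subst (asm) nnN) (auto simp: ennreal_mult ennreal_indicator)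
  then have a: "integrable ?Q (\<lambda>z. indicator (D \<times> D) z * (norm (\<kappa> z - g z))\<^sup>2)"
    by (intro integrableI_nonneg) (auto intro: order.strict_trans)
  have a_le: "(\<integral>z. indicator (D \<times> D) z * (norm (\<kappa> z - g z))\<^sup>2 \<partial>?Q) \<le> (\<eta>/2)\<^sup>2"
    using nna by (simp add: nn_integral_eq_integral[OF a] ennreal_less_iff less_imp_le)
  have [measurable]: "(\<lambda>z. \<kappa> z $ i $ j) \<in> borel_measurable ?Q" for i j
    by (intro borel_measurable_continuous_on[OF _ \<kappa>_measurable, of "\<lambda>x. x $ i $ j"] continuous_intros)
  have [measurable]: "Ce a \<times> Ce b \<in> sets ?Q" for a b by simp
  have \<kappa>int: "integrable ?Q (\<lambda>z. indicator (Ce a \<times> Ce b) z * \<kappa> z $ i $ j)" for a b i j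
  proof (rule Bochner_Integration.integrable_bound)
    show "integrable ?Q (\<lambda>z. indicator (Ce a \<times> Ce b) z + indicator (D \<times> D) z * (norm (\<kappa> z))\<^sup>2)"
      by (intro Bochner_Integration.integrable_add intC v)
    have "\<bar>\<kappa> z $ i $ j\<bar> \<le> 1 + (norm (\<kappa> z))\<^sup>2" for z
    proof -
      have "\<bar>\<kappa> z $ i $ j\<bar> \<le> norm (\<kappa> z)"
        using component_le_norm_cart[of "\<kappa> z $ i" j] Finite_Cartesian_Product.norm_nth_le[of "\<kappa> z" i] by linarith
      also have "\<dots> \<le> 1 + (norm (\<kappa> z))\<^sup>2"
        using sum_squares_bound[of "norm (\<kappa> z)" 1] by simp (smt (verit) zero_le_power2)
      finally show ?thesis .
    qed
    then show "AE z in ?Q. norm (indicator (Ce a \<times> Ce b) z * \<kappa> z $ i $ j)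
        \<le> norm (indicator (Ce a \<times> Ce b) z + indicator (D \<times> D) z * (norm (\<kappa> z))\<^sup>2)"
      using CD[of a] CD[of b] by (intro AE_I2) (auto simp: indicator_def)
  qed measurable
  define K where "K a b i j = (\<integral>z. indicator (Ce a \<times> Ce b) z * \<kappa> z $ i $ j \<partial>?Q)" for a b i j
  \<comment> \<open>This is \<open>2 * (g \<bullet> \<kappa>) - g \<bullet> g\<close> on
    \<open>D \<times> D\<close>, written out over cells and components. It equals the squared norm
    of \<open>\<kappa>\<close> minus that of \<open>\<kappa> - g\<close>.\<close>
  let ?w = "\<lambda>z. \<Sum>a<n. \<Sum>b<n. \<Sum>i\<in>UNIV. \<Sum>j\<in>UNIV.
     2 * c a b $ i $ j * (indicator (Ce a \<times> Ce b) z * \<kappa> z $ i $ j) - (c a b $ i $ j)\<^sup>2 * indicator (Ce a \<times> Ce b) z"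
  have w: "indicator (D \<times> D) z * (norm (\<kappa> z))\<^sup>2 - indicator (D \<times> D) z * (norm (\<kappa> z - g z))\<^sup>2 = ?w z"
    if "z \<in> space ?Q" for z
  proof -
    obtain x y where z: "z = (x, y)" "x \<in> space mu" "y \<in> space mu" using \<open>z \<in> space ?Q\<close> by (auto simp: space_pair_measure)
    have ia: "indicator (Ce a \<times> Ce b) z = (if a = p x then if b = p y then indicator (D \<times> D) z else 0 else 0 :: real)" for a b
      using z by (auto simp: Ce_def indicator_def)
    have "?w z = (\<Sum>i\<in>UNIV. \<Sum>j\<in>UNIV. 2 * c (p x) (p y) $ i $ j * (indicator (D \<times> D) z * \<kappa> z $ i $ j) - (c (p x) (p y) $ i $ j)\<^sup>2 * indicator (D \<times> D) z)"
    proof -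
      let ?h = "\<lambda>a b. \<Sum>i\<in>UNIV. \<Sum>j\<in>UNIV. 2 * c a b $ i $ j * (indicator (D \<times> D) z * \<kappa> z $ i $ j) - (c a b $ i $ j)\<^sup>2 * indicator (D \<times> D) z"
      have "?w z = (\<Sum>a<n. \<Sum>b<n. if a = p x then if b = p y then ?h a b else 0 else 0)"
        by (intro sum.cong[OF refl]) (simp add: ia)
      also have "\<dots> = (\<Sum>a<n. if a = p x then \<Sum>b<n. if b = p y then ?h a b else 0 else 0)"
        by (intro sum.cong[OF refl]) simp
      also have "\<dots> = (\<Sum>i\<in>UNIV. \<Sum>j\<in>UNIV. 2 * c (p x) (p y) $ i $ j * (indicator (D \<times> D) z * \<kappa> z $ i $ j) - (c (p x) (p y) $ i $ j)\<^sup>2 * indicator (D \<times> D) z)"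
        using p(2) by simp
      finally show ?thesis .
    qed
    also have "\<dots> = indicator (D \<times> D) z * (2 * (g z \<bullet> \<kappa> z) - g z \<bullet> g z)"
      unfolding gc z inner_vec_def
      by (simp add: sum_subtractf sum_distrib_left power2_eq_square algebra_simps)
    also have "\<dots> = indicator (D \<times> D) z * (norm (\<kappa> z))\<^sup>2 - indicator (D \<times> D) z * (norm (\<kappa> z - g z))\<^sup>2"
      unfolding power2_norm_eq_inner by (simp add: inner_diff_left inner_diff_right inner_commute algebra_simps)
    finally show ?thesis ..
  qed
  have "(\<integral>z. indicator (D \<times> D) z * (norm (\<kappa> z))\<^sup>2 \<partial>?Q) - (\<integral>z. indicator (D \<times> D) z * (norm (\<kappa> z - g z))\<^sup>2 \<partial>?Q) = (\<integral>z. ?w z \<partial>?Q)"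
    using w by (subst Bochner_Integration.integral_diff[OF v a, symmetric]) (intro Bochner_Integration.integral_cong refl)
  also have "(\<integral>z. ?w z \<partial>?Q) = (\<Sum>a<n. \<Sum>b<n. \<Sum>i\<in>UNIV. \<Sum>j\<in>UNIV. 2 * c a b $ i $ j * K a b i j - (c a b $ i $ j)\<^sup>2 * (m a * m b))"
    unfolding K_def using \<kappa>int intC
    using IC by (simp add: Bochner_Integration.integral_sum)
  \<comment> \<open>As a quadratic polynomial in the value \<open>c\<close> on a cell, each term is
    largest at the cell average \<open>K / (m a * m b)\<close>, where it equals the right
    side.\<close>
  also have "\<dots> \<le> (\<Sum>a<n. \<Sum>b<n. \<Sum>i\<in>UNIV. \<Sum>j\<in>UNIV. if m a > 0 \<and> m b > 0 then (K a b i j)\<^sup>2 / (m a * m b) else 0)"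
  proof (intro sum_mono)
    fix a b i j
    show "2 * c a b $ i $ j * K a b i j - (c a b $ i $ j)\<^sup>2 * (m a * m b) \<le> (if m a > 0 \<and> m b > 0 then (K a b i j)\<^sup>2 / (m a * m b) else 0)"
    proof (cases "m a > 0 \<and> m b > 0")
      case True
      then have mm: "m a * m b > 0" by simp
      have "0 \<le> (K a b i j - c a b $ i $ j * (m a * m b))\<^sup>2" by simp
      then have "(2 * c a b $ i $ j * K a b i j - (c a b $ i $ j)\<^sup>2 * (m a * m b)) * (m a * m b) \<le> (K a b i j)\<^sup>2"
        by (simp add: power2_eq_square algebra_simps)
      then show ?thesis using True mm by (simp add: pos_le_divide_eq)
    next
      case False
      \<comment> \<open>A cell without mass makes the rectangle a null set, so \<open>K\<close>
        vanishes and the default value 0 is correct.\<close>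
      then have mm: "m a * m b = 0" by (auto simp: m_def less_le)
      then have "Ce a \<times> Ce b \<in> null_sets ?Q" using emQ[of a b] by (intro null_setsI) auto
      then have "AE z in ?Q. indicator (Ce a \<times> Ce b) z * \<kappa> z $ i $ j = 0"
        by (rule AE_mp[OF AE_not_in]) (auto simp: indicator_def)
      then have "K a b i j = 0" unfolding K_def by (intro integral_eq_zero_AE)
      then show ?thesis using False mm by (simp only: mult_zero_right if_False)
    qed
  qed
  finally have le1: "(\<integral>z. indicator (D \<times> D) z * (norm (\<kappa> z))\<^sup>2 \<partial>?Q)
    \<le> (\<eta>/2)\<^sup>2 + (\<Sum>a<n. \<Sum>b<n. \<Sum>i\<in>UNIV. \<Sum>j\<in>UNIV. if m a > 0 \<and> m b > 0 then (K a b i j)\<^sup>2 / (m a * m b) else 0)"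
    using a_le by linarith
  define J where "J = {a. a < n \<and> m a > 0}"
  have J: "finite J" unfolding J_def by simp
  let ?e = "\<lambda>(b, i) z. (1 / sqrt (m b)) *\<^sub>R (indicator (Ce b) z *\<^sub>R axis i (1::real))"
  have cellL2: "(\<lambda>z. indicator (Ce b) z *\<^sub>R axis i (1::real)) \<in> L2 mu" for b and i :: "'k::finite"
  proof -
    have "(norm (indicator (Ce b) z *\<^sub>R axis i (1::real)))\<^sup>2 = indicator (Ce b) z" for z
      by (simp add: indicator_def norm_axis_1)
    then show ?thesis unfolding L2_def using Cfin[of b]
      by (simp del: norm_scaleR)
  qed
  have on: "L2_orthonormal_on mu (J \<times> UNIV) (?e :: nat \<times> 'k::finite \<Rightarrow> 'b \<Rightarrow> real^'k)"
    unfolding L2_orthonormal_on_def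
  proof (intro conjI ballI)
    fix s :: "nat \<times> 'k" assume "s \<in> J \<times> UNIV"
    show "?e s \<in> L2 mu" unfolding split_beta by (rule L2_scale[OF cellL2])
  next
    fix s t :: "nat \<times> 'k" assume st: "s \<in> J \<times> UNIV" "t \<in> J \<times> UNIV"
    obtain a i b j where s: "s = (a, i)" "t = (b, j)" by (cases s, cases t)
    show "L2_inner mu (?e s) (?e t) = (if s = t then 1 else 0)"
    proof (cases "s = t")
      case True
      have "L2_inner mu (?e s) (?e t) = (\<integral>z. (1 / m a) * indicator (Ce a) z \<partial>mu)"
        unfolding L2_inner_def using True s st
        by (intro Bochner_Integration.integral_cong refl) (auto simp: inner_axis_axis indicator_def J_def)
      also have "\<dots> = 1" using st s Cm unfolding J_def by (simp add: m_def[symmetric] flip: m_def)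
      finally show ?thesis using True by simp
    next
      case False
      then have "?e s z \<bullet> ?e t z = 0" for z
        using s by (auto simp: inner_axis_axis indicator_def Ce_def)
      then show ?thesis using False unfolding L2_inner_def by simp
    qed
  qed
  \<comment> \<open>The cell \<open>b\<close> and coordinate \<open>i\<close> belong to the input,
    \<open>a\<close> and \<open>j\<close> to the output; \<open>K\<close> carries them in the order
    of the kernel.\<close>
  have \<beta>: "L2_inner mu (T (?e (b, i))) (?e (a, j)) = K a b i j / (sqrt (m a) * sqrt (m b))" for a b i j
  proof -
    have "L2_inner mu (T (?e (b, i))) (?e (a, j))
      = (1 / sqrt (m b)) * ((1 / sqrt (m a)) * L2_inner mu (T (\<lambda>z. indicator (Ce b) z *\<^sub>R axis i 1)) (\<lambda>z. indicator (Ce a) z *\<^sub>R axis j 1))"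
      unfolding prod.case by (intro T_inner_scale cellL2)
    also have "L2_inner mu (T (\<lambda>z. indicator (Ce b) z *\<^sub>R axis i 1)) (\<lambda>z. indicator (Ce a) z *\<^sub>R axis j 1) = K a b i j"
      unfolding K_def by (intro T_kernel Cm Cfin \<kappa>int)
    finally show ?thesis by simp
  qed
  have F: "(\<Sum>s\<in>J \<times> UNIV. \<Sum>t\<in>J \<times> UNIV. (L2_inner mu (T (?e s)) (?e t))\<^sup>2)
    = (\<Sum>a<n. \<Sum>b<n. \<Sum>i\<in>UNIV. \<Sum>j\<in>UNIV. if m a > 0 \<and> m b > 0 then (K a b i j)\<^sup>2 / (m a * m b) else 0)"
  proof -
    have m0: "m a \<ge> 0" for a by (simp add: m_def)
    have "(\<Sum>s\<in>J \<times> UNIV. \<Sum>t\<in>J \<times> UNIV. (L2_inner mu (T (?e s)) (?e t))\<^sup>2)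
      = (\<Sum>b\<in>J. \<Sum>i\<in>UNIV. \<Sum>a\<in>J. \<Sum>j\<in>UNIV. (L2_inner mu (T (?e (b, i))) (?e (a, j)))\<^sup>2)"
      by (simp only: sum.cartesian_product' prod.case)
    also have "\<dots> = (\<Sum>b\<in>J. \<Sum>i\<in>UNIV. \<Sum>a\<in>J. \<Sum>j\<in>UNIV. (K a b i j)\<^sup>2 / (m a * m b))"
      unfolding \<beta> using m0 by (simp add: power_divide power_mult_distrib)
    also have "\<dots> = (\<Sum>b\<in>J. \<Sum>a\<in>J. \<Sum>i\<in>UNIV. \<Sum>j\<in>UNIV. (K a b i j)\<^sup>2 / (m a * m b))"
      by (intro sum.cong refl sum.swap)
    also have "\<dots> = (\<Sum>a\<in>J. \<Sum>b\<in>J. \<Sum>i\<in>UNIV. \<Sum>j\<in>UNIV. (K a b i j)\<^sup>2 / (m a * m b))"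
      by (rule sum.swap)
    also have "\<dots> = (\<Sum>a<n. if m a > 0 then \<Sum>b<n. if m b > 0 then \<Sum>i\<in>UNIV. \<Sum>j\<in>UNIV. (K a b i j)\<^sup>2 / (m a * m b) else 0 else 0)"
      unfolding J_def by (simp add: sum.inter_filter[symmetric] lessThan_def)
    also have "\<dots> = (\<Sum>a<n. \<Sum>b<n. \<Sum>i\<in>UNIV. \<Sum>j\<in>UNIV. if m a > 0 \<and> m b > 0 then (K a b i j)\<^sup>2 / (m a * m b) else 0)"
      by (intro sum.cong refl) (auto intro!: sum.cong)
    finally show ?thesis .
  qed
  let ?V = "\<integral>z. indicator (D \<times> D) z * (norm (\<kappa> z))\<^sup>2 \<partial>?Q"
  let ?F = "\<Sum>s\<in>J \<times> UNIV. \<Sum>t\<in>J \<times> UNIV. (L2_inner mu (T (?e s)) (?e t))\<^sup>2"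
  have "?V \<le> ?F + (\<eta>/2)\<^sup>2" using le1 unfolding F by simp
  \<comment> \<open>The approximation error was fixed as a square, so that subadditivity of the root
    leaves exactly \<eta>/2.\<close>
  then have "sqrt ?V \<le> sqrt (?F + (\<eta>/2)\<^sup>2)" by simp
  also have "\<dots> \<le> sqrt ?F + \<eta>/2"
    using sqrt_add_le_add_sqrt[of ?F "(\<eta>/2)\<^sup>2"] eta by (simp add: sum_nonneg)
  finally have VF: "sqrt ?V \<le> sqrt ?F + \<eta>/2" .
  have eV: "enn2real (\<integral>\<^sup>+z. indicator (D \<times> D) z * ennreal ((norm (\<kappa> z))\<^sup>2) \<partial>?Q) = ?V"
    by (subst integral_eq_nn_integral) (auto simp: ennreal_mult ennreal_indicator)
  have "\<exists>(k::nat) e' f'. L2_orthonormal mu k e' \<and> L2_orthonormal mu k f' \<and>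
     (\<forall>i<k. \<forall>z. z \<notin> D \<longrightarrow> e' i z = 0 \<and> f' i z = 0) \<and>
     sqrt ?F - \<eta>/2 \<le> (\<Sum>i<k. L2_inner mu (T (e' i)) (f' i))"
    using eta J by (intro orthonormal_pair_frobenius on) (auto simp: indicator_def Ce_def)
  then obtain k :: nat and e' f' where k: "L2_orthonormal mu k e'" "L2_orthonormal mu k f'"
    "\<forall>i<k. \<forall>z. z \<notin> D \<longrightarrow> e' i z = 0 \<and> f' i z = 0"
    "sqrt ?F - \<eta>/2 \<le> (\<Sum>i<k. L2_inner mu (T (e' i)) (f' i))" by blast
  have "sqrt ?V - \<eta> \<le> (\<Sum>i<k. L2_inner mu (T (e' i)) (f' i))" using k(4) VF by linarith
  then show ?thesis unfolding eV using k(1-3) by blast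
qed

text \<open>Systems living on disjoint sets are orthogonal to each other, so the pairs found for the
  separate blocks join to one admissible pair. Each function is paired only with its partner from
  the same block, hence the traces add up and no off-diagonal block enters.\<close>

lemma trace_norm_ge_sum_blocks:
  assumes Q: "finite Q" and D: "\<And>q. q \<in> Q \<Longrightarrow> D q \<in> sets mu" "\<And>q. q \<in> Q \<Longrightarrow> emeasure mu (D q) < \<infinity>"
    and disj: "disjoint_family_on D Q"
    and fin: "\<And>q. q \<in> Q \<Longrightarrow> (\<integral>\<^sup>+z. indicator (D q \<times> D q) z * ennreal ((norm (\<kappa> z))\<^sup>2) \<partial>(mu \<Otimes>\<^sub>M mu)) < \<infinity>"
  shows "ennreal (\<Sum>q\<in>Q. sqrt (enn2real (\<integral>\<^sup>+z. indicator (D q \<times> D q) z * ennreal ((norm (\<kappa> z))\<^sup>2) \<partial>(mu \<Otimes>\<^sub>M mu))))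
     \<le> trace_norm mu mu T" (is "ennreal (\<Sum>q\<in>Q. ?s q) \<le> _")
proof (cases "trace_norm mu mu T")
  case (real r)
  have "(\<Sum>q\<in>Q. ?s q) \<le> r + \<epsilon>" if e: "\<epsilon> > 0" for \<epsilon>
  proof -
    \<comment> \<open>The total loss over all blocks stays below \<epsilon>; the added 1 covers the
      empty family.\<close>
    define \<eta> where "\<eta> = \<epsilon> / (card Q + 1)"
    have eta: "\<eta> > 0" using e unfolding \<eta>_def by simp
    let ?R = "\<lambda>q (k::nat, e, f). L2_orthonormal mu k e \<and> L2_orthonormal mu k f \<and>
       (\<forall>i<k. \<forall>z. z \<notin> D q \<longrightarrow> e i z = 0 \<and> f i z = 0) \<and>
       ?s q - \<eta> \<le> (\<Sum>i<k. L2_inner mu (T (e i)) (f i))"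
    have "\<forall>q\<in>Q. \<exists>x. ?R q x"
      using block_ge_hilbert_schmidt[OF D fin eta] by simp
    from bchoice[OF this] obtain X where X: "\<forall>q\<in>Q. ?R q (X q)" ..
    define k e f where "k q = fst (X q)" and "e q = fst (snd (X q))" and "f q = snd (snd (X q))" for q
    have kef: "\<And>q. q \<in> Q \<Longrightarrow> L2_orthonormal mu (k q) (e q)"
        "\<And>q. q \<in> Q \<Longrightarrow> L2_orthonormal mu (k q) (f q)"
      and supp: "\<And>q i z. q \<in> Q \<Longrightarrow> i < k q \<Longrightarrow> z \<notin> D q \<Longrightarrow> e q i z = 0 \<and> f q i z = 0"
      and ge: "\<And>q. q \<in> Q \<Longrightarrow> ?s q - \<eta> \<le> (\<Sum>i<k q. L2_inner mu (T (e q i)) (f q i))"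
      using X unfolding k_def e_def f_def split_beta by blast+
    let ?I = "SIGMA q:Q. {..<k q}"
    have orth: "L2_orthonormal_on mu ?I (\<lambda>(q, i). h q i)"
      if h: "\<And>q. q \<in> Q \<Longrightarrow> L2_orthonormal mu (k q) (h q)"
        and hs: "\<And>q i z. q \<in> Q \<Longrightarrow> i < k q \<Longrightarrow> z \<notin> D q \<Longrightarrow> h q i z = 0"
      for h :: "_ \<Rightarrow> nat \<Rightarrow> 'b \<Rightarrow> 'w::euclidean_space"
    proof -
      have "L2_inner mu (h q i) (h q' j) = (if (q, i) = (q', j) then 1 else 0)"
        if q: "q \<in> Q" "i < k q" "q' \<in> Q" "j < k q'" for q i q' j
      proof (cases "q = q'")
        case False
        have "D q \<inter> D q' = {}" using disj q False unfolding disjoint_family_on_def by blast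
        then have "h q i z \<bullet> h q' j z = 0" for z
          using hs[OF q(1,2), of z] hs[OF q(3,4), of z]
          by (metis IntI empty_iff inner_zero_left inner_zero_right)
        then show ?thesis using False by (simp add: L2_inner_def)
      qed (use h[OF q(1)] q in \<open>auto simp: L2_orthonormal_def\<close>)
      then show ?thesis using h unfolding L2_orthonormal_on_def L2_orthonormal_def by auto
    qed
    have I: "finite ?I" using Q by auto
    have "ennreal (\<Sum>s\<in>?I. \<bar>L2_inner mu (T (case_prod e s)) (case_prod f s)\<bar>) \<le> trace_norm mu mu T"
      using kef supp by (intro trace_norm_ge I orth) auto
    then have "(\<Sum>s\<in>?I. \<bar>L2_inner mu (T (case_prod e s)) (case_prod f s)\<bar>) \<le> r"
      using real by (simp add: ennreal_le_iff)
    moreover have "(\<Sum>s\<in>?I. \<bar>L2_inner mu (T (case_prod e s)) (case_prod f s)\<bar>)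
       = (\<Sum>q\<in>Q. \<Sum>i<k q. \<bar>L2_inner mu (T (e q i)) (f q i)\<bar>)"
      using Q by (subst sum.Sigma) (auto simp: split_beta)
    moreover have "(\<Sum>q\<in>Q. ?s q - \<eta>) \<le> (\<Sum>q\<in>Q. \<Sum>i<k q. \<bar>L2_inner mu (T (e q i)) (f q i)\<bar>)"
      using ge by (intro sum_mono) (meson abs_ge_self order_trans sum_mono)
    moreover have "card Q * \<eta> \<le> \<epsilon>" using e unfolding \<eta>_def by (simp add: field_simps)
    ultimately show ?thesis by (simp add: sum_subtractf)
  qed
  then have "(\<Sum>q\<in>Q. ?s q) \<le> r" by (rule field_le_epsilon)
  then show ?thesis using real by (simp add: ennreal_leI)
qed simp

end

section \<open>Stable stochastic flows\<close>

text \<open>Caratheodory functions: for simple \<open>g\<close> the composition is measurable piece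
  by piece, and continuity in the second argument passes to the limit. Flows are of this kind, being
  measurable for each fixed vector and bounded linear in the vector.\<close>

lemma borel_measurable_continuous_parameter:
  fixes \<phi> :: "'b \<Rightarrow> 'x::{metric_space, second_countable_topology} \<Rightarrow> 'y::metric_space"
  assumes \<phi>: "\<And>x. (\<lambda>v. \<phi> v x) \<in> borel_measurable L"
    and cont: "\<And>v. v \<in> space L \<Longrightarrow> continuous_on UNIV (\<phi> v)"
    and g: "g \<in> borel_measurable L"
  shows "(\<lambda>v. \<phi> v (g v)) \<in> borel_measurable L"
proof -
  obtain s where s: "\<And>i. simple_function L (s i)" "\<And>v. v \<in> space L \<Longrightarrow> (\<lambda>i. s i v) \<longlonglongrightarrow> g v"
    using borel_measurable_implies_sequence_metric[OF g, of undefined] by blast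
  show ?thesis
  proof (rule borel_measurable_LIMSEQ_metric)
    fix i
    have "(\<lambda>v. \<phi> v (s i v)) \<in> borel_measurable L"
    proof (rule measurable_compose_countable'[where I = "s i ` space L"])
      show "s i \<in> measurable L (count_space (s i ` space L))"
        using s(1)[of i] by (simp add: simple_function_def measurable_count_space_eq2)
      show "countable (s i ` space L)" using s(1)[of i] by (simp add: simple_function_def countable_finite)
    qed (rule \<phi>)
    then show "(\<lambda>v. \<phi> v (s i v)) \<in> borel_measurable L" .
  next
    fix v assume v: "v \<in> space L"
    have "isCont (\<phi> v) (g v)" using cont[OF v] by (simp add: continuous_on_eq_continuous_at)
    then show "(\<lambda>i. \<phi> v (s i v)) \<longlonglongrightarrow> \<phi> v (g v)"
      using s(2)[OF v] by (rule isCont_tendsto_compose)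
  qed
qed

definition pos_time :: "real measure" where
  "pos_time = restrict_space lborel {0<..}"

lemma space_pos_time [simp]: "space pos_time = {0<..}"
  unfolding pos_time_def by (simp add: space_restrict_space)

lemma sigma_finite_pos_time: "sigma_finite_measure pos_time"
  unfolding pos_time_def by (rule sigma_finite_measure_restrict_space) (auto intro: sigma_finite_lborel)

lemma Omega_pos_eq: "Omega_pos M = pos_time \<Otimes>\<^sub>M M"
  unfolding Omega_pos_def pos_time_def ..

lemma nn_integral_pos_time: "(\<integral>\<^sup>+t. f t \<partial>pos_time) = (\<integral>\<^sup>+t. f t * indicator {0<..} t \<partial>lborel)"
  unfolding pos_time_def by (rule nn_integral_restrict_space) simp

locale stable_flow = prob_space M for M :: "'a measure" +
  fixes F :: "real \<Rightarrow> 'a measure"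
    and Phi :: "real \<Rightarrow> real \<Rightarrow> 'a \<Rightarrow> 'x::{real_inner,banach,second_countable_topology} \<Rightarrow> 'x"
  assumes filtration: "usual_filtration M F" and flow: "stoch_flow M F Phi"
    and stable: "ms_exp_stable M Phi" and markov: "markov_sg M Phi"
begin

section \<open>Measurability and laws of a single flow\<close>

lemma linear_Phi: "0 \<le> s \<Longrightarrow> s \<le> t \<Longrightarrow> w \<in> space M \<Longrightarrow> bounded_linear (Phi t s w)"
  using flow unfolding stoch_flow_def by blast

lemma measurable_Phi: "0 \<le> s \<Longrightarrow> s \<le> t \<Longrightarrow> (\<lambda>w. Phi t s w x) \<in> borel_measurable M"
  using flow filtration unfolding stoch_flow_def usual_filtration_def
  by (meson measurable_from_subalg)

lemma measurable_Phi_simplex: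
  "(\<lambda>((t, s), w). Phi t s w x) \<in> borel_measurable (restrict_space (lborel \<Otimes>\<^sub>M lborel) {(t, s). 0 \<le> s \<and> s \<le> t} \<Otimes>\<^sub>M M)"
  using flow unfolding stoch_flow_def by blast

lemma measurable_Phi_fst: "(\<lambda>(t, w). Phi t 0 w x) \<in> borel_measurable (pos_time \<Otimes>\<^sub>M M)"
proof -
  have "(\<lambda>t. (t, 0::real)) \<in> measurable pos_time (restrict_space (lborel \<Otimes>\<^sub>M lborel) {(t, s). 0 \<le> s \<and> s \<le> t})"
    unfolding pos_time_def
    by (rule measurable_restrict_space2) (auto simp: space_restrict_space intro!: measurable_restrict_space1)
  then have "(\<lambda>(t, w). ((t, 0::real), w)) \<in> measurable (pos_time \<Otimes>\<^sub>M M)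
      (restrict_space (lborel \<Otimes>\<^sub>M lborel) {(t, s). 0 \<le> s \<and> s \<le> t} \<Otimes>\<^sub>M M)"
    by measurable
  from measurable_compose[OF this measurable_Phi_simplex] show ?thesis by (simp add: case_prod_unfold)
qed

lemma measurable_Phi_snd:
  "(\<lambda>(s, w). Phi t s w x) \<in> borel_measurable (restrict_space lborel {0<..t} \<Otimes>\<^sub>M M)"
proof -
  have "(\<lambda>s. (t, s)) \<in> measurable (restrict_space lborel {0<..t}) (restrict_space (lborel \<Otimes>\<^sub>M lborel) {(t, s). 0 \<le> s \<and> s \<le> t})"
    by (rule measurable_restrict_space2) (auto simp: space_restrict_space intro!: measurable_restrict_space1)
  then have "(\<lambda>(s, w). ((t, s), w)) \<in> measurable (restrict_space lborel {0<..t} \<Otimes>\<^sub>M M)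
      (restrict_space (lborel \<Otimes>\<^sub>M lborel) {(t, s). 0 \<le> s \<and> s \<le> t} \<Otimes>\<^sub>M M)"
    by measurable
  from measurable_compose[OF this measurable_Phi_simplex] show ?thesis by (simp add: case_prod_unfold)
qed

lemma measurable_Phi_compose:
  assumes s: "0 \<le> s" "s \<le> t" and h: "h \<in> measurable L M" and g: "g \<in> borel_measurable L"
  shows "(\<lambda>v. Phi t s (h v) (g v)) \<in> borel_measurable L"
proof (rule borel_measurable_continuous_parameter[OF _ _ g])
  show "(\<lambda>v. Phi t s (h v) x) \<in> borel_measurable L" for x
    using measurable_compose[OF h measurable_Phi[OF s]] .
  show "continuous_on UNIV (Phi t s (h v))" if "v \<in> space L" for v
    using measurable_space[OF h that] by (intro linear_continuous_on linear_Phi s)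
qed

lemma measurable_Phi_compose_pos:
  assumes f: "f \<in> measurable L pos_time" and h: "h \<in> measurable L M" and g: "g \<in> borel_measurable L"
  shows "(\<lambda>v. Phi (f v) 0 (h v) (g v)) \<in> borel_measurable L"
proof (rule borel_measurable_continuous_parameter[OF _ _ g])
  show "(\<lambda>v. Phi (f v) 0 (h v) x) \<in> borel_measurable L" for x
    using measurable_compose[OF measurable_Pair[OF f h] measurable_Phi_fst[of x]] by simp
  show "continuous_on UNIV (Phi (f v) 0 (h v))" if "v \<in> space L" for v
    using measurable_space[OF f that] measurable_space[OF h that] by (intro linear_continuous_on linear_Phi) auto
qed

text \<open>Indicators of Borel sets are bounded and thus admissible in \<open>markov_sg\<close>;
  for them the two Markov identities become statements about laws.\<close>

lemma markov_indicator:
  assumes A: "A \<in> sets borel" and ts: "0 \<le> t" "0 \<le> s"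
  shows "prob ((\<lambda>w. Phi (s + t) s w x) -` A \<inter> space M) = prob ((\<lambda>w. Phi t 0 w x) -` A \<inter> space M)"
    and "prob ((\<lambda>w. Phi (t + s) 0 w x) -` A \<inter> space M)
       = (\<integral>w. prob ((\<lambda>w'. Phi s 0 w' (Phi t 0 w x)) -` A \<inter> space M) \<partial>M)"
proof -
  let ?f = "indicator A :: 'x \<Rightarrow> real"
  have eq: "(\<integral>w. ?f (Phi t s w x) \<partial>M) = prob ((\<lambda>w. Phi t s w x) -` A \<inter> space M)"
    if "0 \<le> s" "s \<le> t" for t s x
  proof -
    have "(\<integral>w. ?f (Phi t s w x) \<partial>M) = (\<integral>w. indicator ((\<lambda>w. Phi t s w x) -` A \<inter> space M) w \<partial>M)"
      by (intro Bochner_Integration.integral_cong) (auto simp: indicator_def)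
    then show ?thesis using measurable_sets[OF measurable_Phi[OF that] A] by simp
  qed
  have "\<forall>t s x. 0 \<le> s \<and> s \<le> t \<longrightarrow> integrable M (\<lambda>w. ?f (Phi t s w x))"
  proof (intro allI impI, elim conjE)
    fix t s :: real and x assume "0 \<le> s" "s \<le> t"
    then have "(\<lambda>w. ?f (Phi t s w x)) \<in> borel_measurable M"
      using measurable_compose[OF measurable_Phi borel_measurable_indicator[OF A]] by blast
    then show "integrable M (\<lambda>w. ?f (Phi t s w x))"
      by (rule integrable_const_bound[where B = 1, rotated]) (auto simp: indicator_def)
  qed
  then have m: "\<And>t s x. 0 \<le> t \<Longrightarrow> 0 \<le> s \<Longrightarrow> (\<integral>w. ?f (Phi (s + t) s w x) \<partial>M) = trans_op M Phi t ?f x"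
    "\<And>t s x. 0 \<le> t \<Longrightarrow> 0 \<le> s \<Longrightarrow> trans_op M Phi (t + s) ?f x = trans_op M Phi t (trans_op M Phi s ?f) x"
    using markov unfolding markov_sg_def by blast+
  show "prob ((\<lambda>w. Phi (s + t) s w x) -` A \<inter> space M) = prob ((\<lambda>w. Phi t 0 w x) -` A \<inter> space M)"
    using m(1)[OF ts, of x] ts unfolding trans_op_def by (simp add: eq)
  show "prob ((\<lambda>w. Phi (t + s) 0 w x) -` A \<inter> space M)
       = (\<integral>w. prob ((\<lambda>w'. Phi s 0 w' (Phi t 0 w x)) -` A \<inter> space M) \<partial>M)"
    using m(2)[OF ts, of x] ts unfolding trans_op_def by (simp add: eq)
qed

text \<open>Equality on all Borel sets is equality of laws, which carries over to every nonnegative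
  Borel function, bounded or not.\<close>

lemma nn_integral_homogeneous:
  assumes ts: "0 \<le> t" "0 \<le> s" and G: "G \<in> borel_measurable borel"
  shows "(\<integral>\<^sup>+w. G (Phi (s + t) s w x) \<partial>M) = (\<integral>\<^sup>+w. G (Phi t 0 w x) \<partial>M)"
proof -
  have m [measurable]: "(\<lambda>w. Phi (s + t) s w x) \<in> borel_measurable M" "(\<lambda>w. Phi t 0 w x) \<in> borel_measurable M"
    using ts by (auto intro!: measurable_Phi)
  have "distr M borel (\<lambda>w. Phi (s + t) s w x) = distr M borel (\<lambda>w. Phi t 0 w x)"
    using markov_indicator(1)[OF _ ts, of _ x]
    by (intro measure_eqI) (auto simp: emeasure_distr emeasure_eq_measure)
  then show ?thesis using nn_integral_distr[OF m(1), of G] nn_integral_distr[OF m(2), of G] G by simp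
qed

text \<open>Chapman-Kolmogorov: in law, running for time \<open>t + s\<close> is running for time
  \<open>t\<close> and then restarting for time \<open>s\<close> with a fresh sample
  \<open>w'\<close>. The right side is therefore an integral over the product space.\<close>

lemma nn_integral_semigroup:
  assumes ts: "0 \<le> t" "0 \<le> s" and G [measurable]: "G \<in> borel_measurable borel"
  shows "(\<integral>\<^sup>+w. G (Phi (t + s) 0 w x) \<partial>M) = (\<integral>\<^sup>+w. \<integral>\<^sup>+w'. G (Phi s 0 w' (Phi t 0 w x)) \<partial>M \<partial>M)"
proof -
  have m [measurable]: "(\<lambda>w. Phi (t + s) 0 w x) \<in> borel_measurable M" "(\<lambda>w. Phi t 0 w x) \<in> borel_measurable M"
    using ts by (auto intro!: measurable_Phi)
  have m2 [measurable]: "(\<lambda>(w, w'). Phi s 0 w' (Phi t 0 w x)) \<in> borel_measurable (M \<Otimes>\<^sub>M M)"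
    unfolding split_beta using ts by (intro measurable_Phi_compose) measurable
  have "distr M borel (\<lambda>w. Phi (t + s) 0 w x) = distr (M \<Otimes>\<^sub>M M) borel (\<lambda>(w, w'). Phi s 0 w' (Phi t 0 w x))"
  proof (rule measure_eqI)
    fix A assume "A \<in> sets (distr M borel (\<lambda>w. Phi (t + s) 0 w x))"
    then have A [measurable]: "A \<in> sets borel" by simp
    let ?g = "\<lambda>w. prob ((\<lambda>w'. Phi s 0 w' (Phi t 0 w x)) -` A \<inter> space M)"
    have S: "(\<lambda>(w, w'). Phi s 0 w' (Phi t 0 w x)) -` A \<inter> space (M \<Otimes>\<^sub>M M) \<in> sets (M \<Otimes>\<^sub>M M)"
      by measurable
    have sect: "Pair w -` ((\<lambda>(w, w'). Phi s 0 w' (Phi t 0 w x)) -` A \<inter> space (M \<Otimes>\<^sub>M M))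
        = (\<lambda>w'. Phi s 0 w' (Phi t 0 w x)) -` A \<inter> space M" if "w \<in> space M" for w
      using that by (auto simp: space_pair_measure)
    have gm: "?g \<in> borel_measurable M"
      using borel_measurable_enn2real[OF measurable_emeasure_Pair[OF S]] unfolding measure_def by (rule measurable_cong[THEN iffD1, rotated]) (simp only: sect)
    have "emeasure (distr M borel (\<lambda>w. Phi (t + s) 0 w x)) A = ennreal (\<integral>w. ?g w \<partial>M)"
      using markov_indicator(2)[OF A ts, of x] by (simp add: emeasure_distr emeasure_eq_measure)
    also have "\<dots> = (\<integral>\<^sup>+w. ennreal (?g w) \<partial>M)"
      using gm by (intro nn_integral_eq_integral[symmetric] integrable_const_bound[where B = 1]) auto
    also have "\<dots> = (\<integral>\<^sup>+w. emeasure M (Pair w -` ((\<lambda>(w, w'). Phi s 0 w' (Phi t 0 w x)) -` A \<inter> space (M \<Otimes>\<^sub>M M))) \<partial>M)"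
      by (intro nn_integral_cong) (simp only: sect emeasure_eq_measure)
    also have "\<dots> = emeasure (M \<Otimes>\<^sub>M M) ((\<lambda>(w, w'). Phi s 0 w' (Phi t 0 w x)) -` A \<inter> space (M \<Otimes>\<^sub>M M))"
      using S by (rule emeasure_pair_measure_alt[symmetric])
    finally show "emeasure (distr M borel (\<lambda>w. Phi (t + s) 0 w x)) A
        = emeasure (distr (M \<Otimes>\<^sub>M M) borel (\<lambda>(w, w'). Phi s 0 w' (Phi t 0 w x))) A"
      by (simp add: emeasure_distr)
  qed simp
  then have "(\<integral>\<^sup>+w. G (Phi (t + s) 0 w x) \<partial>M) = (\<integral>\<^sup>+v. G (case v of (w, w') \<Rightarrow> Phi s 0 w' (Phi t 0 w x)) \<partial>(M \<Otimes>\<^sub>M M))"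
    using nn_integral_distr[OF m(1), of G] nn_integral_distr[OF m2, of G] G by simp
  also have "\<dots> = (\<integral>\<^sup>+w. \<integral>\<^sup>+w'. G (Phi s 0 w' (Phi t 0 w x)) \<partial>M \<partial>M)"
    by (subst nn_integral_fst[symmetric]) (use m2 in \<open>auto simp: split_beta\<close>)
  finally show ?thesis .
qed

text \<open>The constant in \<open>ms_exp_stable\<close> may be negative; \<open>max K 0\<close>
  replaces it.\<close>

lemma stability_bounds:
  obtains c K where "c > 0" "K \<ge> 0"
    "\<And>t x. 0 \<le> t \<Longrightarrow> (\<integral>\<^sup>+w. ennreal ((norm (Phi t 0 w x))\<^sup>2) \<partial>M) \<le> ennreal (K * exp (- c * t) * (norm x)\<^sup>2)"
proof -
  obtain c K where c: "c > 0" and K: "\<And>t x. 0 \<le> t \<Longrightarrow>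
      (\<integral>\<^sup>+w. ennreal ((norm (Phi t 0 w x))\<^sup>2) \<partial>M) \<le> ennreal (K * exp (- c * t) * (norm x)\<^sup>2)"
    using stable unfolding ms_exp_stable_def by blast
  have "ennreal (K * exp (- c * t) * (norm x)\<^sup>2) \<le> ennreal (max K 0 * exp (- c * t) * (norm x)\<^sup>2)" for t and x :: 'x
    by (intro ennreal_leI mult_right_mono) auto
  from order_trans[OF K this] show thesis by (intro that[of c "max K 0"] c) auto
qed

text \<open>Exponential decay is integrable over positive times, so every trajectory is square
  integrable over time and sample. Both the reachability and the observation map rest on
  this.\<close>

lemma nn_integral_Phi_square_finite:
  "(\<integral>\<^sup>+z. ennreal ((norm (Phi (fst z) 0 (snd z) x))\<^sup>2) \<partial>(pos_time \<Otimes>\<^sub>M M)) < \<infinity>"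
proof -
  obtain c K where cK: "c > 0" "K \<ge> 0" "\<And>t x. 0 \<le> t \<Longrightarrow> (\<integral>\<^sup>+w. ennreal ((norm (Phi t 0 w x))\<^sup>2) \<partial>M) \<le> ennreal (K * exp (- c * t) * (norm x)\<^sup>2)"
    using stability_bounds by blast
  have [measurable]: "(\<lambda>z. Phi (fst z) 0 (snd z) x) \<in> borel_measurable (pos_time \<Otimes>\<^sub>M M)"
    using measurable_Phi_fst[of x] by (simp add: split_beta')
  have "(\<integral>\<^sup>+z. ennreal ((norm (Phi (fst z) 0 (snd z) x))\<^sup>2) \<partial>(pos_time \<Otimes>\<^sub>M M))
     = (\<integral>\<^sup>+t. \<integral>\<^sup>+w. ennreal ((norm (Phi t 0 w x))\<^sup>2) \<partial>M \<partial>pos_time)"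
    by (subst nn_integral_fst[symmetric]) auto
  also have "\<dots> \<le> (\<integral>\<^sup>+t. ennreal (K * (norm x)\<^sup>2) * ennreal (exp (- c * t)) \<partial>pos_time)"
    using cK(2) by (intro nn_integral_mono order_trans[OF cK(3)]) (auto simp: mult_ac simp flip: ennreal_mult)
  also have "\<dots> = ennreal (K * (norm x)\<^sup>2) * (\<integral>\<^sup>+t. ennreal (exp (- c * t)) \<partial>pos_time)"
    unfolding pos_time_def by (intro nn_integral_cmult measurable_restrict_space1) measurable
  also have "(\<integral>\<^sup>+t. ennreal (exp (- c * t)) \<partial>pos_time) \<le> (\<integral>\<^sup>+t. ennreal (exp (- c * t)) * indicator {0..} t \<partial>lborel)"
    unfolding nn_integral_pos_time by (intro nn_integral_mono) (auto simp: indicator_def)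
  also have "(\<integral>\<^sup>+t. ennreal (exp (- c * t)) * indicator {0..} t \<partial>lborel) = ennreal (0 - (- exp (- c * 0) / c))"
  proof (rule nn_integral_FTC_atLeast)
    show "((\<lambda>t. - exp (- c * t) / c) has_real_derivative exp (- c * t)) (at t)" for t
      using cK(1) by (auto intro!: derivative_eq_intros)
    have "((\<lambda>t. exp (- c * t)) \<longlongrightarrow> 0) at_top"
      using cK(1) by real_asymp
    from tendsto_divide[OF tendsto_minus[OF this] tendsto_const[of c]]
    show "((\<lambda>t. - exp (- c * t) / c) \<longlongrightarrow> 0) at_top" using cK(1) by simp
  qed auto
  finally show ?thesis by (auto simp: ennreal_mult_less_top order.strict_trans1 mult_left_mono)
qed

end

section \<open>Independent pairs of flows\<close>

locale stable_flow_pair =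
  X: stable_flow M F Phi + Y: stable_flow M F Phi'
  for M :: "'a measure" and F :: "real \<Rightarrow> 'a measure"
    and Phi :: "real \<Rightarrow> real \<Rightarrow> 'a \<Rightarrow> 'x::{real_inner,banach,second_countable_topology} \<Rightarrow> 'x"
    and Phi' :: "real \<Rightarrow> real \<Rightarrow> 'a \<Rightarrow> 'y::{real_inner,banach,second_countable_topology} \<Rightarrow> 'y" +
  assumes indep: "flows_indep M Phi Phi'"
begin

text \<open>Evaluation at one index \<open>(t, s, x)\<close> is a coordinate of the whole flow, so
  its events lie in the sigma-algebras that \<open>flows_indep\<close> declares independent.\<close>

lemma distr_pair:
  assumes ts: "0 \<le> s" "s \<le> t"
  shows "distr M (borel \<Otimes>\<^sub>M borel) (\<lambda>w. (Phi t s w x, Phi' t s w y))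
    = distr M borel (\<lambda>w. Phi t s w x) \<Otimes>\<^sub>M distr M borel (\<lambda>w. Phi' t s w y)"
proof -
  have preimage: "(\<lambda>w. \<Psi> t s w a) -` A \<inter> space M \<in> sets (vimage_algebra (space M)
       (\<lambda>w. restrict (\<lambda>(t, s, x). \<Psi> t s w x) flow_index) (Pi\<^sub>M flow_index (\<lambda>_. borel)))"
    if A: "A \<in> sets borel" for \<Psi> :: "real \<Rightarrow> real \<Rightarrow> 'a \<Rightarrow> 'z::topological_space \<Rightarrow> 'z" and a A
  proof -
    let ?r = "\<lambda>w. restrict (\<lambda>(t, s, x). \<Psi> t s w x) flow_index"
    let ?P = "Pi\<^sub>M flow_index (\<lambda>_::real \<times> real \<times> 'z. borel :: 'z measure)"
    have i: "(t, s, a) \<in> flow_index" using ts by (simp add: flow_index_def)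
    have "(\<lambda>\<phi>. \<phi> (t, s, a)) -` A \<inter> space ?P \<in> sets ?P"
      using measurable_sets[OF measurable_component_singleton[OF i] A] .
    then have "?r -` ((\<lambda>\<phi>. \<phi> (t, s, a)) -` A \<inter> space ?P) \<inter> space M
        \<in> sets (vimage_algebra (space M) ?r ?P)"
      by (rule in_vimage_algebra)
    moreover have "?r -` ((\<lambda>\<phi>. \<phi> (t, s, a)) -` A \<inter> space ?P) \<inter> space M = (\<lambda>w. \<Psi> t s w a) -` A \<inter> space M"
      using i by (auto simp: space_PiM)
    ultimately show ?thesis by simp
  qed
  note mX [measurable] = X.measurable_Phi[OF ts, of x] and mY [measurable] = Y.measurable_Phi[OF ts, of y]
  interpret DX: prob_space "distr M borel (\<lambda>w. Phi t s w x)" by (rule X.prob_space_distr) measurable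
  interpret DY: prob_space "distr M borel (\<lambda>w. Phi' t s w y)" by (rule X.prob_space_distr) measurable
  show ?thesis
  proof (rule sym, rule pair_measure_eqI)
    show "sigma_finite_measure (distr M borel (\<lambda>w. Phi t s w x))" "sigma_finite_measure (distr M borel (\<lambda>w. Phi' t s w y))" ..
  next
    fix A B assume "A \<in> sets (distr M borel (\<lambda>w. Phi t s w x))" "B \<in> sets (distr M borel (\<lambda>w. Phi' t s w y))"
    then have [measurable]: "A \<in> sets borel" "B \<in> sets borel" by auto
    let ?A = "(\<lambda>w. Phi t s w x) -` A \<inter> space M" and ?B = "(\<lambda>w. Phi' t s w y) -` B \<inter> space M"
    have "X.prob (?A \<inter> ?B) = X.prob ?A * X.prob ?B"
      using indep unfolding flows_indep_def by (rule X.indep_setD) (intro preimage; measurable)+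
    moreover have "(\<lambda>w. (Phi t s w x, Phi' t s w y)) -` (A \<times> B) \<inter> space M = ?A \<inter> ?B" by auto
    ultimately show "emeasure (distr M borel (\<lambda>w. Phi t s w x)) A * emeasure (distr M borel (\<lambda>w. Phi' t s w y)) B
        = emeasure (distr M (borel \<Otimes>\<^sub>M borel) (\<lambda>w. (Phi t s w x, Phi' t s w y))) (A \<times> B)"
      by (simp add: emeasure_distr X.emeasure_eq_measure ennreal_mult)
  qed (auto intro: sets_pair_measure_cong)
qed

lemma nn_integral_indep:
  assumes ts: "0 \<le> s" "s \<le> t" and G [measurable]: "G \<in> borel_measurable (borel \<Otimes>\<^sub>M borel)"
  shows "(\<integral>\<^sup>+w. G (Phi t s w x, Phi' t s w y) \<partial>M) = (\<integral>\<^sup>+w1. \<integral>\<^sup>+w2. G (Phi t s w1 x, Phi' t s w2 y) \<partial>M \<partial>M)"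
proof -
  note mX [measurable] = X.measurable_Phi[OF ts, of x] and mY [measurable] = Y.measurable_Phi[OF ts, of y]
  interpret DY: prob_space "distr M borel (\<lambda>w. Phi' t s w y)" by (rule X.prob_space_distr) measurable
  have "(\<integral>\<^sup>+w. G (Phi t s w x, Phi' t s w y) \<partial>M)
     = (\<integral>\<^sup>+v. G v \<partial>distr M (borel \<Otimes>\<^sub>M borel) (\<lambda>w. (Phi t s w x, Phi' t s w y)))"
    by (subst nn_integral_distr) auto
  also have "\<dots> = (\<integral>\<^sup>+a. \<integral>\<^sup>+b. G (a, b) \<partial>distr M borel (\<lambda>w. Phi' t s w y) \<partial>distr M borel (\<lambda>w. Phi t s w x))"
    unfolding distr_pair[OF ts] by (subst DY.nn_integral_fst[symmetric]) (auto cong: measurable_cong_sets)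
  also have "\<dots> = (\<integral>\<^sup>+a. \<integral>\<^sup>+w2. G (a, Phi' t s w2 y) \<partial>M \<partial>distr M borel (\<lambda>w. Phi t s w x))"
    by (intro nn_integral_cong, subst nn_integral_distr) auto
  also have "\<dots> = (\<integral>\<^sup>+w1. \<integral>\<^sup>+w2. G (Phi t s w1 x, Phi' t s w2 y) \<partial>M \<partial>M)"
    by (subst nn_integral_distr) auto
  finally show ?thesis .
qed

text \<open>Independence gives each flow its own sample, homogeneity shifts the flows one at a time,
  and independence joins them again.\<close>

lemma nn_integral_pair_homogeneous:
  assumes ts: "0 \<le> t" "0 \<le> s" and G [measurable]: "G \<in> borel_measurable (borel \<Otimes>\<^sub>M borel)"
  shows "(\<integral>\<^sup>+w. G (Phi (s + t) s w x, Phi' (s + t) s w y) \<partial>M) = (\<integral>\<^sup>+w. G (Phi t 0 w x, Phi' t 0 w y) \<partial>M)"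
proof -
  have [measurable]: "(\<lambda>w. Phi' t 0 w y) \<in> borel_measurable M" using ts by (intro Y.measurable_Phi) auto
  have "(\<integral>\<^sup>+w. G (Phi (s + t) s w x, Phi' (s + t) s w y) \<partial>M)
     = (\<integral>\<^sup>+w1. \<integral>\<^sup>+w2. G (Phi (s + t) s w1 x, Phi' (s + t) s w2 y) \<partial>M \<partial>M)"
    using ts by (intro nn_integral_indep) auto
  also have "\<dots> = (\<integral>\<^sup>+w1. \<integral>\<^sup>+w2. G (Phi (s + t) s w1 x, Phi' t 0 w2 y) \<partial>M \<partial>M)"
    by (intro nn_integral_cong Y.nn_integral_homogeneous ts) measurable
  also have "\<dots> = (\<integral>\<^sup>+w1. \<integral>\<^sup>+w2. G (Phi t 0 w1 x, Phi' t 0 w2 y) \<partial>M \<partial>M)"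
    by (rule X.nn_integral_homogeneous[OF ts]) measurable
  also have "\<dots> = (\<integral>\<^sup>+w. G (Phi t 0 w x, Phi' t 0 w y) \<partial>M)"
    using ts by (intro nn_integral_indep[symmetric]) auto
  finally show ?thesis .
qed

text \<open>After decoupling, each flow restarts with its own fresh sample, which makes four
  samples. Recoupling the two first stages and the two second stages leaves \<open>w'\<close> and
  \<open>w\<close>, each shared by both flows, as in the kernel of the Hankel difference.\<close>

lemma nn_integral_pair_semigroup:
  assumes ts: "0 \<le> t" "0 \<le> s" and G [measurable]: "G \<in> borel_measurable (borel \<Otimes>\<^sub>M borel)"
  shows "(\<integral>\<^sup>+w. G (Phi (s + t) 0 w x, Phi' (s + t) 0 w y) \<partial>M)
    = (\<integral>\<^sup>+w'. \<integral>\<^sup>+w. G (Phi t 0 w (Phi s 0 w' x), Phi' t 0 w (Phi' s 0 w' y)) \<partial>M \<partial>M)"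
proof -
  interpret P: pair_prob_space M M ..
  have [measurable]: "(\<lambda>w. Phi s 0 w x) \<in> borel_measurable M" "(\<lambda>w. Phi' s 0 w y) \<in> borel_measurable M"
    "(\<lambda>w. Phi' (s + t) 0 w y) \<in> borel_measurable M"
    using ts by (auto intro!: X.measurable_Phi Y.measurable_Phi)
  note [measurable (raw)] = X.measurable_Phi_compose[OF order_refl ts(1)] Y.measurable_Phi_compose[OF order_refl ts(1)]
  have "(\<integral>\<^sup>+w. G (Phi (s + t) 0 w x, Phi' (s + t) 0 w y) \<partial>M)
     = (\<integral>\<^sup>+w1. \<integral>\<^sup>+w2. G (Phi (s + t) 0 w1 x, Phi' (s + t) 0 w2 y) \<partial>M \<partial>M)"
    using ts by (intro nn_integral_indep) auto
  also have "\<dots> = (\<integral>\<^sup>+w1'. \<integral>\<^sup>+w1. \<integral>\<^sup>+w2. G (Phi t 0 w1 (Phi s 0 w1' x), Phi' (s + t) 0 w2 y) \<partial>M \<partial>M \<partial>M)"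
    by (rule X.nn_integral_semigroup[OF ts(2,1)]) measurable
  also have "\<dots> = (\<integral>\<^sup>+w1'. \<integral>\<^sup>+w1. \<integral>\<^sup>+w2'. \<integral>\<^sup>+w2. G (Phi t 0 w1 (Phi s 0 w1' x), Phi' t 0 w2 (Phi' s 0 w2' y)) \<partial>M \<partial>M \<partial>M \<partial>M)"
    by (intro nn_integral_cong Y.nn_integral_semigroup[OF ts(2,1)]) measurable
  \<comment> \<open>The exchange brings the two first-stage samples next to each other, so that
    independence applies to them as a pair.\<close>
  also have "\<dots> = (\<integral>\<^sup>+w1'. \<integral>\<^sup>+w2'. \<integral>\<^sup>+w1. \<integral>\<^sup>+w2. G (Phi t 0 w1 (Phi s 0 w1' x), Phi' t 0 w2 (Phi' s 0 w2' y)) \<partial>M \<partial>M \<partial>M \<partial>M)"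
    by (intro nn_integral_cong P.Fubini') measurable
  also have "\<dots> = (\<integral>\<^sup>+w'. \<integral>\<^sup>+w1. \<integral>\<^sup>+w2. G (Phi t 0 w1 (Phi s 0 w' x), Phi' t 0 w2 (Phi' s 0 w' y)) \<partial>M \<partial>M \<partial>M)"
    using ts(2) by (intro nn_integral_indep[symmetric, where G = "\<lambda>v. \<integral>\<^sup>+w1. \<integral>\<^sup>+w2. G (Phi t 0 w1 (fst v), Phi' t 0 w2 (snd v)) \<partial>M \<partial>M", simplified]) measurable
  also have "\<dots> = (\<integral>\<^sup>+w'. \<integral>\<^sup>+w. G (Phi t 0 w (Phi s 0 w' x), Phi' t 0 w (Phi' s 0 w' y)) \<partial>M \<partial>M)"
    using ts(1) by (intro nn_integral_cong nn_integral_indep[symmetric]) auto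
  finally show ?thesis .
qed

end

section \<open>Averaging over antidiagonals\<close>

text \<open>The push-forward of Lebesgue measure on a square under \<open>(t, s) \<mapsto> t + s\<close> is a tent.\<close>

lemma nn_integral_square_ge_tent:
  fixes z :: "real \<Rightarrow> ennreal"
  assumes [measurable]: "z \<in> borel_measurable borel"
  shows "(\<integral>\<^sup>+r. z r * ennreal (\<epsilon> - \<bar>r - 2 * b - \<epsilon>\<bar>) \<partial>lborel)
    \<le> (\<integral>\<^sup>+t. \<integral>\<^sup>+s. indicator {b<..b+\<epsilon>} t * indicator {b<..b+\<epsilon>} s * z (t + s) \<partial>lborel \<partial>lborel)"
proof -
  let ?J = "{b<..b+\<epsilon>}"
  have overlap: "ennreal (\<epsilon> - \<bar>r - 2 * b - \<epsilon>\<bar>) \<le> (\<integral>\<^sup>+t. indicator ?J t * indicator ?J (r - t) \<partial>lborel)" for r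
  proof -
    \<comment> \<open>Up to end points, the interval from \<open>l\<close> to \<open>u\<close> is
      the set of \<open>t\<close> with both \<open>t\<close> and \<open>r - t\<close> in
      \<open>?J\<close>.\<close>
    define l u where "l = max b (r - b - \<epsilon>)" and "u = min (b + \<epsilon>) (r - b)"
    have "ennreal (\<epsilon> - \<bar>r - 2 * b - \<epsilon>\<bar>) \<le> emeasure lborel {l<..<u}"
    proof (cases "l \<le> u")
      case True
      then show ?thesis by (auto simp: l_def u_def intro!: ennreal_leI)
    next
      case False
      then have "\<epsilon> - \<bar>r - 2 * b - \<epsilon>\<bar> \<le> 0" by (auto simp: l_def u_def)
      then show ?thesis by (simp add: ennreal_neg)
    qed
    also have "\<dots> = (\<integral>\<^sup>+t. indicator {l<..<u} t \<partial>lborel)" by simp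
    also have "\<dots> \<le> (\<integral>\<^sup>+t. indicator ?J t * indicator ?J (r - t) \<partial>lborel)"
      by (intro nn_integral_mono) (auto simp: indicator_def l_def u_def)
    finally show ?thesis .
  qed
  have "(\<integral>\<^sup>+r. z r * ennreal (\<epsilon> - \<bar>r - 2 * b - \<epsilon>\<bar>) \<partial>lborel)
      \<le> (\<integral>\<^sup>+r. z r * (\<integral>\<^sup>+t. indicator ?J t * indicator ?J (r - t) \<partial>lborel) \<partial>lborel)"
    by (intro nn_integral_mono mult_left_mono overlap) auto
  also have "\<dots> = (\<integral>\<^sup>+r. \<integral>\<^sup>+t. z r * (indicator ?J t * indicator ?J (r - t)) \<partial>lborel \<partial>lborel)"
    by (intro nn_integral_cong nn_integral_cmult[symmetric]) measurable
  also have "\<dots> = (\<integral>\<^sup>+t. \<integral>\<^sup>+r. z r * (indicator ?J t * indicator ?J (r - t)) \<partial>lborel \<partial>lborel)"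
    by (rule lborel_pair.Fubini'[symmetric]) measurable
  also have "\<dots> = (\<integral>\<^sup>+t. \<integral>\<^sup>+s. indicator ?J t * indicator ?J s * z (t + s) \<partial>lborel \<partial>lborel)"
  proof (rule nn_integral_cong)
    fix t :: real
    have "(\<integral>\<^sup>+r. z r * (indicator ?J t * indicator ?J (r - t)) \<partial>lborel)
        = \<bar>1::real\<bar> * (\<integral>\<^sup>+s. z (t + 1 * s) * (indicator ?J t * indicator ?J (t + 1 * s - t)) \<partial>lborel)"
      by (rule nn_integral_real_affine) auto
    then show "(\<integral>\<^sup>+r. z r * (indicator ?J t * indicator ?J (r - t)) \<partial>lborel)
        = (\<integral>\<^sup>+s. indicator ?J t * indicator ?J s * z (t + s) \<partial>lborel)"
      by (simp add: mult_ac)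
  qed
  finally show ?thesis .
qed

text \<open>Two families of squares along the diagonal, shifted against each other by \<open>\<epsilon>/2\<close>, have tents
  that sum to the constant \<open>\<epsilon>\<close>.\<close>

lemma sum_tents_ge:
  fixes \<epsilon> r :: real and n :: nat
  assumes e: "\<epsilon> > 0" and r: "\<epsilon> \<le> r" "r < 2 * real n * \<epsilon>"
  shows "ennreal \<epsilon> \<le> (\<Sum>q<n. ennreal (\<epsilon> - \<bar>r - 2 * (real q * \<epsilon>) - \<epsilon>\<bar>)) + (\<Sum>q<n. ennreal (\<epsilon> - \<bar>r - 2 * (\<epsilon>/2 + real q * \<epsilon>) - \<epsilon>\<bar>))"
proof -
  \<comment> \<open>The peaks of the first family sit at odd multiples of \<epsilon>, those of the
    second at positive even multiples. On the interval from k\<epsilon> to (k+1)\<epsilon> the two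
    neighbouring tents sum to \<epsilon>; below \<epsilon> there is only one tent, hence the lower
    bound on \<open>r\<close>.\<close>
  define k where "k = nat \<lfloor>r / \<epsilon>\<rfloor>"
  have r0: "0 \<le> r / \<epsilon>" using e r by simp
  have "real k \<le> r / \<epsilon>" "r / \<epsilon> < real k + 1" unfolding k_def using r0 by linarith+
  then have kr: "k * \<epsilon> \<le> r" "r < (k + 1) * \<epsilon>" using e by (auto simp: field_simps)
  have "1 \<le> k" unfolding k_def using e r by (simp add: le_nat_floor)
  have "k * \<epsilon> < (2 * n) * \<epsilon>" using kr r by simp
  then have "real k < real (2 * n)" using e by (simp del: of_nat_mult)
  then have k2: "k < 2 * n" by linarith
  have split: "ennreal \<epsilon> \<le> ennreal (\<epsilon> - \<bar>r - k * \<epsilon>\<bar>) + ennreal (\<epsilon> - \<bar>r - (k + 1) * \<epsilon>\<bar>)"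
    using kr by (subst ennreal_plus[symmetric]) (auto simp: algebra_simps abs_if intro!: ennreal_leI)
  let ?a = "\<lambda>q::nat. ennreal (\<epsilon> - \<bar>r - 2 * (q * \<epsilon>) - \<epsilon>\<bar>)" and ?b = "\<lambda>q::nat. ennreal (\<epsilon> - \<bar>r - 2 * (\<epsilon>/2 + q * \<epsilon>) - \<epsilon>\<bar>)"
  have le: "?a q \<le> (\<Sum>q<n. ?a q)" "?b q \<le> (\<Sum>q<n. ?b q)" if "q < n" for q
    using that by (intro member_le_sum; simp)+
  show ?thesis
  proof (cases "odd k")
    case True
    then obtain q where q: "k = 2 * q + 1" by (auto elim: oddE)
    then have "q < n" using k2 by simp
    have "ennreal (\<epsilon> - \<bar>r - k * \<epsilon>\<bar>) = ?a q" "ennreal (\<epsilon> - \<bar>r - (k + 1) * \<epsilon>\<bar>) = ?b q"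
      unfolding q by (auto simp: algebra_simps)
    then have "ennreal \<epsilon> \<le> ?a q + ?b q" using split by simp
    also have "\<dots> \<le> (\<Sum>q<n. ?a q) + (\<Sum>q<n. ?b q)" by (intro add_mono le \<open>q < n\<close>)
    finally show ?thesis .
  next
    case False
    then obtain p where p: "k = 2 * p" by (auto elim: evenE)
    then have q: "k = 2 * (p - 1) + 2" using \<open>1 \<le> k\<close> by simp
    \<comment> \<open>The tent at (2q+2)\<epsilon> belongs to square \<open>q\<close> of the second
      family, hence the shift by one; it exists since k is at least 1.\<close>
    define q where "q = p - 1"
    note q = q[folded q_def]
    then have qn: "q < n" "Suc q < n" using k2 by simp_all
    have "ennreal (\<epsilon> - \<bar>r - k * \<epsilon>\<bar>) = ?b q" "ennreal (\<epsilon> - \<bar>r - (k + 1) * \<epsilon>\<bar>) = ?a (Suc q)"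
      unfolding q by (auto simp: algebra_simps)
    then have "ennreal \<epsilon> \<le> ?a (Suc q) + ?b q" using split by (simp add: add.commute)
    also have "\<dots> \<le> (\<Sum>q<n. ?a q) + (\<Sum>q<n. ?b q)" by (intro add_mono le qn)
    finally show ?thesis .
  qed
qed

text \<open>The offsets \<open>a = 0\<close> and \<open>a = \<epsilon>/2\<close> each contribute at
  most \<epsilon> times \<open>N\<close>, whereas their tents together weigh \<open>z\<close> by at
  least \<epsilon>. Dividing by \<epsilon> gives the bound on a bounded window, and the windows are
  then exhausted.\<close>

lemma nn_integral_le_of_diagonal_blocks:
  fixes z :: "real \<Rightarrow> ennreal"
  assumes [measurable]: "z \<in> borel_measurable borel"
    and blocks: "\<And>(\<epsilon>::real) (a::real) (n::nat). \<epsilon> > 0 \<Longrightarrow> a \<ge> 0 \<Longrightarrow>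
      (\<Sum>q<n. \<integral>\<^sup>+t. \<integral>\<^sup>+s. indicator {a + real q * \<epsilon><..a + real q * \<epsilon> + \<epsilon>} t * indicator {a + real q * \<epsilon><..a + real q * \<epsilon> + \<epsilon>} s * z (t + s) \<partial>lborel \<partial>lborel)
        \<le> ennreal \<epsilon> * N"
  shows "(\<integral>\<^sup>+r. indicator {0<..} r * z r \<partial>lborel) \<le> 2 * N"
proof -
  have part: "(\<integral>\<^sup>+r. indicator {\<epsilon>..<2 * real n * \<epsilon>} r * z r \<partial>lborel) \<le> 2 * N" if e: "\<epsilon> > 0" for \<epsilon> :: real and n :: nat
  proof -
    let ?t = "\<lambda>a q r. z r * ennreal (\<epsilon> - \<bar>r - 2 * (a + real q * \<epsilon>) - \<epsilon>\<bar>)"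
    have tent: "(\<Sum>q<n. \<integral>\<^sup>+r. ?t a q r \<partial>lborel) \<le> ennreal \<epsilon> * N" if "a \<ge> 0" for a :: real
      using blocks[OF e that, of n] by (rule order_trans[rotated]) (intro sum_mono nn_integral_square_ge_tent assms)
    have "ennreal \<epsilon> * (\<integral>\<^sup>+r. indicator {\<epsilon>..<2 * real n * \<epsilon>} r * z r \<partial>lborel)
        = (\<integral>\<^sup>+r. ennreal \<epsilon> * (indicator {\<epsilon>..<2 * real n * \<epsilon>} r * z r) \<partial>lborel)"
      by (intro nn_integral_cmult[symmetric]) measurable
    also have "\<dots> \<le> (\<integral>\<^sup>+r. (\<Sum>q<n. ?t 0 q r) + (\<Sum>q<n. ?t (\<epsilon>/2) q r) \<partial>lborel)"
    proof (rule nn_integral_mono)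
      fix r
      have "z r * ennreal \<epsilon> \<le> z r * ((\<Sum>q<n. ennreal (\<epsilon> - \<bar>r - 2 * (real q * \<epsilon>) - \<epsilon>\<bar>)) + (\<Sum>q<n. ennreal (\<epsilon> - \<bar>r - 2 * (\<epsilon>/2 + real q * \<epsilon>) - \<epsilon>\<bar>)))"
        if "\<epsilon> \<le> r" "r < 2 * real n * \<epsilon>"
        by (intro mult_left_mono sum_tents_ge e that) auto
      then show "ennreal \<epsilon> * (indicator {\<epsilon>..<2 * real n * \<epsilon>} r * z r) \<le> (\<Sum>q<n. ?t 0 q r) + (\<Sum>q<n. ?t (\<epsilon>/2) q r)"
        by (auto simp: indicator_def distrib_left sum_distrib_left mult.commute)
    qed
    also have "\<dots> = (\<Sum>q<n. \<integral>\<^sup>+r. ?t 0 q r \<partial>lborel) + (\<Sum>q<n. \<integral>\<^sup>+r. ?t (\<epsilon>/2) q r \<partial>lborel)"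
      by (subst nn_integral_add) (auto simp: nn_integral_sum)
    also have "\<dots> \<le> ennreal \<epsilon> * N + ennreal \<epsilon> * N"
      using e by (intro add_mono tent) auto
    also have "\<dots> = ennreal \<epsilon> * (2 * N)" by (simp add: distrib_left[symmetric] mult_2)
    finally show ?thesis using e by (simp add: ennreal_mult_le_mult_iff)
  qed
  \<comment> \<open>With \<epsilon> = 1/(m+1) and (m+1)^2 squares the window reaches from 1/(m+1) to
    2(m+1): it approaches 0 on the left while growing on the right.\<close>
  define I where "I m = {1 / real (Suc m)..<2 * real (Suc m * Suc m) * (1 / real (Suc m))}" for m
  have I_eq: "I m = {1 / real (Suc m)..<2 * real (Suc m)}" for m
    unfolding I_def of_nat_mult by (simp del: of_nat_Suc)
  have "incseq (\<lambda>m r. indicator (I m) r * z r)"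
  proof (intro incseq_SucI le_funI)
    fix m r
    have "I m \<subseteq> I (Suc m)" unfolding I_eq by (intro ivl_subset[THEN iffD2] disjI2 conjI) (auto simp: field_simps)
    then show "indicator (I m) r * z r \<le> indicator (I (Suc m)) r * z r"
      by (auto simp: indicator_def)
  qed
  moreover have "(SUP m. indicator (I m) r * z r) = indicator {0<..} r * z r" for r
  proof (cases "r > 0")
    case True
    obtain m where m: "1 / r < real m" "r < real m" using reals_Archimedean2[of "max (1/r) r"] by auto
    have "1 / real (Suc m) \<le> r"
      using m(1) True by (simp add: field_simps)
    then have "r \<in> I m" unfolding I_eq using m by auto
    then show ?thesis using True
      by (intro antisym SUP_least SUP_upper2[of m]) (auto simp: indicator_def)
  next
    case False
    have "r \<notin> I m" for m
    proof -
      have "0 < 1 / real (Suc m)" by simp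
      then have "r < 1 / real (Suc m)" using False by linarith
      then show ?thesis unfolding I_eq by simp
    qed
    then show ?thesis using False by simp
  qed
  ultimately have "(\<integral>\<^sup>+r. indicator {0<..} r * z r \<partial>lborel) = (SUP m. \<integral>\<^sup>+r. indicator (I m) r * z r \<partial>lborel)"
    by (subst nn_integral_monotone_convergence_SUP[symmetric]) (auto simp: I_def)
  also have "\<dots> \<le> 2 * N"
  proof (rule SUP_least)
    fix m
    show "(\<integral>\<^sup>+r. indicator (I m) r * z r \<partial>lborel) \<le> 2 * N"
      unfolding I_def by (rule part) simp
  qed
  finally show ?thesis .
qed

section \<open>Hankel operators\<close>

lemma L2I:
  assumes "f \<in> borel_measurable mu" "(\<integral>\<^sup>+z. ennreal ((norm (f z))\<^sup>2) \<partial>mu) < \<infinity>"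
  shows "f \<in> L2 mu"
  unfolding L2_def using assms by (auto intro!: integrableI_nonneg)

lemma L2_diff: "f \<in> L2 mu \<Longrightarrow> g \<in> L2 mu \<Longrightarrow> (\<lambda>z. f z - g z) \<in> L2 mu"
  using L2_add[OF _ L2_scale[of g mu "-1"], of f] by simp

lemma bounded_linear_input_op: "bounded_linear (input_op psi)"
  unfolding input_op_def
  by (intro bounded_linear_sum bounded_linear_compose[OF bounded_linear_scaleR_left bounded_linear_vec_nth])

lemma input_op_axis: "input_op psi (c *\<^sub>R axis i 1) = c *\<^sub>R psi i"
proof -
  have "input_op psi (c *\<^sub>R axis i 1) = (\<Sum>k\<in>UNIV. if k = i then c *\<^sub>R psi i else 0)"
    unfolding input_op_def by (intro sum.cong) (auto simp: axis_def)
  then show ?thesis by simp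
qed

lemma measurable_cart_lambda:
  fixes f :: "'b \<Rightarrow> 'n::finite \<Rightarrow> 'v::euclidean_space"
  assumes "\<And>i. (\<lambda>x. f x i) \<in> borel_measurable N"
  shows "(\<lambda>x. \<chi> i. f x i) \<in> borel_measurable N"
proof (rule borel_measurable_euclidean_space[THEN iffD2], intro ballI)
  fix b :: "'v^'n" assume "b \<in> Basis"
  then obtain i v where b: "b = axis i v" by (auto simp: Basis_vec_def)
  show "(\<lambda>x. (\<chi> i. f x i) \<bullet> b) \<in> borel_measurable N"
    unfolding b inner_axis using assms[of i] by simp
qed

context stable_flow
begin

lemma measurable_Phi_Omega:
  assumes "g \<in> borel_measurable (pos_time \<Otimes>\<^sub>M M)"
  shows "(\<lambda>z. Phi (fst z) 0 (snd z) (g z)) \<in> borel_measurable (pos_time \<Otimes>\<^sub>M M)"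
  using assms by (intro measurable_Phi_compose_pos) auto

text \<open>Expanding the input over the vectors \<open>psi i\<close>, each product is dominated by
  a sum of two squares, one integrable by the choice of \<open>f\<close> and one by
  stability.\<close>

lemma reach_integrable:
  assumes f: "f \<in> L2 (pos_time \<Otimes>\<^sub>M M)"
  shows "integrable (pos_time \<Otimes>\<^sub>M M) (\<lambda>z. Phi (fst z) 0 (snd z) (input_op psi (f z)))"
proof (rule Bochner_Integration.integrable_bound)
  have fm [measurable]: "f \<in> borel_measurable (pos_time \<Otimes>\<^sub>M M)" using f by (rule L2_measurable)
  have pm [measurable]: "(\<lambda>z. Phi (fst z) 0 (snd z) (psi i)) \<in> borel_measurable (pos_time \<Otimes>\<^sub>M M)" for i
    by (intro measurable_Phi_Omega) auto
  have "integrable (pos_time \<Otimes>\<^sub>M M) (\<lambda>z. (norm (Phi (fst z) 0 (snd z) (psi i)))\<^sup>2)" for i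
    using nn_integral_Phi_square_finite[of "psi i"] by (intro integrableI_nonneg) auto
  then show "integrable (pos_time \<Otimes>\<^sub>M M) (\<lambda>z. \<Sum>i\<in>UNIV. (norm (f z))\<^sup>2 + (norm (Phi (fst z) 0 (snd z) (psi i)))\<^sup>2)"
    using f unfolding L2_def by auto
  have "(\<lambda>z. input_op psi (f z)) \<in> borel_measurable (pos_time \<Otimes>\<^sub>M M)"
    using bounded_linear_input_op[of psi]
    by (intro borel_measurable_continuous_on[OF _ fm, of "input_op psi"] linear_continuous_on)
  then show "(\<lambda>z. Phi (fst z) 0 (snd z) (input_op psi (f z))) \<in> borel_measurable (pos_time \<Otimes>\<^sub>M M)"
    by (rule measurable_Phi_Omega)
  show "AE z in pos_time \<Otimes>\<^sub>M M. norm (Phi (fst z) 0 (snd z) (input_op psi (f z)))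
      \<le> norm (\<Sum>i\<in>UNIV. (norm (f z))\<^sup>2 + (norm (Phi (fst z) 0 (snd z) (psi i)))\<^sup>2)"
  proof (rule AE_I2)
    fix z assume "z \<in> space (pos_time \<Otimes>\<^sub>M M)"
    then have lin: "linear (Phi (fst z) 0 (snd z))"
      by (intro bounded_linear.linear linear_Phi) (auto simp: space_pair_measure)
    have "norm (Phi (fst z) 0 (snd z) (input_op psi (f z)))
       = norm (\<Sum>i\<in>UNIV. f z $ i *\<^sub>R Phi (fst z) 0 (snd z) (psi i))"
      unfolding input_op_def by (simp add: linear_sum[OF lin] linear_scale[OF lin])
    also have "\<dots> \<le> (\<Sum>i\<in>UNIV. norm (f z $ i *\<^sub>R Phi (fst z) 0 (snd z) (psi i)))" by (rule norm_sum)
    also have "\<dots> \<le> (\<Sum>i\<in>UNIV. (norm (f z))\<^sup>2 + (norm (Phi (fst z) 0 (snd z) (psi i)))\<^sup>2)"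
    proof (rule sum_mono)
      fix i
      have "norm (f z $ i *\<^sub>R Phi (fst z) 0 (snd z) (psi i)) \<le> norm (f z) * norm (Phi (fst z) 0 (snd z) (psi i))"
        using component_le_norm_cart[of "f z" i] by (simp add: mult_right_mono)
      also have "\<dots> \<le> (norm (f z))\<^sup>2 + (norm (Phi (fst z) 0 (snd z) (psi i)))\<^sup>2"
        using sum_squares_bound[of "norm (f z)" "norm (Phi (fst z) 0 (snd z) (psi i))"]
          zero_le_power2[of "norm (f z)"] zero_le_power2[of "norm (Phi (fst z) 0 (snd z) (psi i))"] by linarith
      finally show "norm (f z $ i *\<^sub>R Phi (fst z) 0 (snd z) (psi i)) \<le> (norm (f z))\<^sup>2 + (norm (Phi (fst z) 0 (snd z) (psi i)))\<^sup>2" .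
    qed
    finally show "norm (Phi (fst z) 0 (snd z) (input_op psi (f z)))
      \<le> norm (\<Sum>i\<in>UNIV. (norm (f z))\<^sup>2 + (norm (Phi (fst z) 0 (snd z) (psi i)))\<^sup>2)"
      by (simp add: sum_nonneg)
  qed
qed

text \<open>Fubini turns the iterated integral of the definition into one Bochner integral, for
  which linearity and exchange with bounded operators are available.\<close>

lemma reach_op_eq:
  assumes f: "f \<in> L2 (pos_time \<Otimes>\<^sub>M M)"
  shows "reach_op M Phi psi f = (\<integral>z. Phi (fst z) 0 (snd z) (input_op psi (f z)) \<partial>(pos_time \<Otimes>\<^sub>M M))"
proof -
  interpret T: sigma_finite_measure pos_time by (rule sigma_finite_pos_time)
  interpret P: pair_sigma_finite pos_time M ..
  have "reach_op M Phi psi f = (\<integral>w. \<integral>s. Phi s 0 w (input_op psi (f (s, w))) \<partial>pos_time \<partial>M)"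
    unfolding reach_op_def pos_time_def set_lebesgue_integral_def by (simp add: integral_restrict_space)
  also have "\<dots> = (\<integral>z. (case z of (s, w) \<Rightarrow> Phi s 0 w (input_op psi (f (s, w)))) \<partial>(pos_time \<Otimes>\<^sub>M M))"
    by (rule P.integral_snd) (use reach_integrable[OF f, of psi] in \<open>simp add: case_prod_unfold\<close>)
  finally show ?thesis by (simp add: case_prod_unfold)
qed

lemma reach_op_add:
  assumes f: "f \<in> L2 (pos_time \<Otimes>\<^sub>M M)" and g: "g \<in> L2 (pos_time \<Otimes>\<^sub>M M)"
  shows "reach_op M Phi psi (\<lambda>z. f z + g z) = reach_op M Phi psi f + reach_op M Phi psi g"
  unfolding reach_op_eq[OF f] reach_op_eq[OF g] reach_op_eq[OF L2_add[OF f g]]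
    Bochner_Integration.integral_add[OF reach_integrable[OF f] reach_integrable[OF g], symmetric]
  by (intro Bochner_Integration.integral_cong refl)
     (auto simp: space_pair_measure linear_add[OF bounded_linear.linear[OF linear_Phi]]
        linear_add[OF bounded_linear.linear[OF bounded_linear_input_op]])

lemma reach_op_scale:
  assumes f: "f \<in> L2 (pos_time \<Otimes>\<^sub>M M)"
  shows "reach_op M Phi psi (\<lambda>z. c *\<^sub>R f z) = c *\<^sub>R reach_op M Phi psi f"
  unfolding reach_op_eq[OF f] reach_op_eq[OF L2_scale[OF f]] integral_scaleR_right[symmetric]
  by (intro Bochner_Integration.integral_cong refl)
     (auto simp: space_pair_measure linear_scale[OF bounded_linear.linear[OF linear_Phi]]
        linear_scale[OF bounded_linear.linear[OF bounded_linear_input_op]])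

lemma obs_op_L2:
  fixes C :: "'x \<Rightarrow> real^'m::finite"
  assumes C: "bounded_linear C"
  shows "obs_op Phi C x \<in> L2 (pos_time \<Otimes>\<^sub>M M)"
proof (rule L2I)
  note [measurable] = measurable_Phi_Omega[of "\<lambda>_. x"]
  show "obs_op Phi C x \<in> borel_measurable (pos_time \<Otimes>\<^sub>M M)"
    unfolding obs_op_def case_prod_unfold
    by (intro borel_measurable_continuous_on[OF linear_continuous_on[OF C]] measurable_Phi_Omega) auto
  obtain K where K: "K > 0" "\<And>x. norm (C x) \<le> norm x * K" using bounded_linear.pos_bounded[OF C] by auto
  have "(\<integral>\<^sup>+z. ennreal ((norm (obs_op Phi C x z))\<^sup>2) \<partial>(pos_time \<Otimes>\<^sub>M M))
     \<le> (\<integral>\<^sup>+z. ennreal (K\<^sup>2) * ennreal ((norm (Phi (fst z) 0 (snd z) x))\<^sup>2) \<partial>(pos_time \<Otimes>\<^sub>M M))"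
  proof (rule nn_integral_mono)
    fix z :: "real \<times> 'a"
    have "(norm (obs_op Phi C x z))\<^sup>2 \<le> (norm (Phi (fst z) 0 (snd z) x) * K)\<^sup>2"
      unfolding obs_op_def case_prod_unfold by (intro power_mono K) auto
    then show "ennreal ((norm (obs_op Phi C x z))\<^sup>2) \<le> ennreal (K\<^sup>2) * ennreal ((norm (Phi (fst z) 0 (snd z) x))\<^sup>2)"
      by (simp add: ennreal_mult[symmetric] power_mult_distrib mult.commute ennreal_leI)
  qed
  also have "\<dots> = ennreal (K\<^sup>2) * (\<integral>\<^sup>+z. ennreal ((norm (Phi (fst z) 0 (snd z) x))\<^sup>2) \<partial>(pos_time \<Otimes>\<^sub>M M))"
    by (intro nn_integral_cmult) measurable
  also have "\<dots> < \<infinity>" using nn_integral_Phi_square_finite[of x] by (simp add: ennreal_mult_less_top)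
  finally show "(\<integral>\<^sup>+z. ennreal ((norm (obs_op Phi C x z))\<^sup>2) \<partial>(pos_time \<Otimes>\<^sub>M M)) < \<infinity>" .
qed

lemma hankel_L2:
  fixes C :: "'x \<Rightarrow> real^'m::finite"
  assumes C: "bounded_linear C"
  shows "hankel M Phi psi C f \<in> L2 (pos_time \<Otimes>\<^sub>M M)"
  unfolding hankel_def by (rule obs_op_L2[OF C])

lemma hankel_add:
  assumes C: "bounded_linear C" and fg: "f \<in> L2 (pos_time \<Otimes>\<^sub>M M)" "g \<in> L2 (pos_time \<Otimes>\<^sub>M M)"
    and z: "z \<in> space (pos_time \<Otimes>\<^sub>M M)"
  shows "hankel M Phi psi C (\<lambda>z. f z + g z) z = hankel M Phi psi C f z + hankel M Phi psi C g z"
  using z unfolding hankel_def obs_op_def reach_op_add[OF fg]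
  by (auto simp: space_pair_measure linear_add[OF bounded_linear.linear[OF linear_Phi]]
        linear_add[OF bounded_linear.linear[OF C]])

lemma hankel_scale:
  assumes C: "bounded_linear C" and f: "f \<in> L2 (pos_time \<Otimes>\<^sub>M M)"
    and z: "z \<in> space (pos_time \<Otimes>\<^sub>M M)"
  shows "hankel M Phi psi C (\<lambda>z. c *\<^sub>R f z) z = c *\<^sub>R hankel M Phi psi C f z"
  using z unfolding hankel_def obs_op_def reach_op_scale[OF f]
  by (auto simp: space_pair_measure linear_scale[OF bounded_linear.linear[OF linear_Phi]]
        linear_scale[OF bounded_linear.linear[OF C]])

text \<open>For a fixed output point the observation is a bounded linear functional of the state and
  moves inside the Bochner integral.\<close>

lemma hankel_kernel:
  assumes C: "bounded_linear C" and f: "f \<in> L2 (pos_time \<Otimes>\<^sub>M M)"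
    and z: "z \<in> space (pos_time \<Otimes>\<^sub>M M)"
  shows "integrable (pos_time \<Otimes>\<^sub>M M) (\<lambda>z'. C (Phi (fst z) 0 (snd z) (Phi (fst z') 0 (snd z') (input_op psi (f z')))))"
    and "hankel M Phi psi C f z
      = (\<integral>z'. C (Phi (fst z) 0 (snd z) (Phi (fst z') 0 (snd z') (input_op psi (f z')))) \<partial>(pos_time \<Otimes>\<^sub>M M))"
proof -
  have bl: "bounded_linear (\<lambda>x. C (Phi (fst z) 0 (snd z) x))"
    using z by (intro bounded_linear_compose[OF C] linear_Phi) (auto simp: space_pair_measure)
  show "integrable (pos_time \<Otimes>\<^sub>M M) (\<lambda>z'. C (Phi (fst z) 0 (snd z) (Phi (fst z') 0 (snd z') (input_op psi (f z')))))"
    by (rule integrable_bounded_linear[OF bl reach_integrable[OF f]])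
  show "hankel M Phi psi C f z
      = (\<integral>z'. C (Phi (fst z) 0 (snd z) (Phi (fst z') 0 (snd z') (input_op psi (f z')))) \<partial>(pos_time \<Otimes>\<^sub>M M))"
    unfolding hankel_def obs_op_def case_prod_unfold reach_op_eq[OF f]
    by (rule integral_bounded_linear[OF bl reach_integrable[OF f], symmetric])
qed

end

section \<open>The kernel of the error system\<close>

locale system_pair = stable_flow_pair M F Phi Phi'
  for M :: "'a measure" and F :: "real \<Rightarrow> 'a measure"
    and Phi :: "real \<Rightarrow> real \<Rightarrow> 'a \<Rightarrow> 'x::{real_inner,banach,second_countable_topology} \<Rightarrow> 'x"
    and Phi' :: "real \<Rightarrow> real \<Rightarrow> 'a \<Rightarrow> 'y::{real_inner,banach,second_countable_topology} \<Rightarrow> 'y" +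
  fixes psi :: "'n::finite \<Rightarrow> 'x" and C :: "'x \<Rightarrow> real^'m::finite"
    and psi' :: "'n \<Rightarrow> 'y" and C' :: "'y \<Rightarrow> real^'m"
  assumes C: "bounded_linear C" and C': "bounded_linear C'"
begin

abbreviation \<Omega> :: "(real \<times> 'a) measure" where "\<Omega> \<equiv> pos_time \<Otimes>\<^sub>M M"

definition hankel_diff :: "(real \<times> 'a \<Rightarrow> real^'n) \<Rightarrow> real \<times> 'a \<Rightarrow> real^'m" where
  "hankel_diff f z = hankel M Phi psi C f z - hankel M Phi' psi' C' f z"

text \<open>The first component of \<open>v\<close> is the observation time and sample, the second
  those of the input. Entry \<open>i\<close> is the error response to input \<open>i\<close>, so the
  norm of this nested vector is the Hilbert-Schmidt norm.\<close>

definition kernel :: "(real \<times> 'a) \<times> (real \<times> 'a) \<Rightarrow> real^'m^'n" where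
  "kernel v = (\<chi> i. C (Phi (fst (fst v)) 0 (snd (fst v)) (Phi (fst (snd v)) 0 (snd (snd v)) (psi i)))
     - C' (Phi' (fst (fst v)) 0 (snd (fst v)) (Phi' (fst (snd v)) 0 (snd (snd v)) (psi' i))))"

text \<open>The square of the function z of the overview, kept in \<open>ennreal\<close> until it is
  known to be finite.\<close>

definition impulse_energy :: "real \<Rightarrow> ennreal" where
  "impulse_energy t = (\<Sum>i\<in>UNIV. \<integral>\<^sup>+w. ennreal ((norm (C (Phi t 0 w (psi i)) - C' (Phi' t 0 w (psi' i))))\<^sup>2) \<partial>M)"

text \<open>The function z of the overview. Its extension by zero makes it Borel on the whole line,
  whereas measurability of \<open>impulse_energy\<close> comes only from positive times.\<close>

definition impulse_size :: "real \<Rightarrow> real" where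
  "impulse_size t = (if t > 0 then sqrt (enn2real (impulse_energy t)) else 0)"

lemma sigma_finite_Omega: "sigma_finite_measure \<Omega>"
proof -
  interpret T: sigma_finite_measure pos_time by (rule sigma_finite_pos_time)
  interpret P: pair_sigma_finite pos_time M ..
  show ?thesis by unfold_locales
qed

lemma measurable_C [measurable (raw)]: "g \<in> borel_measurable L \<Longrightarrow> (\<lambda>v. C (g v)) \<in> borel_measurable L"
  by (rule borel_measurable_continuous_on[OF linear_continuous_on[OF C]])

lemma measurable_C' [measurable (raw)]: "g \<in> borel_measurable L \<Longrightarrow> (\<lambda>v. C' (g v)) \<in> borel_measurable L"
  by (rule borel_measurable_continuous_on[OF linear_continuous_on[OF C']])

lemma measurable_kernel:
  assumes "p \<in> measurable L \<Omega>" "q \<in> measurable L \<Omega>"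
  shows "(\<lambda>v. kernel (p v, q v)) \<in> borel_measurable L"
proof -
  have [measurable]: "(\<lambda>v. fst (p v)) \<in> measurable L pos_time" "(\<lambda>v. snd (p v)) \<in> measurable L M"
    "(\<lambda>v. fst (q v)) \<in> measurable L pos_time" "(\<lambda>v. snd (q v)) \<in> measurable L M"
    using assms by measurable
  show ?thesis unfolding kernel_def fst_conv snd_conv
    by (intro measurable_cart_lambda borel_measurable_diff measurable_C measurable_C'
       X.measurable_Phi_compose_pos Y.measurable_Phi_compose_pos) measurable
qed

lemma norm_kernel: "(norm (kernel v))\<^sup>2 = (\<Sum>i\<in>UNIV. (norm (kernel v $ i))\<^sup>2)"
  unfolding norm_vec_def[of "kernel v"] L2_set_def by (simp add: sum_nonneg)

text \<open>Applied to an indicator of \<open>B\<close> in input direction \<open>i\<close>, the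
  Hankel difference integrates entry \<open>i\<close> of the kernel over \<open>B\<close>. Testing
  against an indicator of \<open>A\<close> gives an iterated integral, and Fubini on
  \<open>A \<times> B\<close> turns it into the product integral.\<close>

lemma kernel_operator: "L2_kernel_operator \<Omega> hankel_diff kernel"
proof -
  interpret \<Omega>: sigma_finite_measure \<Omega> by (rule sigma_finite_Omega)
  interpret \<Omega>2: pair_sigma_finite \<Omega> \<Omega> ..
  show ?thesis
  proof
    show "hankel_diff f \<in> L2 \<Omega>" if "f \<in> L2 \<Omega>" for f
      unfolding hankel_diff_def using X.hankel_L2[OF C] Y.hankel_L2[OF C'] by (rule L2_diff)
    show "hankel_diff (\<lambda>z. f z + g z) z = hankel_diff f z + hankel_diff g z"
      if "f \<in> L2 \<Omega>" "g \<in> L2 \<Omega>" "z \<in> space \<Omega>" for f g z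
      unfolding hankel_diff_def X.hankel_add[OF C that] Y.hankel_add[OF C' that] by simp
    show "hankel_diff (\<lambda>z. c *\<^sub>R f z) z = c *\<^sub>R hankel_diff f z"
      if "f \<in> L2 \<Omega>" "z \<in> space \<Omega>" for f z c
      unfolding hankel_diff_def X.hankel_scale[OF C that] Y.hankel_scale[OF C' that] by (simp add: scaleR_diff_right)
    show "kernel \<in> borel_measurable (\<Omega> \<Otimes>\<^sub>M \<Omega>)"
      using measurable_kernel[of fst "\<Omega> \<Otimes>\<^sub>M \<Omega>" snd] by simp
    fix A B :: "(real \<times> 'a) set" and i :: 'n and j :: 'm
    assume A: "A \<in> sets \<Omega>" and B: "B \<in> sets \<Omega>" "emeasure \<Omega> A < \<infinity>" "emeasure \<Omega> B < \<infinity>"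
      and int: "integrable (\<Omega> \<Otimes>\<^sub>M \<Omega>) (\<lambda>z. indicator (A \<times> B) z * kernel z $ i $ j)"
    let ?b = "\<lambda>z. indicator B z *\<^sub>R axis i (1::real)"
    have b: "?b \<in> L2 \<Omega>"
    proof (rule L2I)
      have "(norm (?b z))\<^sup>2 = indicator B z" for z by (simp add: indicator_def norm_axis_1)
      then have "(\<integral>\<^sup>+z. ennreal ((norm (?b z))\<^sup>2) \<partial>\<Omega>) = emeasure \<Omega> B"
        using B(1) by (simp add: ennreal_indicator del: norm_scaleR)
      then show "(\<integral>\<^sup>+z. ennreal ((norm (?b z))\<^sup>2) \<partial>\<Omega>) < \<infinity>" using B by simp
    qed (use B(1) in measurable)
    have inner: "hankel_diff ?b z \<bullet> axis j 1 = (\<integral>z'. indicator B z' * kernel (z, z') $ i $ j \<partial>\<Omega>)"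
      if z: "z \<in> space \<Omega>" for z
    proof -
      let ?k = "\<lambda>z'. C (Phi (fst z) 0 (snd z) (Phi (fst z') 0 (snd z') (input_op psi (?b z'))))
         - C' (Phi' (fst z) 0 (snd z) (Phi' (fst z') 0 (snd z') (input_op psi' (?b z'))))"
      have ik: "integrable \<Omega> ?k"
        by (intro Bochner_Integration.integrable_diff X.hankel_kernel(1) Y.hankel_kernel(1) C C' b z)
      have "hankel_diff ?b z = (\<integral>z'. ?k z' \<partial>\<Omega>)"
        unfolding hankel_diff_def X.hankel_kernel(2)[OF C b z] Y.hankel_kernel(2)[OF C' b z]
        by (rule Bochner_Integration.integral_diff[symmetric]; intro X.hankel_kernel(1) Y.hankel_kernel(1) C C' b z)
      then have "hankel_diff ?b z \<bullet> axis j 1 = (\<integral>z'. ?k z' \<bullet> axis j 1 \<partial>\<Omega>)"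
        using ik by simp
      also have "\<dots> = (\<integral>z'. indicator B z' * kernel (z, z') $ i $ j \<partial>\<Omega>)"
      proof (rule Bochner_Integration.integral_cong[OF refl])
        fix z' assume z': "z' \<in> space \<Omega>"
        have lin: "linear (Phi (fst z) 0 (snd z))" "linear (Phi (fst z') 0 (snd z'))"
          "linear (Phi' (fst z) 0 (snd z))" "linear (Phi' (fst z') 0 (snd z'))" "linear C" "linear C'"
          using z z' C C' by (auto simp: space_pair_measure intro!: bounded_linear.linear X.linear_Phi Y.linear_Phi)
        have "?k z' = indicator B z' *\<^sub>R (kernel (z, z') $ i)"
          unfolding input_op_axis kernel_def by (simp add: linear_scale[OF lin(1)] linear_scale[OF lin(2)]
            linear_scale[OF lin(3)] linear_scale[OF lin(4)] linear_scale[OF lin(5)] linear_scale[OF lin(6)] scaleR_diff_right)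
        then show "?k z' \<bullet> axis j 1 = indicator B z' * kernel (z, z') $ i $ j"
          by (simp add: inner_axis)
      qed
      finally show ?thesis .
    qed
    have "L2_inner \<Omega> (hankel_diff ?b) (\<lambda>z. indicator A z *\<^sub>R axis j 1)
      = (\<integral>z. \<integral>z'. indicator (A \<times> B) (z, z') * kernel (z, z') $ i $ j \<partial>\<Omega> \<partial>\<Omega>)"
      unfolding L2_inner_def
    proof (rule Bochner_Integration.integral_cong[OF refl])
      fix z assume z: "z \<in> space \<Omega>"
      have "hankel_diff ?b z \<bullet> (indicator A z *\<^sub>R axis j 1)
          = indicator A z * (\<integral>z'. indicator B z' * kernel (z, z') $ i $ j \<partial>\<Omega>)"
        using inner[OF z] by simp
      also have "\<dots> = (\<integral>z'. indicator A z * (indicator B z' * kernel (z, z') $ i $ j) \<partial>\<Omega>)" by simp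
      finally show "hankel_diff ?b z \<bullet> (indicator A z *\<^sub>R axis j 1)
          = (\<integral>z'. indicator (A \<times> B) (z, z') * kernel (z, z') $ i $ j \<partial>\<Omega>)"
        by (simp add: indicator_times mult.assoc)
    qed
    also have "\<dots> = (\<integral>v. indicator (A \<times> B) v * kernel v $ i $ j \<partial>(\<Omega> \<Otimes>\<^sub>M \<Omega>))"
      by (rule \<Omega>2.integral_fst'[OF int])
    finally show "L2_inner \<Omega> (hankel_diff ?b) (\<lambda>z. indicator A z *\<^sub>R axis j 1)
      = (\<integral>v. indicator (A \<times> B) v * kernel v $ i $ j \<partial>(\<Omega> \<Otimes>\<^sub>M \<Omega>))" .
  qed
qed

lemma impulse_energy_measurable [measurable]: "impulse_energy \<in> borel_measurable pos_time"
proof -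
  have [measurable]: "(\<lambda>z. Phi (fst z) 0 (snd z) x) \<in> borel_measurable \<Omega>"
    "(\<lambda>z. Phi' (fst z) 0 (snd z) y) \<in> borel_measurable \<Omega>" for x y
    by (auto intro!: X.measurable_Phi_Omega Y.measurable_Phi_Omega)
  have "(\<lambda>z. ennreal ((norm (C (Phi (fst z) 0 (snd z) (psi i)) - C' (Phi' (fst z) 0 (snd z) (psi' i))))\<^sup>2)) \<in> borel_measurable \<Omega>" for i
    by measurable
  from X.borel_measurable_nn_integral_fst[OF this] show ?thesis
    unfolding impulse_energy_def[abs_def] by simp
qed

lemma impulse_size_measurable [measurable]: "impulse_size \<in> borel_measurable borel"
proof -
  have "(\<lambda>t. sqrt (enn2real (impulse_energy t))) \<in> borel_measurable (restrict_space borel {0<..})"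
    using impulse_energy_measurable unfolding pos_time_def
    by (simp cong: measurable_cong_sets sets_restrict_space_cong)
  then have "(\<lambda>t. indicator {0<..} t *\<^sub>R sqrt (enn2real (impulse_energy t))) \<in> borel_measurable borel"
    by (subst (asm) borel_measurable_restrict_space_iff) auto
  also have "(\<lambda>t. indicator {0<..} t *\<^sub>R sqrt (enn2real (impulse_energy t))) = impulse_size"
    by (auto simp: impulse_size_def fun_eq_iff)
  finally show ?thesis .
qed

text \<open>A uniform bound, with the decay discarded: it makes the Hilbert-Schmidt norm of every
  bounded block finite.\<close>

lemma impulse_energy_bounded: "\<exists>Z\<ge>0. \<forall>t\<ge>0. impulse_energy t \<le> ennreal Z"
proof -
  obtain c K where K: "c > 0" "K \<ge> 0" "\<And>t x. 0 \<le> t \<Longrightarrow> (\<integral>\<^sup>+w. ennreal ((norm (Phi t 0 w x))\<^sup>2) \<partial>M) \<le> ennreal (K * exp (- c * t) * (norm x)\<^sup>2)"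
    using X.stability_bounds by blast
  obtain c' K' where K': "c' > 0" "K' \<ge> 0" "\<And>t x. 0 \<le> t \<Longrightarrow> (\<integral>\<^sup>+w. ennreal ((norm (Phi' t 0 w x))\<^sup>2) \<partial>M) \<le> ennreal (K' * exp (- c' * t) * (norm x)\<^sup>2)"
    using Y.stability_bounds by blast
  obtain L where L: "L > 0" "\<And>x. norm (C x) \<le> norm x * L" using bounded_linear.pos_bounded[OF C] by auto
  obtain L' where L': "L' > 0" "\<And>x. norm (C' x) \<le> norm x * L'" using bounded_linear.pos_bounded[OF C'] by auto
  have stab: "k * exp (- d * t) * n \<le> k * n" if "k \<ge> 0" "d > 0" "t \<ge> 0" "n \<ge> 0" for k d t n :: real
    using that by (intro mult_right_mono mult_left_le) auto
  define Zi where "Zi i = 2 * L\<^sup>2 * (K * (norm (psi i))\<^sup>2) + 2 * L'\<^sup>2 * (K' * (norm (psi' i))\<^sup>2)" for i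
  have Zi0: "Zi i \<ge> 0" for i unfolding Zi_def using K K' by auto
  have "(\<integral>\<^sup>+w. ennreal ((norm (C (Phi t 0 w (psi i)) - C' (Phi' t 0 w (psi' i))))\<^sup>2) \<partial>M) \<le> ennreal (Zi i)" if t: "t \<ge> 0" for t i
  proof -
    note [measurable] = X.measurable_Phi[OF order_refl t, of "psi i"] Y.measurable_Phi[OF order_refl t, of "psi' i"]
    have "(\<integral>\<^sup>+w. ennreal ((norm (C (Phi t 0 w (psi i)) - C' (Phi' t 0 w (psi' i))))\<^sup>2) \<partial>M)
       \<le> (\<integral>\<^sup>+w. ennreal (2 * L\<^sup>2) * ennreal ((norm (Phi t 0 w (psi i)))\<^sup>2) + ennreal (2 * L'\<^sup>2) * ennreal ((norm (Phi' t 0 w (psi' i)))\<^sup>2) \<partial>M)"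
    proof (rule nn_integral_mono)
      fix w
      let ?x = "Phi t 0 w (psi i)" and ?y = "Phi' t 0 w (psi' i)"
      have "(norm (C ?x - C' ?y))\<^sup>2 \<le> 2 * (norm (C ?x))\<^sup>2 + 2 * (norm (C' ?y))\<^sup>2"
        using norm_add_power2_le[of "C ?x" "- C' ?y"] by simp
      also have "\<dots> \<le> 2 * (norm ?x * L)\<^sup>2 + 2 * (norm ?y * L')\<^sup>2"
        by (intro add_mono mult_left_mono power_mono L L') auto
      finally have "(norm (C ?x - C' ?y))\<^sup>2 \<le> 2 * L\<^sup>2 * (norm ?x)\<^sup>2 + 2 * L'\<^sup>2 * (norm ?y)\<^sup>2"
        by (simp add: power_mult_distrib mult_ac)
      then have "ennreal ((norm (C ?x - C' ?y))\<^sup>2) \<le> ennreal (2 * L\<^sup>2 * (norm ?x)\<^sup>2 + 2 * L'\<^sup>2 * (norm ?y)\<^sup>2)"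
        by (rule ennreal_leI)
      also have "\<dots> = ennreal (2 * L\<^sup>2) * ennreal ((norm ?x)\<^sup>2) + ennreal (2 * L'\<^sup>2) * ennreal ((norm ?y)\<^sup>2)"
        by (subst ennreal_plus) (auto intro!: arg_cong2[where f = "(+)"] ennreal_mult)
      finally show "ennreal ((norm (C ?x - C' ?y))\<^sup>2) \<le> ennreal (2 * L\<^sup>2) * ennreal ((norm ?x)\<^sup>2) + ennreal (2 * L'\<^sup>2) * ennreal ((norm ?y)\<^sup>2)" .
    qed
    also have "\<dots> = ennreal (2 * L\<^sup>2) * (\<integral>\<^sup>+w. ennreal ((norm (Phi t 0 w (psi i)))\<^sup>2) \<partial>M)
        + ennreal (2 * L'\<^sup>2) * (\<integral>\<^sup>+w. ennreal ((norm (Phi' t 0 w (psi' i)))\<^sup>2) \<partial>M)"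
      by (subst nn_integral_add) (auto simp: nn_integral_cmult)
    also have "\<dots> \<le> ennreal (2 * L\<^sup>2) * ennreal (K * (norm (psi i))\<^sup>2) + ennreal (2 * L'\<^sup>2) * ennreal (K' * (norm (psi' i))\<^sup>2)"
      using K K' t by (intro add_mono mult_left_mono order_trans[OF K(3)] order_trans[OF K'(3)] ennreal_leI stab) auto
    also have "\<dots> = ennreal (Zi i)"
      unfolding Zi_def using K K' by (subst ennreal_plus) (auto intro!: arg_cong2[where f = "(+)"] ennreal_mult[symmetric])
    finally show ?thesis .
  qed
  then have "impulse_energy t \<le> (\<Sum>i\<in>UNIV. ennreal (Zi i))" if "t \<ge> 0" for t
    unfolding impulse_energy_def using that by (intro sum_mono) auto
  moreover have "(\<Sum>i\<in>UNIV. ennreal (Zi i)) = ennreal (\<Sum>i\<in>UNIV. Zi i)"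
    using Zi0 by (intro sum_ennreal) auto
  ultimately show ?thesis using Zi0 by (intro exI[of _ "\<Sum>i\<in>UNIV. Zi i"]) (auto intro: sum_nonneg)
qed

lemma impulse_size_power2: "t > 0 \<Longrightarrow> ennreal ((impulse_size t)\<^sup>2) = impulse_energy t"
proof -
  assume t: "t > 0"
  obtain Z where "\<forall>t\<ge>0. impulse_energy t \<le> ennreal Z" using impulse_energy_bounded by auto
  then have "impulse_energy t < \<top>" using t by (meson ennreal_less_top less_imp_le order.strict_trans1)
  then show ?thesis using t unfolding impulse_size_def by simp
qed

lemma impulse_size_nonneg: "impulse_size t \<ge> 0"
  unfolding impulse_size_def by simp

text \<open>The sum over inputs is drawn out of both expectations, so the semigroup identity for the
  pair of flows is applied to one pair of starting vectors at a time.\<close>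

lemma kernel_energy:
  assumes ts: "t > 0" "s > 0"
  shows "(\<integral>\<^sup>+w. \<integral>\<^sup>+w'. ennreal ((norm (kernel ((t, w), (s, w'))))\<^sup>2) \<partial>M \<partial>M) = impulse_energy (t + s)"
proof -
  interpret P: pair_prob_space M M ..
  let ?G = "\<lambda>v. ennreal ((norm (C (fst v) - C' (snd v)))\<^sup>2)"
  have G: "?G \<in> borel_measurable (borel \<Otimes>\<^sub>M borel)" by measurable
  note [measurable (raw)] = X.measurable_Phi_compose[OF order_refl less_imp_le[OF ts(1)]] Y.measurable_Phi_compose[OF order_refl less_imp_le[OF ts(1)]]
    X.measurable_Phi_compose[OF order_refl less_imp_le[OF ts(2)]] Y.measurable_Phi_compose[OF order_refl less_imp_le[OF ts(2)]]
  let ?k = "\<lambda>i w w'. ennreal ((norm (C (Phi t 0 w (Phi s 0 w' (psi i))) - C' (Phi' t 0 w (Phi' s 0 w' (psi' i)))))\<^sup>2)"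
  have "(\<integral>\<^sup>+w. \<integral>\<^sup>+w'. ennreal ((norm (kernel ((t, w), (s, w'))))\<^sup>2) \<partial>M \<partial>M) = (\<integral>\<^sup>+w. \<integral>\<^sup>+w'. (\<Sum>i\<in>UNIV. ?k i w w') \<partial>M \<partial>M)"
    unfolding norm_kernel by (simp add: sum_ennreal kernel_def)
  also have "\<dots> = (\<integral>\<^sup>+w. (\<Sum>i\<in>UNIV. \<integral>\<^sup>+w'. ?k i w w' \<partial>M) \<partial>M)"
    by (intro nn_integral_cong nn_integral_sum) measurable
  also have "\<dots> = (\<Sum>i\<in>UNIV. \<integral>\<^sup>+w. \<integral>\<^sup>+w'. ?k i w w' \<partial>M \<partial>M)"
    by (intro nn_integral_sum) measurable
  also have "\<dots> = (\<Sum>i\<in>UNIV. \<integral>\<^sup>+w'. \<integral>\<^sup>+w. ?k i w w' \<partial>M \<partial>M)"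
    by (intro sum.cong refl P.Fubini') measurable
  also have "\<dots> = impulse_energy (t + s)"
    unfolding impulse_energy_def
    using nn_integral_pair_semigroup[OF less_imp_le[OF ts(1)] less_imp_le[OF ts(2)] G]
    by (intro sum.cong refl) (simp add: add.commute)
  finally show ?thesis .
qed

text \<open>The block is full in the sample variables. Integrating them out first leaves a function
  of \<open>t + s\<close> alone, which is what averaging over antidiagonals requires.\<close>

lemma kernel_block:
  assumes J [measurable]: "J \<in> sets borel" and Jpos: "J \<subseteq> {0<..}"
  shows "(\<integral>\<^sup>+v. indicator ((J \<times> space M) \<times> (J \<times> space M)) v * ennreal ((norm (kernel v))\<^sup>2) \<partial>(\<Omega> \<Otimes>\<^sub>M \<Omega>))
    = (\<integral>\<^sup>+t. \<integral>\<^sup>+s. indicator J t * indicator J s * ennreal ((impulse_size (t + s))\<^sup>2) \<partial>lborel \<partial>lborel)"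
proof -
  interpret T: sigma_finite_measure pos_time by (rule sigma_finite_pos_time)
  interpret \<Omega>: sigma_finite_measure \<Omega> by (rule sigma_finite_Omega)
  interpret P: pair_sigma_finite M pos_time ..
  have Jp [measurable]: "J \<in> sets pos_time"
    unfolding pos_time_def using Jpos J by (simp add: sets_restrict_space_iff)
  have [measurable]: "kernel \<in> borel_measurable (\<Omega> \<Otimes>\<^sub>M \<Omega>)"
    using measurable_kernel[of fst "\<Omega> \<Otimes>\<^sub>M \<Omega>" snd] by simp
  have [measurable]: "J \<times> space M \<in> sets \<Omega>" by simp
  let ?k = "\<lambda>t w s w'. ennreal ((norm (kernel ((t, w), (s, w'))))\<^sup>2)"
  have "(\<integral>\<^sup>+v. indicator ((J \<times> space M) \<times> (J \<times> space M)) v * ennreal ((norm (kernel v))\<^sup>2) \<partial>(\<Omega> \<Otimes>\<^sub>M \<Omega>))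
     = (\<integral>\<^sup>+z. \<integral>\<^sup>+z'. indicator (J \<times> space M) z * indicator (J \<times> space M) z' * ennreal ((norm (kernel (z, z')))\<^sup>2) \<partial>\<Omega> \<partial>\<Omega>)"
    by (subst \<Omega>.nn_integral_fst[symmetric]) (auto simp: indicator_times)
  also have "\<dots> = (\<integral>\<^sup>+t. \<integral>\<^sup>+w. \<integral>\<^sup>+z'. indicator (J \<times> space M) (t, w) * indicator (J \<times> space M) z' * ennreal ((norm (kernel ((t, w), z')))\<^sup>2) \<partial>\<Omega> \<partial>M \<partial>pos_time)"
    by (rule X.nn_integral_fst[symmetric]) measurable
  also have "\<dots> = (\<integral>\<^sup>+t. \<integral>\<^sup>+w. \<integral>\<^sup>+s. \<integral>\<^sup>+w'. indicator (J \<times> space M) (t, w) * indicator (J \<times> space M) (s, w') * ?k t w s w' \<partial>M \<partial>pos_time \<partial>M \<partial>pos_time)"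
    by (intro nn_integral_cong X.nn_integral_fst[symmetric]) measurable
  also have "\<dots> = (\<integral>\<^sup>+t. \<integral>\<^sup>+w. \<integral>\<^sup>+s. indicator J t * indicator J s * (\<integral>\<^sup>+w'. ?k t w s w' \<partial>M) \<partial>pos_time \<partial>M \<partial>pos_time)"
    by (intro nn_integral_cong, subst nn_integral_cmult[symmetric])
       (auto simp: indicator_times intro!: nn_integral_cong)
  also have "\<dots> = (\<integral>\<^sup>+t. \<integral>\<^sup>+s. \<integral>\<^sup>+w. indicator J t * indicator J s * (\<integral>\<^sup>+w'. ?k t w s w' \<partial>M) \<partial>M \<partial>pos_time \<partial>pos_time)"
    by (intro nn_integral_cong P.Fubini'[symmetric]) measurable
  also have "\<dots> = (\<integral>\<^sup>+t. \<integral>\<^sup>+s. indicator J t * indicator J s * ennreal ((impulse_size (t + s))\<^sup>2) \<partial>pos_time \<partial>pos_time)"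
    by (intro nn_integral_cong, subst nn_integral_cmult) (auto simp: kernel_energy impulse_size_power2)
  also have "\<dots> = (\<integral>\<^sup>+t. \<integral>\<^sup>+s. indicator J t * indicator J s * ennreal ((impulse_size (t + s))\<^sup>2) \<partial>lborel \<partial>lborel)"
    unfolding nn_integral_pos_time
  proof (rule nn_integral_cong)
    fix t :: real
    have "(\<integral>\<^sup>+s. indicator J t * indicator J s * ennreal ((impulse_size (t + s))\<^sup>2) * indicator {0<..} s \<partial>lborel)
       = (\<integral>\<^sup>+s. indicator J t * indicator J s * ennreal ((impulse_size (t + s))\<^sup>2) \<partial>lborel)"
      using Jpos by (intro nn_integral_cong) (auto simp: indicator_def)
    then show "(\<integral>\<^sup>+s. indicator J t * indicator J s * ennreal ((impulse_size (t + s))\<^sup>2) * indicator {0<..} s \<partial>lborel) * indicator {0<..} t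
       = (\<integral>\<^sup>+s. indicator J t * indicator J s * ennreal ((impulse_size (t + s))\<^sup>2) \<partial>lborel)"
      using Jpos by (cases "t \<in> J") (auto simp: indicator_def)
  qed
  finally show ?thesis .
qed

end

section \<open>Moment bounds for controls and state responses\<close>

lemma ennreal_le_of_power2_le:
  assumes "(x::ennreal)\<^sup>2 \<le> ennreal (c\<^sup>2)" "c \<ge> 0"
  shows "x \<le> ennreal c"
proof (cases x)
  case (real r)
  then have "ennreal (r\<^sup>2) \<le> ennreal (c\<^sup>2)" using assms(1) by (simp add: ennreal_power)
  then have "r\<^sup>2 \<le> c\<^sup>2" by (simp add: ennreal_le_iff)
  then have "r \<le> c" using assms(2) by (rule power2_le_imp_le)
  then show ?thesis unfolding real(2) by (rule ennreal_leI)
next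
  case top
  then show ?thesis using assms(1) by (simp add: power2_eq_square top_unique)
qed

text \<open>Cauchy-Schwarz twice: over the inputs for each sample, then over the sample space.
  Dependence between the coefficients \<open>v\<close> and the vectors \<open>d\<close> does no
  harm.\<close>

lemma nn_integral_norm_lincomb_le:
  fixes v :: "'a \<Rightarrow> real^'n::finite" and d :: "'n \<Rightarrow> 'a \<Rightarrow> 'v::real_normed_vector"
  assumes [measurable]: "v \<in> borel_measurable M" "\<And>i. (\<lambda>w. norm (d i w)) \<in> borel_measurable M"
    and d: "(\<Sum>i\<in>UNIV. \<integral>\<^sup>+w. ennreal ((norm (d i w))\<^sup>2) \<partial>M) \<le> ennreal (a\<^sup>2)"
    and v: "(\<integral>\<^sup>+w. ennreal ((norm (v w))\<^sup>2) \<partial>M) \<le> ennreal (b\<^sup>2)" and ab: "a \<ge> 0" "b \<ge> 0"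
  shows "(\<integral>\<^sup>+w. ennreal (norm (\<Sum>i\<in>UNIV. v w $ i *\<^sub>R d i w)) \<partial>M) \<le> ennreal (a * b)"
proof -
  let ?D = "\<lambda>w. L2_set (\<lambda>i. norm (d i w)) UNIV"
  have [measurable]: "?D \<in> borel_measurable M" unfolding L2_set_def by measurable
  have "(\<integral>\<^sup>+w. ennreal (norm (\<Sum>i\<in>UNIV. v w $ i *\<^sub>R d i w)) \<partial>M) \<le> (\<integral>\<^sup>+w. ennreal (?D w) * ennreal (norm (v w)) \<partial>M)"
  proof (rule nn_integral_mono)
    fix w
    have "norm (\<Sum>i\<in>UNIV. v w $ i *\<^sub>R d i w) \<le> (\<Sum>i\<in>UNIV. norm (v w $ i *\<^sub>R d i w))" by (rule norm_sum)
    also have "\<dots> = (\<Sum>i\<in>UNIV. \<bar>norm (d i w)\<bar> * \<bar>v w $ i\<bar>)" by (simp add: mult.commute)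
    also have "\<dots> \<le> ?D w * L2_set (\<lambda>i. v w $ i) UNIV" by (rule L2_set_mult_ineq)
    also have "L2_set (\<lambda>i. v w $ i) UNIV = norm (v w)" by (simp add: norm_vec_def L2_set_def)
    finally show "ennreal (norm (\<Sum>i\<in>UNIV. v w $ i *\<^sub>R d i w)) \<le> ennreal (?D w) * ennreal (norm (v w))"
      by (simp add: ennreal_mult[symmetric] ennreal_leI)
  qed
  also have "\<dots> \<le> ennreal (a * b)"
  proof (rule ennreal_le_of_power2_le)
    have "(\<integral>\<^sup>+w. ennreal (?D w) * ennreal (norm (v w)) \<partial>M)\<^sup>2
      \<le> (\<integral>\<^sup>+w. (ennreal (?D w))\<^sup>2 \<partial>M) * (\<integral>\<^sup>+w. (ennreal (norm (v w)))\<^sup>2 \<partial>M)"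
      by (rule Cauchy_Schwarz_nn_integral) measurable
    also have "(\<integral>\<^sup>+w. (ennreal (?D w))\<^sup>2 \<partial>M) = (\<integral>\<^sup>+w. (\<Sum>i\<in>UNIV. ennreal ((norm (d i w))\<^sup>2)) \<partial>M)"
      by (intro nn_integral_cong) (simp add: ennreal_power L2_set_def sum_nonneg)
    also have "\<dots> = (\<Sum>i\<in>UNIV. \<integral>\<^sup>+w. ennreal ((norm (d i w))\<^sup>2) \<partial>M)"
      by (intro nn_integral_sum) measurable
    also have "(\<integral>\<^sup>+w. (ennreal (norm (v w)))\<^sup>2 \<partial>M) = (\<integral>\<^sup>+w. ennreal ((norm (v w))\<^sup>2) \<partial>M)"
      by (simp add: ennreal_power)
    also have "(\<Sum>i\<in>UNIV. \<integral>\<^sup>+w. ennreal ((norm (d i w))\<^sup>2) \<partial>M) * (\<integral>\<^sup>+w. ennreal ((norm (v w))\<^sup>2) \<partial>M)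
        \<le> ennreal (a\<^sup>2) * ennreal (b\<^sup>2)"
      by (intro mult_mono d v) auto
    also have "\<dots> = ennreal ((a * b)\<^sup>2)" by (simp add: ennreal_mult[symmetric] power_mult_distrib)
    finally show "(\<integral>\<^sup>+w. ennreal (?D w) * ennreal (norm (v w)) \<partial>M)\<^sup>2 \<le> ennreal ((a * b)\<^sup>2)" .
  qed (use ab in simp)
  finally show ?thesis .
qed

text \<open>\<open>H2_norm\<close> is a supremum of reals obtained by \<open>enn2real\<close>.
  Membership in \<open>H2\<close> supplies the boundedness and finiteness that make it an actual
  bound.\<close>

lemma H2_norm_bound:
  assumes u: "u \<in> H2 M F" and t: "t > 0"
  shows "(\<integral>\<^sup>+w. ennreal ((norm (u t w))\<^sup>2) \<partial>M) \<le> ennreal ((H2_norm M u)\<^sup>2)" "H2_norm M u \<ge> 0"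
proof -
  obtain K where K: "\<And>t. t > 0 \<Longrightarrow> (\<integral>\<^sup>+ w. ennreal ((norm (u t w))\<^sup>2) \<partial>M) \<le> ennreal K"
    using u unfolding H2_def by auto
  let ?f = "\<lambda>t. \<integral>\<^sup>+ w. ennreal ((norm (u t w))\<^sup>2) \<partial>M"
  have fin: "?f t < \<top>" if "t > 0" for t using K[OF that] by (rule order.strict_trans1) simp
  have "bdd_above ((\<lambda>t. sqrt (enn2real (?f t))) ` {0<..})"
  proof (rule bdd_aboveI2)
    fix t :: real assume "t \<in> {0<..}"
    then have "enn2real (?f t) \<le> max K 0"
      using K[of t] by (intro enn2real_leI) (auto intro: order_trans ennreal_leI)
    then show "sqrt (enn2real (?f t)) \<le> sqrt (max K 0)" by simp
  qed
  then have le: "sqrt (enn2real (?f t)) \<le> H2_norm M u"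
    unfolding H2_norm_def using t by (intro cSUP_upper) auto
  then show 0: "H2_norm M u \<ge> 0" by (rule order_trans[rotated]) simp
  have "enn2real (?f t) \<le> (H2_norm M u)\<^sup>2"
    using le by (simp add: real_sqrt_le_iff' sqrt_le_D)
  then show "?f t \<le> ennreal ((H2_norm M u)\<^sup>2)"
    using fin[OF t] by (metis ennreal_enn2real ennreal_leI)
qed

context stable_flow
begin

text \<open>A Bochner integral defaults to 0 where the integrand is not integrable, so almost sure
  integrability is what makes \<open>state_resp\<close> the intended response. It follows from a
  finite expected integral of the norm, where homogeneity reduces \<open>Phi t s\<close> to a flow
  started at time 0.\<close>

lemma state_resp_integrable:
  fixes u :: "real \<Rightarrow> 'a \<Rightarrow> real^'n::finite"
  assumes u: "u \<in> H2 M F" and t: "t > 0"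
  shows "AE w in M. integrable (restrict_space lborel {0<..t}) (\<lambda>s. Phi t s w (input_op psi (u s w)))"
    and "(\<lambda>z. Phi t (fst z) (snd z) (input_op psi (u (fst z) (snd z)))) \<in> borel_measurable (restrict_space lborel {0<..t} \<Otimes>\<^sub>M M)"
proof -
  let ?R = "restrict_space lborel {0<..t}"
  interpret R: sigma_finite_measure ?R
    by (rule sigma_finite_measure_restrict_space) (auto intro: sigma_finite_lborel)
  interpret P: pair_sigma_finite ?R M ..
  have um: "(\<lambda>z. u (fst z) (snd z)) \<in> borel_measurable (?R \<Otimes>\<^sub>M M)"
  proof -
    have "(\<lambda>s. s) \<in> measurable ?R pos_time"
      unfolding pos_time_def by (rule measurable_restrict_space2) (auto simp: space_restrict_space intro!: measurable_restrict_space1)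
    then have "(\<lambda>z. (fst z, snd z)) \<in> measurable (?R \<Otimes>\<^sub>M M) (pos_time \<Otimes>\<^sub>M M)"
      by measurable
    moreover have "(\<lambda>(t, w). u t w) \<in> borel_measurable (pos_time \<Otimes>\<^sub>M M)"
      using u unfolding H2_def Omega_pos_eq by simp
    ultimately show ?thesis
      by (auto dest: measurable_compose simp: case_prod_unfold)
  qed
  show m: "(\<lambda>z. Phi t (fst z) (snd z) (input_op psi (u (fst z) (snd z)))) \<in> borel_measurable (?R \<Otimes>\<^sub>M M)"
  proof (rule borel_measurable_continuous_parameter[where \<phi> = "\<lambda>z. Phi t (fst z) (snd z)"])
    show "(\<lambda>z. Phi t (fst z) (snd z) x) \<in> borel_measurable (?R \<Otimes>\<^sub>M M)" for x
      using measurable_Phi_snd[of t x] by (simp add: case_prod_unfold)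
    show "continuous_on UNIV (Phi t (fst v) (snd v))" if "v \<in> space (?R \<Otimes>\<^sub>M M)" for v
      using that by (intro linear_continuous_on linear_Phi) (auto simp: space_pair_measure space_restrict_space)
    show "(\<lambda>z. input_op psi (u (fst z) (snd z))) \<in> borel_measurable (?R \<Otimes>\<^sub>M M)"
      by (rule borel_measurable_continuous_on[OF linear_continuous_on[OF bounded_linear_input_op] um])
  qed
  obtain c K where K: "c > 0" "K \<ge> 0" "\<And>t x. 0 \<le> t \<Longrightarrow> (\<integral>\<^sup>+w. ennreal ((norm (Phi t 0 w x))\<^sup>2) \<partial>M) \<le> ennreal (K * exp (- c * t) * (norm x)\<^sup>2)"
    using stability_bounds by blast
  \<comment> \<open>The square of \<open>a\<close> bounds the summed second moments of the columns
    of the flow, uniformly in the elapsed time.\<close>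
  define a where "a = sqrt (\<Sum>i\<in>UNIV. K * (norm (psi i))\<^sup>2)"
  have a: "a \<ge> 0" "a\<^sup>2 = (\<Sum>i\<in>UNIV. K * (norm (psi i))\<^sup>2)"
    unfolding a_def using K by (auto intro!: sum_nonneg)
  let ?h = "\<lambda>s w. Phi t s w (input_op psi (u s w))"
  have bound: "(\<integral>\<^sup>+w. ennreal (norm (?h s w)) \<partial>M) \<le> ennreal (a * H2_norm M u)" if s: "s \<in> space ?R" for s
  proof -
    from s have s': "0 \<le> s" "s \<le> t" "0 < s" by (auto simp: space_restrict_space)
    have usm: "u s \<in> borel_measurable M"
      using measurable_compose[OF measurable_Pair1'[OF s] um] by simp
    have "(\<integral>\<^sup>+w. ennreal (norm (?h s w)) \<partial>M) = (\<integral>\<^sup>+w. ennreal (norm (\<Sum>i\<in>UNIV. u s w $ i *\<^sub>R Phi t s w (psi i))) \<partial>M)"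
      by (intro nn_integral_cong) (simp add: input_op_def linear_sum[OF bounded_linear.linear[OF linear_Phi[OF s'(1,2)]]]
            linear_scale[OF bounded_linear.linear[OF linear_Phi[OF s'(1,2)]]])
    also have "\<dots> \<le> ennreal (a * H2_norm M u)"
    proof (rule nn_integral_norm_lincomb_le[OF usm _ _ H2_norm_bound(1)[OF u s'(3)] a(1) H2_norm_bound(2)[OF u s'(3)]])
      show "(\<lambda>w. norm (Phi t s w (psi i))) \<in> borel_measurable M" for i
        using measurable_Phi[OF s'(1,2)] by measurable
      have "(\<integral>\<^sup>+w. ennreal ((norm (Phi t s w (psi i)))\<^sup>2) \<partial>M) \<le> ennreal (K * (norm (psi i))\<^sup>2)" for i
      proof -
        have "(\<integral>\<^sup>+w. ennreal ((norm (Phi t s w (psi i)))\<^sup>2) \<partial>M) = (\<integral>\<^sup>+w. ennreal ((norm (Phi (t - s) 0 w (psi i)))\<^sup>2) \<partial>M)"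
          using nn_integral_homogeneous[of "t - s" s "\<lambda>x. ennreal ((norm x)\<^sup>2)" "psi i"] s' by simp
        also have "\<dots> \<le> ennreal (K * exp (- c * (t - s)) * (norm (psi i))\<^sup>2)" using s' by (intro K) auto
        also have "\<dots> \<le> ennreal (K * (norm (psi i))\<^sup>2)"
          using K s' by (intro ennreal_leI mult_right_mono mult_left_le) auto
        finally show ?thesis .
      qed
      then have "(\<Sum>i\<in>UNIV. \<integral>\<^sup>+w. ennreal ((norm (Phi t s w (psi i)))\<^sup>2) \<partial>M) \<le> (\<Sum>i\<in>UNIV. ennreal (K * (norm (psi i))\<^sup>2))"
        by (intro sum_mono) auto
      also have "\<dots> = ennreal (a\<^sup>2)" unfolding a(2) using K by (intro sum_ennreal) auto
      finally show "(\<Sum>i\<in>UNIV. \<integral>\<^sup>+w. ennreal ((norm (Phi t s w (psi i)))\<^sup>2) \<partial>M) \<le> ennreal (a\<^sup>2)" .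
    qed
    finally show ?thesis .
  qed
  have nm: "(\<lambda>(s, w). ennreal (norm (?h s w))) \<in> borel_measurable (?R \<Otimes>\<^sub>M M)"
    using m by (simp add: case_prod_unfold)
  have "(\<integral>\<^sup>+w. \<integral>\<^sup>+s. ennreal (norm (?h s w)) \<partial>?R \<partial>M) = (\<integral>\<^sup>+s. \<integral>\<^sup>+w. ennreal (norm (?h s w)) \<partial>M \<partial>?R)"
    by (rule P.Fubini'[OF nm])
  also have "\<dots> \<le> (\<integral>\<^sup>+s. ennreal (a * H2_norm M u) \<partial>?R)"
    by (intro nn_integral_mono bound)
  also have "\<dots> < \<infinity>"
    using t by (simp add: emeasure_restrict_space space_restrict_space ennreal_mult_less_top)
  finally have "(\<integral>\<^sup>+w. \<integral>\<^sup>+s. ennreal (norm (?h s w)) \<partial>?R \<partial>M) \<noteq> \<infinity>" by simp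
  moreover have "(\<lambda>w. \<integral>\<^sup>+s. ennreal (norm (?h s w)) \<partial>?R) \<in> borel_measurable M"
    using measurable_compose[OF measurable_pair_swap' nm]
    by (intro R.borel_measurable_nn_integral) (simp add: case_prod_unfold)
  ultimately have "AE w in M. (\<integral>\<^sup>+s. ennreal (norm (?h s w)) \<partial>?R) \<noteq> \<infinity>"
    by (intro nn_integral_PInf_AE)
  then show "AE w in M. integrable ?R (\<lambda>s. ?h s w)"
    using AE_space
  proof eventually_elim
    case (elim w)
    note fin = elim(1) and w = elim(2)
    show "integrable ?R (\<lambda>s. ?h s w)"
      using measurable_compose[OF measurable_Pair2'[OF w] m] fin by (intro integrableI_bounded) (auto simp: less_top)
  qed
qed

end

section \<open>From blocks to the trace norm, and the output error\<close>

context system_pair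
begin

text \<open>Cauchy-Schwarz on a square of area \<open>\<epsilon>\<^sup>2\<close> bounds the integral
  of z(t + s) by \<epsilon> times the Hilbert-Schmidt norm of the block. Summed over disjoint blocks
  this is at most \<epsilon> times the trace norm, the premise of the tent argument.\<close>

lemma impulse_size_integral_le: "(\<integral>\<^sup>+r. indicator {0<..} r * ennreal (impulse_size r) \<partial>lborel) \<le> 2 * trace_norm \<Omega> \<Omega> hankel_diff"
proof (rule nn_integral_le_of_diagonal_blocks)
  interpret T: L2_kernel_operator \<Omega> hankel_diff kernel by (rule kernel_operator)
  show "(\<lambda>r. ennreal (impulse_size r)) \<in> borel_measurable borel" by measurable
  obtain Z where Z: "\<And>t. t \<ge> 0 \<Longrightarrow> impulse_energy t \<le> ennreal Z" using impulse_energy_bounded by auto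
  fix \<epsilon> a :: real and n :: nat assume e: "\<epsilon> > 0" and a: "a \<ge> 0"
  define J where "J q = {a + real q * \<epsilon><..a + real q * \<epsilon> + \<epsilon>}" for q
  define V where "V q = (\<integral>\<^sup>+t. \<integral>\<^sup>+s. indicator (J q) t * indicator (J q) s * ennreal ((impulse_size (t + s))\<^sup>2) \<partial>lborel \<partial>lborel)" for q
  have Jm [measurable]: "J q \<in> sets borel" for q unfolding J_def by simp
  have J0: "0 \<le> a + real q * \<epsilon>" for q using e a by simp
  have Jpos: "J q \<subseteq> {0<..}" for q unfolding J_def using J0[of q] by auto
  have Jl: "emeasure lborel (J q) = ennreal \<epsilon>" for q unfolding J_def using e by simp
  have JJ: "(\<integral>\<^sup>+v. indicator (J q \<times> J q) v \<partial>(lborel \<Otimes>\<^sub>M lborel)) = ennreal (\<epsilon>\<^sup>2)" for q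
    using e by (simp add: lborel.emeasure_pair_measure_Times Jl ennreal_mult[symmetric] power2_eq_square)
  \<comment> \<open>The indicator sits inside the square, so \<open>V q\<close> appears directly as
    one factor in Cauchy-Schwarz, with the indicator itself as the other function.\<close>
  have V_pair: "V q = (\<integral>\<^sup>+v. (ennreal (impulse_size (fst v + snd v)) * indicator (J q \<times> J q) v)\<^sup>2 \<partial>(lborel \<Otimes>\<^sub>M lborel))" for q
    unfolding V_def
    by (subst lborel.nn_integral_fst[symmetric])
       (auto simp: indicator_times power_mult_distrib ennreal_power impulse_size_nonneg indicator_def intro!: nn_integral_cong)
  have Vfin: "V q < \<infinity>" for q
  proof -
    have "V q \<le> (\<integral>\<^sup>+v. ennreal Z * indicator (J q \<times> J q) v \<partial>(lborel \<Otimes>\<^sub>M lborel))"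
      unfolding V_pair
    proof (rule nn_integral_mono)
      fix v :: "real \<times> real"
      show "(ennreal (impulse_size (fst v + snd v)) * indicator (J q \<times> J q) v)\<^sup>2 \<le> ennreal Z * indicator (J q \<times> J q) v"
      proof (cases "v \<in> J q \<times> J q")
        case True
        then have "fst v + snd v > 0" using Jpos[of q] by (auto intro!: add_pos_pos)
        then have "ennreal ((impulse_size (fst v + snd v))\<^sup>2) \<le> ennreal Z"
          using impulse_size_power2 Z by (simp add: less_imp_le)
        then show ?thesis using True by (simp add: ennreal_power impulse_size_nonneg)
      qed simp
    qed
    also have "\<dots> = ennreal Z * ennreal (\<epsilon>\<^sup>2)" by (simp add: nn_integral_cmult JJ del: nn_integral_indicator)
    finally show ?thesis by (rule order.strict_trans1) (simp add: ennreal_mult_less_top)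
  qed
  have block: "(\<integral>\<^sup>+t. \<integral>\<^sup>+s. indicator (J q) t * indicator (J q) s * ennreal (impulse_size (t + s)) \<partial>lborel \<partial>lborel)
      \<le> ennreal (\<epsilon> * sqrt (enn2real (V q)))" for q
  proof -
    have "(\<integral>\<^sup>+t. \<integral>\<^sup>+s. indicator (J q) t * indicator (J q) s * ennreal (impulse_size (t + s)) \<partial>lborel \<partial>lborel)
       = (\<integral>\<^sup>+v. (ennreal (impulse_size (fst v + snd v)) * indicator (J q \<times> J q) v) * indicator (J q \<times> J q) v \<partial>(lborel \<Otimes>\<^sub>M lborel))"
      by (subst lborel.nn_integral_fst[symmetric]) (auto simp: indicator_def intro!: nn_integral_cong)
    also have "\<dots> \<le> ennreal (\<epsilon> * sqrt (enn2real (V q)))"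
    proof (rule ennreal_le_of_power2_le)
      have "(\<integral>\<^sup>+v. (ennreal (impulse_size (fst v + snd v)) * indicator (J q \<times> J q) v) * indicator (J q \<times> J q) v \<partial>(lborel \<Otimes>\<^sub>M lborel))\<^sup>2
        \<le> V q * (\<integral>\<^sup>+v. (indicator (J q \<times> J q) v)\<^sup>2 \<partial>(lborel \<Otimes>\<^sub>M lborel))"
        unfolding V_pair by (rule Cauchy_Schwarz_nn_integral) measurable
      also have "(\<integral>\<^sup>+v. (indicator (J q \<times> J q) v)\<^sup>2 \<partial>(lborel \<Otimes>\<^sub>M lborel)) = ennreal (\<epsilon>\<^sup>2)"
        unfolding JJ[symmetric, of q] by (intro nn_integral_cong) (auto simp: indicator_def)
      also have "V q * ennreal (\<epsilon>\<^sup>2) = ennreal ((\<epsilon> * sqrt (enn2real (V q)))\<^sup>2)"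
        using Vfin[of q] by (simp add: power_mult_distrib ennreal_mult mult.commute)
      finally show "(\<integral>\<^sup>+v. (ennreal (impulse_size (fst v + snd v)) * indicator (J q \<times> J q) v) * indicator (J q \<times> J q) v \<partial>(lborel \<Otimes>\<^sub>M lborel))\<^sup>2
        \<le> ennreal ((\<epsilon> * sqrt (enn2real (V q)))\<^sup>2)" .
    qed (use e in simp)
    finally show ?thesis .
  qed
  have Vk: "(\<integral>\<^sup>+v. indicator ((J q \<times> space M) \<times> (J q \<times> space M)) v * ennreal ((norm (kernel v))\<^sup>2) \<partial>(\<Omega> \<Otimes>\<^sub>M \<Omega>)) = V q" for q
    unfolding V_def by (rule kernel_block[OF Jm Jpos])
  have Jp: "J q \<in> sets pos_time" for q
    unfolding pos_time_def using Jpos Jm by (simp add: sets_restrict_space_iff)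
  have "ennreal (\<Sum>q<n. sqrt (enn2real (\<integral>\<^sup>+v. indicator ((J q \<times> space M) \<times> (J q \<times> space M)) v * ennreal ((norm (kernel v))\<^sup>2) \<partial>(\<Omega> \<Otimes>\<^sub>M \<Omega>))))
      \<le> trace_norm \<Omega> \<Omega> hankel_diff"
  proof (rule T.trace_norm_ge_sum_blocks)
    show "J q \<times> space M \<in> sets \<Omega>" for q using Jp by simp
    show "emeasure \<Omega> (J q \<times> space M) < \<infinity>" for q
      using Jp[of q] Jpos[of q] by (simp add: X.emeasure_pair_measure_Times X.emeasure_space_1)
        (simp add: pos_time_def emeasure_restrict_space Jl)
    show "disjoint_family_on (\<lambda>q. J q \<times> space M) {..<n}"
    proof -
      have "J p \<inter> J q = {}" if "p < q" for p q
      proof -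
        have "real (Suc p) * \<epsilon> \<le> real q * \<epsilon>" using that e by (intro mult_right_mono) auto
        then have "a + real p * \<epsilon> + \<epsilon> \<le> a + real q * \<epsilon>" by (simp add: algebra_simps)
        then show ?thesis unfolding J_def by auto
      qed
      then have "J p \<inter> J q = {}" if "p \<noteq> q" for p q
        using that by (metis inf_commute nat_neq_iff)
      then show ?thesis unfolding disjoint_family_on_def by blast
    qed
  qed (use Vfin Vk in auto)
  then have TN: "ennreal (\<Sum>q<n. sqrt (enn2real (V q))) \<le> trace_norm \<Omega> \<Omega> hankel_diff" unfolding Vk .
  have "(\<Sum>q<n. \<integral>\<^sup>+t. \<integral>\<^sup>+s. indicator (J q) t * indicator (J q) s * ennreal (impulse_size (t + s)) \<partial>lborel \<partial>lborel)
      \<le> (\<Sum>q<n. ennreal (\<epsilon> * sqrt (enn2real (V q))))"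
    by (intro sum_mono block)
  also have "\<dots> = ennreal \<epsilon> * ennreal (\<Sum>q<n. sqrt (enn2real (V q)))"
    using e by (simp add: sum_ennreal ennreal_mult[symmetric] sum_nonneg sum_distrib_left)
  also have "\<dots> \<le> ennreal \<epsilon> * trace_norm \<Omega> \<Omega> hankel_diff" by (intro mult_left_mono TN) auto
  finally show "(\<Sum>q<n. \<integral>\<^sup>+t. \<integral>\<^sup>+s. indicator {a + real q * \<epsilon><..a + real q * \<epsilon> + \<epsilon>} t * indicator {a + real q * \<epsilon><..a + real q * \<epsilon> + \<epsilon>} s * ennreal (impulse_size (t + s)) \<partial>lborel \<partial>lborel)
      \<le> ennreal \<epsilon> * trace_norm \<Omega> \<Omega> hankel_diff"
    unfolding J_def .
qed

text \<open>The observation moves inside the time integral and expectation is exchanged with time.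
  Homogeneity bounds the integrand at time \<open>s\<close> by \<open>impulse_size (t - s)\<close>
  times the norm of the control; reflecting time gives the integral of
  \<open>impulse_size\<close>.\<close>

lemma output_error_le:
  fixes u :: "real \<Rightarrow> 'a \<Rightarrow> real^'n"
  assumes u: "u \<in> H2 M F" and t: "t > 0"
  shows "(\<integral>\<^sup>+w. ennreal (norm (C (state_resp Phi psi u t w) - C' (state_resp Phi' psi' u t w))) \<partial>M)
    \<le> 2 * trace_norm \<Omega> \<Omega> hankel_diff * ennreal (H2_norm M u)"
proof -
  let ?R = "restrict_space lborel {0<..t}"
  interpret R: sigma_finite_measure ?R
    by (rule sigma_finite_measure_restrict_space) (auto intro: sigma_finite_lborel)
  interpret P: pair_sigma_finite ?R M ..
  let ?x = "\<lambda>s w. Phi t s w (input_op psi (u s w))" and ?y = "\<lambda>s w. Phi' t s w (input_op psi' (u s w))"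
  let ?g = "\<lambda>s w. C (?x s w) - C' (?y s w)"
  note [measurable] = X.state_resp_integrable(2)[OF u t, of psi] Y.state_resp_integrable(2)[OF u t, of psi']
  have gm: "(\<lambda>(s, w). ennreal (norm (?g s w))) \<in> borel_measurable (?R \<Otimes>\<^sub>M M)"
    unfolding case_prod_unfold by measurable
  have resp: "state_resp Phi psi u t w = (\<integral>s. ?x s w \<partial>?R)" "state_resp Phi' psi' u t w = (\<integral>s. ?y s w \<partial>?R)" for w
    unfolding state_resp_def set_lebesgue_integral_def by (simp_all add: integral_restrict_space)
  have "(\<integral>\<^sup>+w. ennreal (norm (C (state_resp Phi psi u t w) - C' (state_resp Phi' psi' u t w))) \<partial>M)
      \<le> (\<integral>\<^sup>+w. \<integral>\<^sup>+s. ennreal (norm (?g s w)) \<partial>?R \<partial>M)"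
  proof (rule nn_integral_mono_AE)
    show "AE w in M. ennreal (norm (C (state_resp Phi psi u t w) - C' (state_resp Phi' psi' u t w)))
        \<le> (\<integral>\<^sup>+s. ennreal (norm (?g s w)) \<partial>?R)"
      using X.state_resp_integrable(1)[OF u t, of psi] Y.state_resp_integrable(1)[OF u t, of psi']
    proof eventually_elim
      case (elim w)
      have i: "integrable ?R (\<lambda>s. C (?x s w))" "integrable ?R (\<lambda>s. C' (?y s w))"
        by (rule integrable_bounded_linear[OF C elim(1)], rule integrable_bounded_linear[OF C' elim(2)])
      have "C (state_resp Phi psi u t w) - C' (state_resp Phi' psi' u t w) = (\<integral>s. ?g s w \<partial>?R)"
        unfolding resp Bochner_Integration.integral_diff[OF i]
        by (simp add: integral_bounded_linear[OF C elim(1)] integral_bounded_linear[OF C' elim(2)])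
      then show ?case
        using integral_norm_bound_ennreal[OF Bochner_Integration.integrable_diff[OF i]] by simp
    qed
  qed
  also have "\<dots> = (\<integral>\<^sup>+s. \<integral>\<^sup>+w. ennreal (norm (?g s w)) \<partial>M \<partial>?R)"
    by (rule P.Fubini'[OF gm])
  also have "\<dots> \<le> (\<integral>\<^sup>+s. ennreal (H2_norm M u) * (indicator {0<..} (t - s) * ennreal (impulse_size (t - s))) \<partial>?R)"
  proof (rule nn_integral_mono_AE)
    \<comment> \<open>At \<open>s = t\<close> the right side is 0 because
      \<open>impulse_size 0 = 0\<close>, while the left side may be positive; the single point has
      measure zero.\<close>
    have "AE s in ?R. s \<noteq> t"
      by (subst AE_restrict_space_iff) (auto intro: AE_mp[OF AE_lborel_singleton[of t]])
    then show "AE s in ?R. (\<integral>\<^sup>+w. ennreal (norm (?g s w)) \<partial>M)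
        \<le> ennreal (H2_norm M u) * (indicator {0<..} (t - s) * ennreal (impulse_size (t - s)))"
      using AE_space
    proof eventually_elim
      case (elim s)
      then have s: "0 < s" "s < t" "0 \<le> s" "s \<le> t" by (auto simp: space_restrict_space)
      have usm: "u s \<in> borel_measurable M"
      proof -
        have "(\<lambda>(t, w). u t w) \<in> borel_measurable \<Omega>"
          using u unfolding H2_def Omega_pos_eq by simp
        from measurable_compose[OF measurable_Pair1'[of s] this] s show ?thesis by simp
      qed
      note [measurable] = X.measurable_Phi[OF s(3,4)] Y.measurable_Phi[OF s(3,4)]
      let ?d = "\<lambda>i w. C (Phi t s w (psi i)) - C' (Phi' t s w (psi' i))"
      have "(\<integral>\<^sup>+w. ennreal (norm (?g s w)) \<partial>M) = (\<integral>\<^sup>+w. ennreal (norm (\<Sum>i\<in>UNIV. u s w $ i *\<^sub>R ?d i w)) \<partial>M)"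
      proof (rule nn_integral_cong)
        fix w assume w: "w \<in> space M"
        have lin: "linear (Phi t s w)" "linear (Phi' t s w)" "linear C" "linear C'"
          using w s C C' by (auto intro!: bounded_linear.linear X.linear_Phi Y.linear_Phi)
        have "?g s w = (\<Sum>i\<in>UNIV. u s w $ i *\<^sub>R ?d i w)"
          unfolding input_op_def by (simp add: linear_sum[OF lin(1)] linear_scale[OF lin(1)] linear_sum[OF lin(2)] linear_scale[OF lin(2)]
            linear_sum[OF lin(3)] linear_scale[OF lin(3)] linear_sum[OF lin(4)] linear_scale[OF lin(4)] scaleR_diff_right sum_subtractf)
        then show "ennreal (norm (?g s w)) = ennreal (norm (\<Sum>i\<in>UNIV. u s w $ i *\<^sub>R ?d i w))" by simp
      qed
      also have "\<dots> \<le> ennreal (impulse_size (t - s) * H2_norm M u)"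
      proof (rule nn_integral_norm_lincomb_le[OF usm _ _ H2_norm_bound(1)[OF u s(1)] impulse_size_nonneg H2_norm_bound(2)[OF u s(1)]])
        show "(\<lambda>w. norm (?d i w)) \<in> borel_measurable M" for i by measurable
        have "(\<integral>\<^sup>+w. ennreal ((norm (?d i w))\<^sup>2) \<partial>M)
           = (\<integral>\<^sup>+w. ennreal ((norm (C (Phi (t - s) 0 w (psi i)) - C' (Phi' (t - s) 0 w (psi' i))))\<^sup>2) \<partial>M)" for i
        proof -
          have "(\<lambda>v. ennreal ((norm (C (fst v) - C' (snd v)))\<^sup>2)) \<in> borel_measurable (borel \<Otimes>\<^sub>M borel)" by measurable
          from nn_integral_pair_homogeneous[OF _ s(3) this, of "t - s" "psi i" "psi' i"] show ?thesis using s by simp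
        qed
        then show "(\<Sum>i\<in>UNIV. \<integral>\<^sup>+w. ennreal ((norm (?d i w))\<^sup>2) \<partial>M) \<le> ennreal ((impulse_size (t - s))\<^sup>2)"
          using s by (simp add: impulse_size_power2 impulse_energy_def)
      qed
      finally show ?case
        using s H2_norm_bound(2)[OF u s(1)] by (simp add: ennreal_mult impulse_size_nonneg mult.commute)
    qed
  qed
  also have "\<dots> \<le> (\<integral>\<^sup>+s. ennreal (H2_norm M u) * (indicator {0<..} (t - s) * ennreal (impulse_size (t - s))) \<partial>lborel)"
    by (subst nn_integral_restrict_space) (auto intro!: nn_integral_mono simp: indicator_def)
  also have "\<dots> = ennreal (H2_norm M u) * (\<integral>\<^sup>+s. indicator {0<..} (t - s) * ennreal (impulse_size (t - s)) \<partial>lborel)"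
    by (intro nn_integral_cmult) measurable
  also have "(\<integral>\<^sup>+s. indicator {0<..} (t - s) * ennreal (impulse_size (t - s)) \<partial>lborel)
      = (\<integral>\<^sup>+r. indicator {0<..} r * ennreal (impulse_size r) \<partial>lborel)"
    using nn_integral_real_affine[of "\<lambda>r. indicator {0<..} r * ennreal (impulse_size r)" "-1" t] by simp
  also have "ennreal (H2_norm M u) * \<dots> \<le> ennreal (H2_norm M u) * (2 * trace_norm \<Omega> \<Omega> hankel_diff)"
    by (intro mult_left_mono impulse_size_integral_le) auto
  finally show ?thesis by (simp add: mult.commute)
qed

end

theorem theorem1p6:
  fixes M :: "'a measure" and F :: "real \<Rightarrow> 'a measure"
    and Phi :: "real \<Rightarrow> real \<Rightarrow> 'a \<Rightarrow> 'x::{real_inner,banach,second_countable_topology} \<Rightarrow> 'x"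
    and psi :: "'n::finite \<Rightarrow> 'x" and C :: "'x \<Rightarrow> real^'m::finite"
    and Phi' :: "real \<Rightarrow> real \<Rightarrow> 'a \<Rightarrow> 'y::{real_inner,banach,second_countable_topology} \<Rightarrow> 'y"
    and psi' :: "'n \<Rightarrow> 'y" and C' :: "'y \<Rightarrow> real^'m"
    and u :: "real \<Rightarrow> 'a \<Rightarrow> real^'n"
  assumes "prob_space M" and "usual_filtration M F"
    and "stoch_flow M F Phi" and "bounded_linear C"
    and "stoch_flow M F Phi'" and "bounded_linear C'"
    and "flows_indep M Phi Phi'"
    and "ms_exp_stable M Phi" and "ms_exp_stable M Phi'"
    and "markov_sg M Phi" and "markov_sg M Phi'"
    and "u \<in> H2 M F"
  shows "(SUP t\<in>{0<..}. \<integral>\<^sup>+ w. ennreal (norm (C (state_resp Phi psi u t w) - C' (state_resp Phi' psi' u t w))) \<partial>M)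
         \<le> 2 * trace_norm (Omega_pos M) (Omega_pos M) (\<lambda>f. (\<lambda>z. hankel M Phi psi C f z - hankel M Phi' psi' C' f z))
             * ennreal (H2_norm M u)"
proof -
  interpret prob_space M by fact
  interpret S: system_pair M F Phi Phi' psi C psi' C'
    by (intro system_pair.intro stable_flow_pair.intro stable_flow.intro stable_flow_axioms.intro
        stable_flow_pair_axioms.intro system_pair_axioms.intro assms)
  have "S.hankel_diff = (\<lambda>f z. hankel M Phi psi C f z - hankel M Phi' psi' C' f z)"
    by (simp add: S.hankel_diff_def fun_eq_iff)
  then show ?thesis
    using S.output_error_le[OF assms(12)] unfolding Omega_pos_eq by (auto intro!: SUP_least)
qed

end
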